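(* [Hodge decomposition] Every 1-form $\omega\in\mathcal H$ can be uniquely decomposed as an orthogonal sum $\omega=dU_E\oplus\omega_H$ of an exact form $dU_E$ ($U_E\in\mathcal F$) and a harmonic form $\omega_H$. The forms $dz_\sigma$, $\sigma\in\Sigma$, give an orthogonal basis of the (Hilbert) space of harmonic forms; therefore the decomposition may be written as $\omega=dU_E+\sum_{\sigma\in\Sigma}k_\sigma\,dz_\sigma$ with real coefficients $k_\sigma$ (convergence in $\mathcal H$).
   Context: Sierpinski gasket: $p_0=(0,0)$, $p_1=(\frac12,\frac{\sqrt3}2)$, $p_2=(1,0)$, $w_i(x)=p_i+\frac12(x-p_i)$, and $K\subset\mathbb R^2$ is the unique nonempty compact set with $K=\bigcup_{i=0}^2w_i(K)$. $\Sigma=\bigcup_m\{0,1,2\}^m$ is the set of finite words, $|\sigma|$ the length, $w_\sigma=w_{\sigma_1}\circ\dots\circ w_{\sigma_m}$. Cells: $C_\sigma=w_\sigma(K)$. $E_0$ is the set of sides of the triangle $p_0p_1p_2$, $E_m=\bigcup_{|\sigma|=m}w_\sigma(E_0)$, $E_*=\bigcup_mE_m$. An oriented edge $e$ has source $e_-$, target $e_+$. $\ell_\emptyset$ is the boundary of the triangle whose vertices are the midpoints of the sides of $p_0p_1p_2$; the lacunas are $\ell_\sigma=w_\sigma(\ell_\emptyset)$, traversed clockwise. Energy: for real-valued $f\in C(K)$, $\mathcal E[f]=\lim_{m}(5/3)^m\sum_{e\in E_m}|f(e_+)-f(e_-)|^2$; $\mathcal F=\{f\in C(K):\mathcal E[f]<\infty\}$,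 an algebra; $\mathcal E(\cdot,\cdot)$ the bilinear form; for a function $f$ on a cell $C$, $\mathcal E_C[f]$ is the same limit with the sum over edges contained in $C$. The energy measure $\mu(f,g)$ is given by $\int_Kh\,d\mu(f,g)=\frac12(\mathcal E(f,gh)-\mathcal E(fg,h)+\mathcal E(hf,g))$. Forms: $\Omega^1(\mathcal F)\subset\mathcal F\otimes\mathcal F$ is the $\mathcal F$-bimodule generated by the elements $f\,dg$, $dg=g\otimes1-1\otimes g$; $Q(f\,dg,h\,dk)=\int_Kfh\,d\mu(g,k)$ extended bilinearly; $\mathcal H$ is the Hilbert space obtained from $(\Omega^1(\mathcal F),Q)$ by separation and completion, and $\Omega^1(K)=\Omega^1(\mathcal F)/\{Q=0\}\subset\mathcal H$. An elementary path is a finite concatenation of consecutive oriented edges in $E_*$; for $\omega=\sum_if_i\,dg_i$, $\int_\gamma\omega=\lim_n\sum_{e}\sum_if_i(e_+)(g_i(e_+)-g_i(e_-))$, the sum over the level-$n$ edges $e$ of $\gamma$ oriented as $\gamma$; this limit exists and depends only on the class of $\omega$ in $\Omega^1(K)$. A form is exact if it is $dU$ with $U\in\mathcal F$. $n$-exact forms: $\omega\in\Omega^1(K)$ is $n$-exact if for every $|\sigma|=n$ there is a continuous $f_\sigma:C_\sigma\to\mathbb R$ with $\mathcal E_{C_\sigma}[f_\sigma]<\infty$ and $\int_\gamma\omega=f_\sigma(\gamma(1))-f_\sigma(\gamma(0))$ for all elementary paths $\gamma\subset C_\sigma$ (local potentials). The forms $dz_\sigma$: for $|\sigma|=n$, $dz_\sigma$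 is the $(n+1)$-exact form minimizing $Q^{1/2}$ among the $(n+1)$-exact $\omega$ with $\int_{\ell_\sigma}\omega=1$. Explicitly, it vanishes on $C_\tau$ for $|\tau|=n,\tau\ne\sigma$, and on $C_{\sigma i}$ its local potential is the harmonic function (energy minimizer given its values at the three vertices of $C_{\sigma i}$) equal to $0$ at $w_\sigma(p_i)$ and to $\pm\frac16$ at the other two vertices, with signs such that its increment along the side of $\ell_\sigma$ in $C_{\sigma i}$, traversed clockwise, is $+\frac13$. Harmonic forms: a form in $\mathcal H$ is co-closed if it is orthogonal to all exact forms. All 1-forms on $K$ are regarded as closed (the exterior differential on 1-forms is zero), so a harmonic form is a co-closed element of $\mathcal H$. *)

theory Defs
  imports "HOL-Analysis.Analysis"
begin

section \<open>The Sierpinski gasket\<close>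

type_synonym pt = "real \<times> real"

definition vtx :: "nat \<Rightarrow> pt" where
  "vtx i = (if i = 0 then (0, 0) else if i = 1 then (1/2, sqrt 3 / 2) else (1, 0))"

definition contr :: "nat \<Rightarrow> pt \<Rightarrow> pt" where
  "contr i x = vtx i + (1/2) *\<^sub>R (x - vtx i)"

definition gasket :: "pt set" where
  "gasket = (THE K. compact K \<and> K \<noteq> {} \<and> K = (\<Union>i\<in>{0,1,2}. contr i ` K))"

definition gwords :: "nat list set" where
  "gwords = lists {0,1,2}"

definition contr_word :: "nat list \<Rightarrow> pt \<Rightarrow> pt" where
  "contr_word \<sigma> = foldr (\<lambda>i g. contr i \<circ> g) \<sigma> id"

definition cell :: "nat list \<Rightarrow> pt set" where
  "cell \<sigma> = contr_word \<sigma> ` gasket"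


section \<open>Edges and elementary paths\<close>

text \<open>
  An edge is given by its pair (source, target). The set \<open>edges m\<close> contains every (unoriented)
  edge of level \<open>m\<close> exactly once, with an arbitrary fixed orientation; \<open>oriented_edges m\<close> contains
  both orientations.
\<close>

definition edges :: "nat \<Rightarrow> (pt \<times> pt) set" where
  "edges m = {(contr_word \<sigma> a, contr_word \<sigma> b) | \<sigma> a b.
     \<sigma> \<in> gwords \<and> length \<sigma> = m \<and> (a, b) \<in> {(vtx 0, vtx 1), (vtx 1, vtx 2), (vtx 2, vtx 0)}}"

definition oriented_edges :: "nat \<Rightarrow> (pt \<times> pt) set" where
  "oriented_edges m = edges m \<union> (edges m)\<inverse>"

definition elementary_path :: "(pt \<times> pt) list \<Rightarrow> bool" where
  "elementary_path \<gamma> \<longleftrightarrow> \<gamma> \<noteq> [] \<and> set \<gamma> \<subseteq> (\<Union>m. oriented_edges m) \<and>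
     successively (\<lambda>e e'. snd e = fst e') \<gamma>"

definition path_start :: "(pt \<times> pt) list \<Rightarrow> pt" where
  "path_start \<gamma> = fst (hd \<gamma>)"

definition path_end :: "(pt \<times> pt) list \<Rightarrow> pt" where
  "path_end \<gamma> = snd (last \<gamma>)"

definition path_support :: "(pt \<times> pt) list \<Rightarrow> pt set" where
  "path_support \<gamma> = (\<Union>(a, b)\<in>set \<gamma>. closed_segment a b)"

text \<open>The level-\<open>n\<close> edges into which an oriented edge is subdivided, oriented in the same way.\<close>

definition subedges :: "nat \<Rightarrow> pt \<times> pt \<Rightarrow> (pt \<times> pt) set" where
  "subedges n e = {(x, y) \<in> oriented_edges n.
     closed_segment x y \<subseteq> closed_segment (fst e) (snd e) \<and> inner (y - x) (snd e - fst e) > 0}"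

text \<open>
  The boundary of the central triangle, traversed clockwise: from the midpoint of \<open>p\<^sub>0p\<^sub>1\<close> to
  that of \<open>p\<^sub>1p\<^sub>2\<close>, to that of \<open>p\<^sub>0p\<^sub>2\<close>, and back. The similarities preserve orientation.
\<close>

definition lacuna :: "nat list \<Rightarrow> (pt \<times> pt) list" where
  "lacuna \<sigma> = map (map_prod (contr_word \<sigma>) (contr_word \<sigma>))
     [(midpoint (vtx 0) (vtx 1), midpoint (vtx 1) (vtx 2)),
      (midpoint (vtx 1) (vtx 2), midpoint (vtx 0) (vtx 2)),
      (midpoint (vtx 0) (vtx 2), midpoint (vtx 0) (vtx 1))]"


section \<open>Energy\<close>

text \<open>
  Functions on a subset of the plane (the gasket or a cell) are modelled by functions on the whole
  plane; the values outside the subset never matter. The sequences whose limits define the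
  energies are nondecreasing, so the limits exist in \<open>[0,\<infinity>]\<close>.
\<close>

definition energy :: "(pt \<Rightarrow> real) \<Rightarrow> ennreal" where
  "energy f = lim (\<lambda>m. ennreal ((5/3)^m * (\<Sum>(a, b)\<in>edges m. \<bar>f b - f a\<bar>\<^sup>2)))"

definition cell_energy :: "pt set \<Rightarrow> (pt \<Rightarrow> real) \<Rightarrow> ennreal" where
  "cell_energy C f = lim (\<lambda>m. ennreal ((5/3)^m *
     (\<Sum>(a, b)\<in>{(a, b) \<in> edges m. closed_segment a b \<subseteq> C}. \<bar>f b - f a\<bar>\<^sup>2)))"

definition finite_energy_fns :: "(pt \<Rightarrow> real) set" where
  "finite_energy_fns = {f. continuous_on gasket f \<and> energy f < \<infinity>}"

definition energy_form :: "(pt \<Rightarrow> real) \<Rightarrow> (pt \<Rightarrow> real) \<Rightarrow> real" where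
  "energy_form f g =
     (enn2real (energy (\<lambda>x. f x + g x)) - enn2real (energy (\<lambda>x. f x - g x))) / 4"

text \<open>
  \<open>energy_measure_integral f g h\<close> is the integral of \<open>h\<close> against the (signed) energy measure
  \<open>\<mu>(f,g)\<close>. That measure is given by this functional of \<open>h\<close> in the uniformly dense algebra
  \<open>finite_energy_fns\<close>, and only integrands from this algebra occur below.
\<close>

definition energy_measure_integral ::
    "(pt \<Rightarrow> real) \<Rightarrow> (pt \<Rightarrow> real) \<Rightarrow> (pt \<Rightarrow> real) \<Rightarrow> real" where
  "energy_measure_integral f g h =
     (energy_form f (\<lambda>x. g x * h x) - energy_form (\<lambda>x. f x * g x) h
       + energy_form (\<lambda>x. h x * f x) g) / 2"


section \<open>Differential forms\<close>

text \<open>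
  The tensor product of the function algebra with itself is realised as functions of two
  variables, \<open>f \<otimes> g\<close> being \<open>(x, y) \<mapsto> f x * g y\<close> (this identification is injective). The left
  action multiplies in the first variable and the right action in the second; the element
  \<open>f dg = f (g \<otimes> 1 - 1 \<otimes> g)\<close> is \<open>(x, y) \<mapsto> f x * (g x - g y)\<close>.
\<close>

type_synonym form = "pt \<times> pt \<Rightarrow> real"

definition fdg :: "(pt \<Rightarrow> real) \<Rightarrow> (pt \<Rightarrow> real) \<Rightarrow> form" where
  "fdg f g = (\<lambda>(x, y). f x * (g x - g y))"

inductive_set one_forms :: "form set" where
  gen: "f \<in> finite_energy_fns \<Longrightarrow> g \<in> finite_energy_fns \<Longrightarrow> fdg f g \<in> one_forms"
| add: "\<omega> \<in> one_forms \<Longrightarrow> \<eta> \<in> one_forms \<Longrightarrow> (\<lambda>z. \<omega> z + \<eta> z) \<in> one_forms"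
| left: "f \<in> finite_energy_fns \<Longrightarrow> \<omega> \<in> one_forms \<Longrightarrow> (\<lambda>(x, y). f x * \<omega> (x, y)) \<in> one_forms"
| right: "f \<in> finite_energy_fns \<Longrightarrow> \<omega> \<in> one_forms \<Longrightarrow> (\<lambda>(x, y). \<omega> (x, y) * f y) \<in> one_forms"

text \<open>
  A Hilbert space \<open>'h\<close> together with a map \<open>\<iota>\<close> from \<open>one_forms\<close> is the separation and completion
  of \<open>(one_forms, Q)\<close> iff \<open>\<iota>\<close> is linear, has dense range, and carries \<open>Q\<close> to the inner product.
  Since \<open>\<iota>\<close> is linear, prescribing \<open>Q(f dg, h dk) = \<integral> f h d\<mu>(g,k)\<close> prescribes its bilinear
  extension. The kernel of \<open>\<iota>\<close> is \<open>{Q = 0}\<close>, the range of \<open>\<iota>\<close> is the quotient of \<open>one_forms\<close>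
  by this kernel, and \<open>norm (\<iota> \<omega>)\<close> is \<open>Q\<close> of \<open>\<omega>\<close> to the power \<open>1/2\<close>.
\<close>

definition form_completion :: "(form \<Rightarrow> 'h::{real_inner, complete_space}) \<Rightarrow> bool" where
  "form_completion \<iota> \<longleftrightarrow>
     (\<forall>\<omega>\<in>one_forms. \<forall>\<eta>\<in>one_forms. \<forall>a b.
        \<iota> (\<lambda>z. a * \<omega> z + b * \<eta> z) = a *\<^sub>R \<iota> \<omega> + b *\<^sub>R \<iota> \<eta>) \<and>
     (\<forall>f\<in>finite_energy_fns. \<forall>g\<in>finite_energy_fns.
      \<forall>h\<in>finite_energy_fns. \<forall>k\<in>finite_energy_fns.
        inner (\<iota> (fdg f g)) (\<iota> (fdg h k)) = energy_measure_integral g k (\<lambda>x. f x * h x)) \<and>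
     closure (\<iota> ` one_forms) = UNIV"

text \<open>
  For \<open>\<omega> = \<Sum>\<^sub>i f\<^sub>i dg\<^sub>i\<close> and an edge from \<open>x\<close> to \<open>y\<close>, the value \<open>\<omega> (y, x)\<close> is
  \<open>\<Sum>\<^sub>i f\<^sub>i(y) (g\<^sub>i(y) - g\<^sub>i(x))\<close>. Edges occurring several times in the path are counted with
  multiplicity.
\<close>

definition form_integral :: "(pt \<times> pt) list \<Rightarrow> form \<Rightarrow> real" where
  "form_integral \<gamma> \<omega> = lim (\<lambda>n. \<Sum>e\<leftarrow>\<gamma>. \<Sum>(x, y)\<in>subedges n e. \<omega> (y, x))"

text \<open>
  \<open>n\<close>-exactness is stated for representatives; path integrals, hence \<open>n\<close>-exactness, depend only
  on the class of the form modulo \<open>{Q = 0}\<close>.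
\<close>

definition locally_exact :: "nat \<Rightarrow> form \<Rightarrow> bool" where
  "locally_exact n \<omega> \<longleftrightarrow> \<omega> \<in> one_forms \<and>
     (\<forall>\<sigma>\<in>gwords. length \<sigma> = n \<longrightarrow>
        (\<exists>f. continuous_on (cell \<sigma>) f \<and> cell_energy (cell \<sigma>) f < \<infinity> \<and>
          (\<forall>\<gamma>. elementary_path \<gamma> \<and> path_support \<gamma> \<subseteq> cell \<sigma> \<longrightarrow>
             form_integral \<gamma> \<omega> = f (path_end \<gamma>) - f (path_start \<gamma>))))"

definition dz_competitors :: "nat list \<Rightarrow> form set" where
  "dz_competitors \<sigma> =
     {\<omega>. locally_exact (length \<sigma> + 1) \<omega> \<and> form_integral (lacuna \<sigma>) \<omega> = 1}"

definition dz :: "(form \<Rightarrow> 'h::{real_inner, complete_space}) \<Rightarrow> nat list \<Rightarrow> 'h" where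
  "dz \<iota> \<sigma> = (THE \<theta>. \<exists>\<omega>\<in>dz_competitors \<sigma>. \<theta> = \<iota> \<omega> \<and>
     (\<forall>\<eta>\<in>dz_competitors \<sigma>. norm (\<iota> \<omega>) \<le> norm (\<iota> \<eta>)))"


section \<open>Exact and harmonic forms\<close>

definition exact_form :: "(form \<Rightarrow> 'h::{real_inner, complete_space}) \<Rightarrow> (pt \<Rightarrow> real) \<Rightarrow> 'h" where
  "exact_form \<iota> U = \<iota> (fdg (\<lambda>_. 1) U)"

definition exact_forms :: "(form \<Rightarrow> 'h::{real_inner, complete_space}) \<Rightarrow> 'h set" where
  "exact_forms \<iota> = exact_form \<iota> ` finite_energy_fns"

definition co_closed :: "(form \<Rightarrow> 'h::{real_inner, complete_space}) \<Rightarrow> 'h \<Rightarrow> bool" where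
  "co_closed \<iota> \<theta> \<longleftrightarrow> (\<forall>\<eta>\<in>exact_forms \<iota>. inner \<theta> \<eta> = 0)"

text \<open>The exterior differential on 1-forms is zero, so harmonic means co-closed.\<close>

definition harmonic_forms :: "(form \<Rightarrow> 'h::{real_inner, complete_space}) \<Rightarrow> 'h set" where
  "harmonic_forms \<iota> = {\<theta>. co_closed \<iota> \<theta>}"

end

theory Submission
  imports Defs
begin

text \<open>
  The inner product of two one-forms is the limit of renormalised sums of products of their integrals
  over the edges of level \<open>m\<close>: replacing \<open>\<omega>(y, x)\<close> by the integral over the edge changes
  the \<open>\<ell>\<^sup>1\<close> norm at level \<open>m\<close> by only \<open>O((3/5)\<^sup>m)\<close>. Hence a form with local
  potentials is determined by them, and its norm is given by their energies. Since the potentials of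
  \<open>dz\<^sub>\<sigma>\<close> are harmonic, its product with an \<open>(n+1)\<close>-exact form is \<open>(5/3)\<^sup>n\<^sup>+\<^sup>1 / 2\<close> times the
  period of that form around \<open>\<ell>\<^sub>\<sigma>\<close>, where \<open>n = |\<sigma>|\<close>. This identity shows that
  \<open>dz\<^sub>\<sigma>\<close> is the minimiser, and that it is orthogonal to the exact forms and to the other \<open>dz\<^sub>\<tau>\<close>.
  Finally, locally exact forms are dense, and are combinations of exact forms and of the
  \<open>dz\<^sub>\<sigma>\<close>: once the periods around the lacunas of the last level have been removed, the local
  potentials can be glued to potentials on the next coarser cells. The space of exact forms is closed
  because the energy controls the supremum norm of functions vanishing at \<open>p\<^sub>0\<close>.
\<close>

section \<open>The gasket and its cells\<close>

text \<open>The form Q sees a one-form through sums over edges, exactness sees it through path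
  integrals. The two can be compared because halving an edge changes the Riemann sum of f dg by a
  product of two increments. Over level m these defects total O((3/5)^m), which only balances the
  weight (5/3)^m; the margin comes from the single edge values, each O(sqrt(3/5)^m). The main
  obstacle is existence. Potentials on neighbouring cells may disagree at a shared vertex, yet they
  must come from a finite sum of terms f dg with f and g continuous on all of K. Nested bumps at the
  vertex resolve this: \<phi> is 1 wherever \<psi> does not vanish, so \<phi> d\<psi> = d\<psi> in
  one cell, while \<psi> d\<phi> = 0 in the cell across the vertex. The values 0, 1/6, -1/6 of a
  potential of \<open>dz\<close> have discrete normal derivatives 0, 1/2, -1/2. Its energy against
  another potential is therefore half the increment of the latter along the side of the lacuna; this
  is the 1/2 in the product formula, and (5/3)^(n+1) is the energy scaling of cells of level
  n+1.\<close>

lemma contr_eq: "contr i x = (1/2) *\<^sub>R (vtx i + x)"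
  by (simp add: contr_def prod_eq_iff field_simps)

lemma contr_word_Nil [simp]: "contr_word [] = id"
  by (simp add: contr_word_def)

lemma contr_word_Cons: "contr_word (i # \<sigma>) x = contr i (contr_word \<sigma> x)"
  by (simp add: contr_word_def)

lemma contr_word_append: "contr_word (\<sigma> @ \<tau>) x = contr_word \<sigma> (contr_word \<tau> x)"
  by (induction \<sigma>) (simp_all add: contr_word_Cons)

text \<open>All three contractions have linear part one half the identity, so every
  \<open>contr_word \<sigma>\<close> is a homothety. Injectivity, segments, midpoints and signs of
  inner products all come from this normal form.\<close>

lemma contr_word_affine: "contr_word \<sigma> x = contr_word \<sigma> 0 + ((1/2) ^ length \<sigma>) *\<^sub>R x"
proof (induction \<sigma>)
  case (Cons i \<sigma>)
  show ?case
    by (subst contr_word_Cons, subst Cons, subst contr_word_Cons) (simp add: contr_eq algebra_simps)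
qed simp

lemma contr_word_diff:
  "contr_word \<sigma> x - contr_word \<sigma> y = ((1/2) ^ length \<sigma>) *\<^sub>R (x - y)"
  by (subst (1 2) contr_word_affine) (simp add: algebra_simps)

lemma contr_word_inject [simp]: "contr_word \<sigma> x = contr_word \<sigma> y \<longleftrightarrow> x = y"
  using contr_word_diff[of \<sigma> x y] by auto

lemma contr_word_midpoint:
  "contr_word \<sigma> (midpoint x y) = midpoint (contr_word \<sigma> x) (contr_word \<sigma> y)"
  by (subst (1 2 3) contr_word_affine) (simp add: midpoint_def prod_eq_iff field_simps)

lemma contr_word_single: "contr_word [i] = contr i"
  by (rule ext) (simp add: contr_word_Cons)

lemma contr_inject [simp]: "contr i x = contr i y \<longleftrightarrow> x = y"
  using contr_word_inject[of "[i]" x y] by (simp add: contr_word_single)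

lemma dist_contr: "dist (contr i x) (contr i y) = dist x y / 2"
  by (simp add: contr_def dist_norm flip: scaleR_diff_right)

lemma continuous_on_contr_word: "continuous_on S (contr_word \<sigma>)"
proof -
  have "continuous_on S (\<lambda>x. contr_word \<sigma> 0 + ((1/2) ^ length \<sigma>) *\<^sub>R x)"
    by (intro continuous_intros)
  then show ?thesis by (simp only: flip: contr_word_affine)
qed

lemma continuous_on_contr: "continuous_on S (contr i)"
  using continuous_on_contr_word[of S "[i]"] by (simp add: contr_word_single)

lemma contr_word_convex:
  "contr_word \<sigma> ((1 - t) *\<^sub>R a + t *\<^sub>R b) = (1 - t) *\<^sub>R contr_word \<sigma> a + t *\<^sub>R contr_word \<sigma> b"
  by (subst (1 2 3) contr_word_affine) (simp add: algebra_simps)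

lemma contr_word_segment:
  "closed_segment (contr_word \<sigma> a) (contr_word \<sigma> b) = contr_word \<sigma> ` closed_segment a b"
  by (auto simp: closed_segment_def image_iff simp flip: contr_word_convex)

section \<open>Barycentric coordinates with respect to p_0, p_1, p_2\<close>

definition bary :: "nat \<Rightarrow> pt \<Rightarrow> real" where
  "bary i x = (if i = 0 then 1 - fst x - snd x / sqrt 3
     else if i = 1 then 2 * snd x / sqrt 3 else fst x - snd x / sqrt 3)"

lemma less3: "i < 3 \<longleftrightarrow> i = 0 \<or> i = 1 \<or> i = (2::nat)"
  by auto

lemma set012: "{0, 1, 2} = {..<3::nat}"
  by auto

lemma bary_vtx: "i < 3 \<Longrightarrow> j < 3 \<Longrightarrow> bary j (vtx i) = of_bool (i = j)"
  by (auto simp: less3 bary_def vtx_def)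

lemma bary_contr: "bary j (contr i x) = (bary j (vtx i) + bary j x) / 2"
  by (simp add: bary_def contr_eq add_divide_distrib diff_divide_distrib distrib_left)

lemma continuous_on_bary [continuous_intros]:
  "continuous_on S f \<Longrightarrow> continuous_on S (\<lambda>x. bary i (f x))"
  unfolding bary_def by (cases "i = 0"; cases "i = 1") (auto intro!: continuous_intros)

lemma bary_sum: "bary 0 x + bary 1 x + bary 2 x = 1"
  by (simp add: bary_def field_simps)

lemma bary_eqI: "bary 1 x = bary 1 y \<Longrightarrow> bary 2 x = bary 2 y \<Longrightarrow> x = y"
  by (simp add: bary_def prod_eq_iff)

lemma bary_convex:
  "bary i ((1 - t) *\<^sub>R x + t *\<^sub>R y) = (1 - t) * bary i x + t * bary i y"
  by (simp add: bary_def algebra_simps add_divide_distrib diff_divide_distrib)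

lemma vtx_inject [simp]: "i < 3 \<Longrightarrow> j < 3 \<Longrightarrow> vtx i = vtx j \<longleftrightarrow> i = j"
  using bary_vtx[of i i] bary_vtx[of j i] by (metis of_bool_eq_iff)

lemma norm_vtx: "norm (vtx i) \<le> 1"
  by (auto simp: vtx_def norm_prod_def power_divide)

lemma contr_vtx_self [simp]: "contr i (vtx i) = vtx i"
  by (simp add: contr_def)

lemma contr_vtx_commute: "contr i (vtx j) = contr j (vtx i)"
  by (simp add: contr_eq add.commute)

lemma contr_vtx_midpoint: "contr i (vtx j) = midpoint (vtx i) (vtx j)"
  by (simp add: contr_eq midpoint_def)

lemma contr_word_replicate [simp]: "contr_word (replicate n i) (vtx i) = vtx i"
  by (induction n) (simp_all add: contr_word_Cons)

section \<open>Words of a fixed length\<close>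

definition words :: "nat \<Rightarrow> nat list set" where
  "words n = {\<sigma> \<in> gwords. length \<sigma> = n}"

lemma words_0 [simp]: "words 0 = {[]}"
  by (auto simp: words_def gwords_def)

lemma words_Suc: "words (Suc n) = (\<lambda>(i, \<sigma>). i # \<sigma>) ` ({..<3} \<times> words n)"
  unfolding words_def gwords_def set012 by (auto simp: length_Suc_conv image_iff)

lemma words_1: "words 1 = {[0], [1], [2]}"
  unfolding One_nat_def words_Suc words_0 set012[symmetric] by auto

lemma Cons_in_words [simp]: "i # \<sigma> \<in> words (Suc n) \<longleftrightarrow> i < 3 \<and> \<sigma> \<in> words n"
  unfolding words_def gwords_def set012 by auto

lemma words_SucE:
  assumes "\<sigma> \<in> words (Suc n)"
  obtains i \<tau> where "\<sigma> = i # \<tau>" "i < 3" "\<tau> \<in> words n"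
  using assms unfolding words_Suc by auto

lemma words_append: "\<sigma> \<in> words m \<Longrightarrow> \<tau> \<in> words n \<Longrightarrow> \<sigma> @ \<tau> \<in> words (m + n)"
  by (auto simp: words_def gwords_def)

lemma words_add: "words (m + n) = (\<lambda>(\<sigma>, \<tau>). \<sigma> @ \<tau>) ` (words m \<times> words n)"
proof
  show "words (m + n) \<subseteq> (\<lambda>(\<sigma>, \<tau>). \<sigma> @ \<tau>) ` (words m \<times> words n)"
  proof
    fix \<rho> assume r: "\<rho> \<in> words (m + n)"
    then have "set (take m \<rho>) \<subseteq> {0, 1, 2}" "set (drop m \<rho>) \<subseteq> {0, 1, 2}"
      using set_take_subset[of m \<rho>] set_drop_subset[of m \<rho>]
      unfolding words_def gwords_def lists_eq_set by blast+
    then have "take m \<rho> \<in> words m" "drop m \<rho> \<in> words n"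
      using r unfolding words_def gwords_def lists_eq_set by simp_all
    then show "\<rho> \<in> (\<lambda>(\<sigma>, \<tau>). \<sigma> @ \<tau>) ` (words m \<times> words n)"
      by (intro image_eqI[where x = "(take m \<rho>, drop m \<rho>)"]) simp_all
  qed
qed (auto intro: words_append)

lemma words_addE:
  assumes "\<rho> \<in> words (m + n)"
  obtains \<sigma> \<tau> where "\<rho> = \<sigma> @ \<tau>" "\<sigma> \<in> words m" "\<tau> \<in> words n"
  using assms unfolding words_add by auto

lemma finite_words [simp]: "finite (words n)"
  by (induction n) (auto simp: words_Suc)

lemma replicate_in_words [simp]: "i < 3 \<Longrightarrow> replicate n i \<in> words n"
  by (auto simp: words_def gwords_def)

lemma words_imp_gwords: "\<sigma> \<in> words n \<Longrightarrow> \<sigma> \<in> gwords"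
  by (simp add: words_def)

lemma length_words: "\<sigma> \<in> words n \<Longrightarrow> length \<sigma> = n"
  by (simp add: words_def)

lemma gwords_in_words: "\<sigma> \<in> gwords \<Longrightarrow> \<sigma> \<in> words (length \<sigma>)"
  by (simp add: words_def)

section \<open>The dense set of cell vertices, and uniqueness of the attractor\<close>

definition skeleton :: "pt set" where
  "skeleton = (\<Union>\<sigma>\<in>gwords. contr_word \<sigma> ` vtx ` {..<3})"

lemma contr_word_in_skeleton: "\<sigma> \<in> gwords \<Longrightarrow> i < 3 \<Longrightarrow> contr_word \<sigma> (vtx i) \<in> skeleton"
  unfolding skeleton_def by blast

lemma vtx_in_skeleton: "i < 3 \<Longrightarrow> vtx i \<in> skeleton"
  using contr_word_in_skeleton[of "[]" i] by (simp add: gwords_def)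

lemma skeleton_invariant: "skeleton = (\<Union>i\<in>{..<3}. contr i ` skeleton)"
proof -
  have 1: "x \<in> (\<Union>i\<in>{..<3}. contr i ` skeleton)" if "x \<in> skeleton" for x
  proof -
    from that obtain \<sigma> j where *: "\<sigma> \<in> gwords" "j < 3" "x = contr_word \<sigma> (vtx j)"
      by (auto simp: skeleton_def)
    show ?thesis
    proof (cases \<sigma>)
      case Nil
      have "vtx j \<in> skeleton"
        using * by (simp add: vtx_in_skeleton)
      moreover have "x = contr j (vtx j)" using * Nil by simp
      ultimately show ?thesis using *(2) by blast
    next
      case (Cons i \<tau>)
      then have "i < 3" "\<tau> \<in> gwords" using *(1) unfolding gwords_def set012 by auto
      moreover from this have "contr_word \<tau> (vtx j) \<in> skeleton"
        using *(2) by (auto simp: skeleton_def)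
      ultimately show ?thesis using * Cons by (auto simp: contr_word_Cons)
    qed
  qed
  have 2: "contr i x \<in> skeleton" if "i < 3" "x \<in> skeleton" for x i
  proof -
    from that obtain \<sigma> j where *: "\<sigma> \<in> gwords" "j < 3" "x = contr_word \<sigma> (vtx j)"
      by (auto simp: skeleton_def)
    have "i # \<sigma> \<in> gwords" using * that unfolding gwords_def set012 by auto
    moreover have "contr i x = contr_word (i # \<sigma>) (vtx j)" using * by (simp add: contr_word_Cons)
    ultimately show ?thesis using *(2) unfolding skeleton_def by blast
  qed
  show ?thesis using 1 2 by blast
qed

lemma bounded_skeleton: "bounded skeleton"
proof -
  have "norm (contr_word \<sigma> (vtx j)) \<le> 1" for \<sigma> j
  proof (induction \<sigma>)
    case (Cons i \<sigma>)
    show ?case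
      using norm_triangle_ineq[of "vtx i" "contr_word \<sigma> (vtx j)"] Cons norm_vtx[of i]
      by (simp add: contr_word_Cons contr_eq)
  qed (simp add: norm_vtx)
  then show ?thesis
    unfolding bounded_iff skeleton_def by blast
qed

text \<open>Let x in A be farthest from B and write x = contr i y with y in A. Contractions halve
  distances, so x is at most half as far from B as y, hence at most half as far as itself. Used in
  both directions this gives uniqueness of the attractor; used for a segment it places the sides of
  the triangle in the gasket.\<close>

lemma attractor_subset:
  assumes A: "compact A" "A \<subseteq> (\<Union>i\<in>I. contr i ` A)"
    and B: "compact B" "B \<noteq> {}" "(\<Union>i\<in>I. contr i ` B) \<subseteq> B"
  shows "A \<subseteq> B"
proof (cases "A = {}")
  case False
  have "continuous_on A (\<lambda>x. infdist x B)" by (intro continuous_intros)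
  from continuous_attains_sup[OF A(1) False this]
  obtain x where x: "x \<in> A" "\<And>y. y \<in> A \<Longrightarrow> infdist y B \<le> infdist x B" by blast
  obtain i y where y: "i \<in> I" "y \<in> A" "x = contr i y" using A(2) x(1) by blast
  obtain z where z: "z \<in> B" "infdist y B = dist y z"
    using infdist_attains_inf[OF compact_imp_closed[OF B(1)] B(2)] by blast
  have "contr i z \<in> B" using B(3) y z by blast
  then have "infdist x B \<le> dist x (contr i z)" by (rule infdist_le)
  also have "\<dots> = infdist y B / 2" using y z by (simp add: dist_contr)
  also have "\<dots> \<le> infdist x B / 2" using x(2)[OF y(2)] by simp
  finally have "infdist x B = 0" using infdist_nonneg[of x B] by linarith
  then have "infdist y B = 0" if "y \<in> A" for y
    using x(2)[OF that] infdist_nonneg[of y B] by linarith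
  then show ?thesis
    by (intro subsetI) (simp add: in_closed_iff_infdist_zero[OF compact_imp_closed[OF B(1)] B(2)])
qed simp

text \<open>\<open>gasket\<close> is a definite description, so a solution has to be exhibited and
  shown to be the only one. The closure of the set of all cell vertices is a convenient solution:
  density of the vertices is then available for continuity arguments.\<close>

lemma gasket_eq_closure: "gasket = closure skeleton"
  and gasket_invariant: "gasket = (\<Union>i\<in>{..<3}. contr i ` gasket)"
proof -
  let ?K = "closure skeleton"
  have cK: "compact ?K" using bounded_skeleton by (simp add: compact_closure)
  have img: "closure (contr i ` skeleton) = contr i ` ?K" for i
  proof (rule closure_unique)
    show "contr i ` skeleton \<subseteq> contr i ` ?K" using closure_subset by blast
    show "closed (contr i ` ?K)"
      by (intro compact_imp_closed compact_continuous_image cK continuous_on_contr)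
    fix T assume T: "contr i ` skeleton \<subseteq> T" "closed T"
    show "contr i ` ?K \<subseteq> T"
      by (rule image_closure_subset[OF continuous_on_contr T(2,1)])
  qed
  have inv: "?K = (\<Union>i\<in>{..<3}. contr i ` ?K)"
    unfolding set012[symmetric]
    by (subst (1) skeleton_invariant) (simp flip: set012 add: closure_Un img)
  have "vtx 0 \<in> skeleton" by (simp add: vtx_in_skeleton)
  then have ne: "?K \<noteq> {}" using closure_subset by blast
  have *: "gasket = ?K"
    unfolding gasket_def
  proof (rule the_equality)
    show "compact ?K \<and> ?K \<noteq> {} \<and> ?K = (\<Union>i\<in>{0,1,2}. contr i ` ?K)"
      unfolding set012 by (intro conjI cK ne inv)
    fix A assume "compact A \<and> A \<noteq> {} \<and> A = (\<Union>i\<in>{0,1,2}. contr i ` A)"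
    then have A: "compact A" "A \<noteq> {}" "A = (\<Union>i\<in>{..<3}. contr i ` A)"
      unfolding set012 by simp_all
    show "A = ?K"
      by (intro subset_antisym
          attractor_subset[OF A(1) equalityD1[OF A(3)] cK ne equalityD2[OF inv]]
          attractor_subset[OF cK equalityD1[OF inv] A(1,2) equalityD2[OF A(3)]])
  qed
  then show "gasket = ?K" .
  show "gasket = (\<Union>i\<in>{..<3}. contr i ` gasket)" unfolding * by (rule inv)
qed

lemma compact_gasket [simp]: "compact gasket"
  using bounded_skeleton by (simp add: gasket_eq_closure compact_closure)

lemma contr_in_gasket [simp]: "i < 3 \<Longrightarrow> x \<in> gasket \<Longrightarrow> contr i x \<in> gasket"
  using gasket_invariant by blast

lemma gasketE:
  assumes "x \<in> gasket" obtains i y where "i < 3" "y \<in> gasket" "x = contr i y"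
  using assms gasket_invariant by blast

lemma contr_word_in_gasket [simp]: "\<sigma> \<in> words n \<Longrightarrow> x \<in> gasket \<Longrightarrow> contr_word \<sigma> x \<in> gasket"
  by (induction n arbitrary: \<sigma>) (auto elim!: words_SucE simp: contr_word_Cons)

lemma vtx_in_gasket [simp]: "i < 3 \<Longrightarrow> vtx i \<in> gasket"
  unfolding gasket_eq_closure by (intro subsetD[OF closure_subset] vtx_in_skeleton)

text \<open>At a minimum point y = contr i z of \<open>bary j\<close>, the value is at least half
  the value at z, hence at least half the minimum. A number that is at least half of itself is
  nonnegative.\<close>

lemma bary_gasket_nonneg:
  assumes "x \<in> gasket" "j < 3" shows "0 \<le> bary j x"
proof -
  have "continuous_on gasket (bary j)" by (intro continuous_on_bary continuous_on_id)
  from continuous_attains_inf[OF compact_gasket _ this] assms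
  obtain y where y: "y \<in> gasket" "\<And>x. x \<in> gasket \<Longrightarrow> bary j y \<le> bary j x" by blast
  obtain i z where z: "i < 3" "z \<in> gasket" "y = contr i z" using y(1) by (rule gasketE)
  have "bary j y \<ge> bary j z / 2"
    using z assms(2) by (simp add: bary_contr bary_vtx)
  with y(2)[OF z(2)] y(2)[OF assms(1)] show ?thesis by linarith
qed

lemma bary_contr_ge: "i < 3 \<Longrightarrow> x \<in> gasket \<Longrightarrow> 1 / 2 \<le> bary i (contr i x)"
  using bary_gasket_nonneg[of x i] by (simp add: bary_contr bary_vtx)

text \<open>Comparing i-th coordinates gives bary i y = 1 + bary i x, which forces y = p_i, because
  coordinates on the gasket are nonnegative with sum one; symmetrically x = p_j. First-level cells
  thus meet only in the midpoint of p_i and p_j.\<close>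

lemma contr_eq_contr:
  assumes "i < 3" "j < 3" "i \<noteq> j" "x \<in> gasket" "y \<in> gasket" "contr i x = contr j y"
  shows "x = vtx j" "y = vtx i"
proof -
  have nn: "0 \<le> bary 0 z" "0 \<le> bary 1 z" "0 \<le> bary 2 z" if "z \<in> gasket" for z
    using that bary_gasket_nonneg by auto
  have *: "x = vtx j" if "i < 3" "j < 3" "i \<noteq> j" "x \<in> gasket" "y \<in> gasket" "contr i x = contr j y"
    for i j x y
  proof -
    have "bary k (vtx i) + bary k x = bary k (vtx j) + bary k y" for k
      using arg_cong[OF that(6), of "bary k"] by (simp add: bary_contr)
    from this[of 0] this[of 1] this[of 2] that(1-3) nn[OF that(4)] nn[OF that(5)]
      bary_sum[of x] bary_sum[of y]
    have "bary 1 x = bary 1 (vtx j)" "bary 2 x = bary 2 (vtx j)"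
      by (auto simp: less3 bary_vtx)
    then show ?thesis by (rule bary_eqI)
  qed
  show "x = vtx j" "y = vtx i"
    using *[of i j x y] *[of j i y x] assms by auto
qed

text \<open>After the common prefix is stripped, the first differing letters pin the point to one
  vertex by \<open>contr_eq_contr\<close>. Since an edge has two distinct ends, it belongs to only
  one cell of its level, so edge sums can be split over cells without overlap.\<close>

lemma cells_meet_once:
  assumes "\<sigma> \<in> words n" "\<tau> \<in> words n" "\<sigma> \<noteq> \<tau>"
    and "x \<in> gasket" "y \<in> gasket" "x' \<in> gasket" "y' \<in> gasket"
    and "contr_word \<sigma> x = contr_word \<tau> x'" "contr_word \<sigma> y = contr_word \<tau> y'"
  shows "x = y"
  using assms
proof (induction n arbitrary: \<sigma> \<tau>)
  case (Suc n)
  obtain i \<sigma>' where s: "\<sigma> = i # \<sigma>'" "i < 3" "\<sigma>' \<in> words n" using Suc(2) by (rule words_SucE)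
  obtain j \<tau>' where t: "\<tau> = j # \<tau>'" "j < 3" "\<tau>' \<in> words n" using Suc(3) by (rule words_SucE)
  show ?case
  proof (cases "i = j")
    case True
    show ?thesis
      by (rule Suc(1)[of \<sigma>' \<tau>']) (use Suc s t True in \<open>auto simp: contr_word_Cons\<close>)
  next
    case False
    have "contr_word \<sigma>' x = vtx j"
      by (rule contr_eq_contr(1)[of i j _ "contr_word \<tau>' x'"])
         (use Suc s t False in \<open>auto simp: contr_word_Cons\<close>)
    moreover have "contr_word \<sigma>' y = vtx j"
      by (rule contr_eq_contr(1)[of i j _ "contr_word \<tau>' y'"])
         (use Suc s t False in \<open>auto simp: contr_word_Cons\<close>)
    ultimately show ?thesis by (metis contr_word_inject)
  qed
qed auto

section \<open>Discrete energies\<close>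

definition vpairs :: "(nat \<times> nat) set" where
  "vpairs = {(i, j). i < 3 \<and> j < 3 \<and> i \<noteq> j}"

lemma vpairs_eq: "vpairs = {(0,1), (1,2), (2,0), (1,0), (2,1), (0,2)}"
  unfolding vpairs_def less3 by auto

lemma finite_vpairs [simp]: "finite vpairs"
  by (simp add: vpairs_eq)

lemma vpairs_iff: "(i, j) \<in> vpairs \<longleftrightarrow> i < 3 \<and> j < 3 \<and> i \<noteq> j"
  by (simp add: vpairs_def)

text \<open>Indexing by words and ordered vertex pairs instead of by a set of edges lets sums split
  along prefixes of words and allows a nonsymmetric F. Each edge occurs in both orientations, which
  explains the factor 1/2 in \<open>energy_at\<close>.\<close>

definition osum :: "nat \<Rightarrow> (pt \<Rightarrow> pt \<Rightarrow> real) \<Rightarrow> real" where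
  "osum m F = (\<Sum>\<sigma>\<in>words m. \<Sum>(i, j)\<in>vpairs. F (contr_word \<sigma> (vtx i)) (contr_word \<sigma> (vtx j)))"

lemma sum_words_add: "(\<Sum>\<rho>\<in>words (m + n). f \<rho>) = (\<Sum>\<sigma>\<in>words m. \<Sum>\<tau>\<in>words n. f (\<sigma> @ \<tau>))"
proof -
  have "inj_on (\<lambda>(\<sigma>, \<tau>). \<sigma> @ \<tau>) (words m \<times> words n)"
    by (auto simp: inj_on_def words_def)
  then show ?thesis
    by (simp add: words_add sum.reindex sum.cartesian_product case_prod_unfold)
qed

lemma sum_words_1: "(\<Sum>\<rho>\<in>words 1. f \<rho>) = f [0] + f [1] + f [2]"
  unfolding words_1 by (simp add: add.assoc)

lemma osum_add_level:
  "osum (n + m) F = (\<Sum>\<sigma>\<in>words n. osum m (\<lambda>x y. F (contr_word \<sigma> x) (contr_word \<sigma> y)))"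
  by (simp add: osum_def sum_words_add contr_word_append)

lemma osum_add: "osum m (\<lambda>x y. F x y + G x y) = osum m F + osum m G"
  by (simp add: osum_def sum.distrib case_prod_unfold)

lemma osum_diff: "osum m (\<lambda>x y. F x y - G x y) = osum m F - osum m G"
  by (simp add: osum_def sum_subtractf case_prod_unfold)

lemma osum_cmult: "osum m (\<lambda>x y. c * F x y) = c * osum m F"
  by (simp add: osum_def sum_distrib_left case_prod_unfold)

lemma osum_swap: "osum m (\<lambda>x y. F y x) = osum m F"
  unfolding osum_def by (simp add: vpairs_eq algebra_simps)

lemma osum_mono:
  assumes "\<And>\<sigma> i j. \<sigma> \<in> words m \<Longrightarrow> (i, j) \<in> vpairs \<Longrightarrow>
    F (contr_word \<sigma> (vtx i)) (contr_word \<sigma> (vtx j)) \<le> G (contr_word \<sigma> (vtx i)) (contr_word \<sigma> (vtx j))"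
  shows "osum m F \<le> osum m G"
  unfolding osum_def using assms by (intro sum_mono) auto

lemma osum_cong:
  assumes "\<And>\<sigma> i j. \<sigma> \<in> words m \<Longrightarrow> (i, j) \<in> vpairs \<Longrightarrow>
    F (contr_word \<sigma> (vtx i)) (contr_word \<sigma> (vtx j)) = G (contr_word \<sigma> (vtx i)) (contr_word \<sigma> (vtx j))"
  shows "osum m F = osum m G"
  unfolding osum_def using assms by (intro sum.cong refl) auto

lemma osum_nonneg:
  assumes "\<And>x y. 0 \<le> F x y" shows "0 \<le> osum m F"
  unfolding osum_def case_prod_unfold by (intro sum_nonneg assms)

lemma osum_ge_term:
  assumes "\<And>x y. 0 \<le> F x y" "\<sigma> \<in> words m" "i < 3" "j < 3" "i \<noteq> j"
  shows "F (contr_word \<sigma> (vtx i)) (contr_word \<sigma> (vtx j)) \<le> osum m F"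
proof -
  let ?f = "\<lambda>\<sigma> p. F (contr_word \<sigma> (vtx (fst p))) (contr_word \<sigma> (vtx (snd p)))"
  have nn: "0 \<le> ?f \<sigma> p" for \<sigma> p by (rule assms(1))
  have "(i, j) \<in> vpairs" using assms by (simp add: vpairs_iff)
  then have "?f \<sigma> (i, j) \<le> (\<Sum>p\<in>vpairs. ?f \<sigma> p)"
    by (intro member_le_sum nn finite_vpairs)
  also have "\<dots> \<le> (\<Sum>\<sigma>\<in>words m. \<Sum>p\<in>vpairs. ?f \<sigma> p)"
    using assms(2) by (intro member_le_sum sum_nonneg nn finite_words)
  also have "\<dots> = osum m F" by (simp add: osum_def case_prod_unfold)
  finally show ?thesis by simp
qed

lemma edges_eq:
  "edges m = (\<lambda>(\<sigma>, i, j). (contr_word \<sigma> (vtx i), contr_word \<sigma> (vtx j))) `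
     (words m \<times> {(0,1), (1,2), (2,0)})"
proof -
  let ?f = "\<lambda>(\<sigma>, i, j). (contr_word \<sigma> (vtx i), contr_word \<sigma> (vtx j))"
  have "edges m = {(contr_word \<sigma> (vtx i), contr_word \<sigma> (vtx j)) | \<sigma> i j.
      \<sigma> \<in> words m \<and> (i, j) \<in> {(0,1), (1,2), (2,0)}}"
    unfolding edges_def words_def by blast
  also have "\<dots> = ?f ` (words m \<times> {(0,1), (1,2), (2,0)})"
    (is "?L = ?R")
  proof
    show "?L \<subseteq> ?R"
    proof
      fix e assume "e \<in> ?L"
      then obtain \<sigma> i j where *: "e = (contr_word \<sigma> (vtx i), contr_word \<sigma> (vtx j))" "\<sigma> \<in> words m"
        "(i, j) \<in> {(0,1), (1,2), (2,0)}" by blast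
      then show "e \<in> ?R" by (intro image_eqI[of _ _ "(\<sigma>, i, j)"]) simp_all
    qed
  qed auto
  finally show ?thesis .
qed

lemma edge_determines_word:
  assumes "\<sigma> \<in> words m" "\<tau> \<in> words m" "x \<in> gasket" "y \<in> gasket" "x' \<in> gasket" "y' \<in> gasket" "x \<noteq> y"
    and "contr_word \<sigma> x = contr_word \<tau> x'" "contr_word \<sigma> y = contr_word \<tau> y'"
  shows "\<sigma> = \<tau>" "x = x'" "y = y'"
proof -
  show "\<sigma> = \<tau>" using cells_meet_once[of \<sigma> m \<tau> x y x' y'] assms by blast
  then show "x = x'" "y = y'" using assms by auto
qed

text \<open>\<open>edges m\<close> is a set of pairs of points, so the reindexing is valid only
  because no pair arises from two words; this is \<open>edge_determines_word\<close>.\<close>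

lemma sum_edges:
  "(\<Sum>(a, b)\<in>edges m. F a b) =
     (\<Sum>\<sigma>\<in>words m. \<Sum>(i, j)\<in>{(0,1), (1,2), (2,0)}. F (contr_word \<sigma> (vtx i)) (contr_word \<sigma> (vtx j)))"
proof -
  have "inj_on (\<lambda>(\<sigma>, i, j). (contr_word \<sigma> (vtx i), contr_word \<sigma> (vtx j)))
     (words m \<times> {(0,1), (1,2), (2,0)})"
  proof (rule inj_onI)
    fix p q assume pq: "p \<in> words m \<times> {(0,1), (1,2), (2,0)}" "q \<in> words m \<times> {(0,1), (1,2), (2,0)}"
      "(case p of (\<sigma>, i, j) \<Rightarrow> (contr_word \<sigma> (vtx i), contr_word \<sigma> (vtx j))) =
       (case q of (\<sigma>, i, j) \<Rightarrow> (contr_word \<sigma> (vtx i), contr_word \<sigma> (vtx j)))"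
    obtain \<sigma> i j \<tau> k l where p: "p = (\<sigma>, i, j)" and q: "q = (\<tau>, k, l)" by (metis prod_cases3)
    from pq have *: "\<sigma> \<in> words m" "\<tau> \<in> words m" "(i, j) \<in> {(0,1), (1,2), (2,0)}" "(k, l) \<in> {(0,1), (1,2), (2,0)}"
      "contr_word \<sigma> (vtx i) = contr_word \<tau> (vtx k)" "contr_word \<sigma> (vtx j) = contr_word \<tau> (vtx l)"
      unfolding p q by (simp_all only: mem_Times_iff fst_conv snd_conv split prod.inject)
    have b: "i < 3" "j < 3" "k < 3" "l < 3" "i \<noteq> j" using *(3,4) by auto
    then have "vtx i \<noteq> vtx j" by simp
    from edge_determines_word[OF *(1,2) _ _ _ _ this *(5,6)] b
    show "p = q" unfolding p q by simp
  qed
  then show ?thesis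
    unfolding edges_eq sum.cartesian_product by (simp only: sum.reindex o_def case_prod_unfold fst_conv snd_conv)
qed

lemma sum_edges_sym:
  assumes "\<And>x y. F x y = F y x"
  shows "(\<Sum>(a, b)\<in>edges m. F a b) = osum m F / 2"
proof -
  have "(\<Sum>\<sigma>\<in>words m. \<Sum>(i, j)\<in>{(0,1), (1,2), (2,0)}. F (contr_word \<sigma> (vtx i)) (contr_word \<sigma> (vtx j)))
      = (\<Sum>\<sigma>\<in>words m. (\<Sum>(i, j)\<in>vpairs. F (contr_word \<sigma> (vtx i)) (contr_word \<sigma> (vtx j))) / 2)"
  proof (rule sum.cong[OF refl])
    fix \<sigma>
    show "(\<Sum>(i, j)\<in>{(0,1), (1,2), (2,0)}. F (contr_word \<sigma> (vtx i)) (contr_word \<sigma> (vtx j)))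
      = (\<Sum>(i, j)\<in>vpairs. F (contr_word \<sigma> (vtx i)) (contr_word \<sigma> (vtx j))) / 2"
      using assms[of "contr_word \<sigma> (vtx 1)" "contr_word \<sigma> (vtx 0)"]
        assms[of "contr_word \<sigma> (vtx 2)" "contr_word \<sigma> (vtx 0)"]
        assms[of "contr_word \<sigma> (vtx 2)" "contr_word \<sigma> (vtx 1)"]
      by (simp add: vpairs_eq)
  qed
  then show ?thesis by (simp add: sum_edges osum_def sum_divide_distrib)
qed

section \<open>Discrete energy forms and the algebra of functions of finite energy\<close>

definition energy_at :: "nat \<Rightarrow> (pt \<Rightarrow> real) \<Rightarrow> (pt \<Rightarrow> real) \<Rightarrow> real" where
  "energy_at m f g = (5/3) ^ m / 2 * osum m (\<lambda>x y. (f y - f x) * (g y - g x))"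

lemma energy_at_nonneg: "0 \<le> energy_at m f f"
  unfolding energy_at_def by (intro mult_nonneg_nonneg osum_nonneg zero_le_square) simp

lemma energy_at_add_level:
  "energy_at (n + m) f g =
     (5/3) ^ n * (\<Sum>\<sigma>\<in>words n. energy_at m (\<lambda>x. f (contr_word \<sigma> x)) (\<lambda>x. g (contr_word \<sigma> x)))"
  by (simp add: energy_at_def osum_add_level power_add sum_distrib_left mult.assoc)

lemma energy_at_0:
  "energy_at 0 f g = (f (vtx 1) - f (vtx 0)) * (g (vtx 1) - g (vtx 0))
     + (f (vtx 2) - f (vtx 1)) * (g (vtx 2) - g (vtx 1))
     + (f (vtx 0) - f (vtx 2)) * (g (vtx 0) - g (vtx 2))"
  by (simp add: energy_at_def osum_def vpairs_eq algebra_simps)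

lemma energy_at_1:
  "energy_at 1 f g = 5/3 * (energy_at 0 (\<lambda>x. f (contr 0 x)) (\<lambda>x. g (contr 0 x))
     + energy_at 0 (\<lambda>x. f (contr 1 x)) (\<lambda>x. g (contr 1 x))
     + energy_at 0 (\<lambda>x. f (contr 2 x)) (\<lambda>x. g (contr 2 x)))"
  using energy_at_add_level[of 1 0 f g] by (simp add: sum_words_1[unfolded One_nat_def] contr_word_single)

lemma triangle_energy_le:
  fixes a b c x y z :: real
  shows "(b - a)\<^sup>2 + (c - b)\<^sup>2 + (a - c)\<^sup>2 \<le>
    5/3 * ((x - a)\<^sup>2 + (z - x)\<^sup>2 + (a - z)\<^sup>2 + ((b - x)\<^sup>2 + (y - b)\<^sup>2 + (x - y)\<^sup>2)
      + ((y - z)\<^sup>2 + (c - y)\<^sup>2 + (z - c)\<^sup>2))"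
proof -
  \<comment> \<open>the deviations of the midpoint values from the harmonic ones\<close>
  define u v w where "u = x - (2*a + 2*b + c) / 5" and "v = y - (2*b + 2*c + a) / 5"
    and "w = z - (2*a + 2*c + b) / 5"
  have "5/3 * ((x - a)\<^sup>2 + (z - x)\<^sup>2 + (a - z)\<^sup>2 + ((b - x)\<^sup>2 + (y - b)\<^sup>2 + (x - y)\<^sup>2)
      + ((y - z)\<^sup>2 + (c - y)\<^sup>2 + (z - c)\<^sup>2))
    = (b - a)\<^sup>2 + (c - b)\<^sup>2 + (a - c)\<^sup>2
      + 5/3 * (2 * u\<^sup>2 + 2 * v\<^sup>2 + 2 * w\<^sup>2 + (u - v)\<^sup>2 + (v - w)\<^sup>2 + (w - u)\<^sup>2)"
    unfolding u_def v_def w_def by (simp add: power2_eq_square field_simps)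
  then show ?thesis by simp
qed

text \<open>The factor 5/3 is calibrated here: with it, the least level-1 energy over all choices of
  midpoint values equals the level-0 energy, attained by the weights 2/5, 2/5, 1/5. Applied in each
  cell, this makes the energies increase with the level.\<close>

lemma energy_at_0_le_1: "energy_at 0 f f \<le> energy_at 1 f f"
  using triangle_energy_le[of "f (vtx 1)" "f (vtx 0)" "f (vtx 2)" "f (contr 0 (vtx 1))" "f (contr 0 (vtx 2))" "f (contr 1 (vtx 2))"]
  by (simp add: energy_at_1[unfolded One_nat_def] energy_at_0 power2_eq_square
      contr_vtx_commute[of 1 0, unfolded One_nat_def] contr_vtx_commute[of 2 0] contr_vtx_commute[of 2 1, unfolded One_nat_def])

lemma energy_at_Suc_le: "energy_at m f f \<le> energy_at (Suc m) f f"
proof -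
  have "energy_at (m + 0) f f \<le> energy_at (m + 1) f f"
    unfolding energy_at_add_level
    by (intro mult_left_mono sum_mono energy_at_0_le_1) simp
  then show ?thesis by simp
qed

lemma energy_at_mono: "m \<le> n \<Longrightarrow> energy_at m f f \<le> energy_at n f f"
  using lift_Suc_mono_le[of "\<lambda>m. energy_at m f f"] energy_at_Suc_le by blast

lemma energy_eq: "energy f = (SUP m. ennreal (energy_at m f f))"
proof -
  have "energy f = lim (\<lambda>m. ennreal (energy_at m f f))"
    unfolding energy_def energy_at_def
    by (subst sum_edges_sym) (simp_all add: power2_commute power2_eq_square[symmetric])
  moreover have "incseq (\<lambda>m. ennreal (energy_at m f f))"
    by (intro incseq_SucI ennreal_leI energy_at_Suc_le)
  then have "(\<lambda>m. ennreal (energy_at m f f)) \<longlonglongrightarrow> (SUP m. ennreal (energy_at m f f))"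
    by (rule LIMSEQ_SUP)
  ultimately show ?thesis by (simp add: limI)
qed

lemma energy_finite_iff: "energy f < \<infinity> \<longleftrightarrow> (\<exists>B. \<forall>m. energy_at m f f \<le> B)"
proof
  assume *: "energy f < \<infinity>"
  have "energy_at m f f \<le> enn2real (energy f)" for m
  proof -
    have "ennreal (energy_at m f f) \<le> energy f" unfolding energy_eq by (rule SUP_upper) simp
    then show ?thesis
      using * by (cases "energy f") (auto simp: ennreal_le_iff energy_at_nonneg)
  qed
  then show "\<exists>B. \<forall>m. energy_at m f f \<le> B" by blast
next
  assume "\<exists>B. \<forall>m. energy_at m f f \<le> B"
  then obtain B where "\<And>m. energy_at m f f \<le> B" by blast
  then have "energy f \<le> ennreal B" unfolding energy_eq by (intro SUP_least ennreal_leI)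
  then show "energy f < \<infinity>" by (simp add: le_less_trans)
qed

lemma energy_tendsto:
  assumes "energy f < \<infinity>"
  shows "(\<lambda>m. energy_at m f f) \<longlonglongrightarrow> enn2real (energy f)"
proof -
  have "(\<lambda>m. ennreal (energy_at m f f)) \<longlonglongrightarrow> energy f"
    unfolding energy_eq by (intro LIMSEQ_SUP incseq_SucI ennreal_leI energy_at_Suc_le)
  then have "(\<lambda>m. enn2real (ennreal (energy_at m f f))) \<longlonglongrightarrow> enn2real (energy f)"
    using assms by (intro tendsto_enn2real) auto
  then show ?thesis by (simp add: energy_at_nonneg)
qed

lemma finite_energy_iff:
  "f \<in> finite_energy_fns \<longleftrightarrow> continuous_on gasket f \<and> (\<exists>B. \<forall>m. energy_at m f f \<le> B)"
  by (simp only: finite_energy_fns_def mem_Collect_eq energy_finite_iff)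

lemma energy_at_commute: "energy_at m f g = energy_at m g f"
  by (simp add: energy_at_def mult.commute)

lemma energy_at_add_left: "energy_at m (\<lambda>x. f x + g x) h = energy_at m f h + energy_at m g h"
proof -
  have "osum m (\<lambda>x y. (f y + g y - (f x + g x)) * (h y - h x))
      = osum m (\<lambda>x y. (f y - f x) * (h y - h x) + (g y - g x) * (h y - h x))"
    by (simp add: algebra_simps)
  then show ?thesis by (simp only: energy_at_def osum_add distrib_left)
qed

lemma energy_at_cmult_left: "energy_at m (\<lambda>x. c * f x) h = c * energy_at m f h"
proof -
  have "osum m (\<lambda>x y. (c * f y - c * f x) * (h y - h x))
      = osum m (\<lambda>x y. c * ((f y - f x) * (h y - h x)))"
    by (simp add: algebra_simps)
  then show ?thesis by (simp add: energy_at_def osum_cmult)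
qed

lemma energy_at_add_right: "energy_at m h (\<lambda>x. f x + g x) = energy_at m h f + energy_at m h g"
  using energy_at_add_left by (simp add: energy_at_commute)

lemma energy_at_const [simp]: "energy_at m (\<lambda>_. c) g = 0"
  by (simp add: energy_at_def osum_def)

lemma energy_at_uminus_left: "energy_at m (\<lambda>x. - f x) g = - energy_at m f g"
  using energy_at_cmult_left[of m "-1" f g] by simp

lemma energy_at_diff_left: "energy_at m (\<lambda>x. f x - g x) h = energy_at m f h - energy_at m g h"
  using energy_at_add_left[of m f "\<lambda>x. - g x" h] by (simp add: energy_at_uminus_left)

lemma energy_at_diff_right: "energy_at m h (\<lambda>x. f x - g x) = energy_at m h f - energy_at m h g"
  using energy_at_diff_left by (simp add: energy_at_commute)

lemma energy_at_add_le: "energy_at m (\<lambda>x. f x + g x) (\<lambda>x. f x + g x) \<le> 2 * energy_at m f f + 2 * energy_at m g g"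
  using energy_at_nonneg[of m "\<lambda>x. f x - g x"]
  by (simp add: energy_at_add_left energy_at_add_right energy_at_diff_left energy_at_diff_right
      energy_at_commute[of m g f])

lemma finite_energy_const [simp]: "(\<lambda>_. c) \<in> finite_energy_fns"
  by (auto simp: finite_energy_iff)

lemma finite_energy_add:
  assumes "f \<in> finite_energy_fns" "g \<in> finite_energy_fns"
  shows "(\<lambda>x. f x + g x) \<in> finite_energy_fns"
proof -
  obtain A B where "\<And>m. energy_at m f f \<le> A" "\<And>m. energy_at m g g \<le> B"
    using assms by (auto simp: finite_energy_iff)
  then have "energy_at m (\<lambda>x. f x + g x) (\<lambda>x. f x + g x) \<le> 2 * A + 2 * B" for m
    using energy_at_add_le[of m f g] by (smt (verit))
  then show ?thesis using assms by (auto simp: finite_energy_iff intro!: continuous_intros)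
qed

lemma finite_energy_gasket_bounded:
  assumes "f \<in> finite_energy_fns"
  obtains M where "M > 0" "\<And>x. x \<in> gasket \<Longrightarrow> \<bar>f x\<bar> \<le> M"
proof -
  have "bounded (f ` gasket)"
    using assms by (intro compact_imp_bounded compact_continuous_image) (auto simp: finite_energy_iff)
  then obtain M where "M > 0" "\<forall>y\<in>f ` gasket. norm y \<le> M" unfolding bounded_pos by blast
  then show ?thesis using that[of M] by auto
qed

lemma finite_energy_mult:
  assumes f: "f \<in> finite_energy_fns" and g: "g \<in> finite_energy_fns"
  shows "(\<lambda>x. f x * g x) \<in> finite_energy_fns"
proof -
  obtain A B where AB: "\<And>m. energy_at m f f \<le> A" "\<And>m. energy_at m g g \<le> B"
    using assms by (auto simp: finite_energy_iff)
  obtain M where M: "M > 0" "\<And>x. x \<in> gasket \<Longrightarrow> \<bar>f x\<bar> \<le> M" using finite_energy_gasket_bounded[OF f] by blast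
  obtain N where N: "N > 0" "\<And>x. x \<in> gasket \<Longrightarrow> \<bar>g x\<bar> \<le> N" using finite_energy_gasket_bounded[OF g] by blast
  have "energy_at m (\<lambda>x. f x * g x) (\<lambda>x. f x * g x) \<le> 2 * N\<^sup>2 * A + 2 * M\<^sup>2 * B" for m
  proof -
    have "osum m (\<lambda>x y. (f y * g y - f x * g x) * (f y * g y - f x * g x)) \<le>
        osum m (\<lambda>x y. 2 * N\<^sup>2 * ((f y - f x) * (f y - f x)) + 2 * M\<^sup>2 * ((g y - g x) * (g y - g x)))"
    proof (rule osum_mono)
      fix \<sigma> i j assume *: "\<sigma> \<in> words m" "(i, j) \<in> vpairs"
      let ?x = "contr_word \<sigma> (vtx i)" and ?y = "contr_word \<sigma> (vtx j)"
      have xy: "?x \<in> gasket" "?y \<in> gasket" using * by (auto simp: vpairs_iff)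
      have "(f ?y * g ?y - f ?x * g ?x)\<^sup>2 = ((f ?y - f ?x) * g ?y + f ?x * (g ?y - g ?x))\<^sup>2"
        by (simp add: algebra_simps)
      also have "\<dots> \<le> 2 * ((f ?y - f ?x) * g ?y)\<^sup>2 + 2 * (f ?x * (g ?y - g ?x))\<^sup>2"
        using sum_squares_bound[of "(f ?y - f ?x) * g ?y" "f ?x * (g ?y - g ?x)"]
        by (simp add: power2_sum)
      also have "\<dots> = 2 * (f ?y - f ?x)\<^sup>2 * (g ?y)\<^sup>2 + 2 * (f ?x)\<^sup>2 * (g ?y - g ?x)\<^sup>2"
        by (simp add: power_mult_distrib)
      also have "\<dots> \<le> 2 * (f ?y - f ?x)\<^sup>2 * N\<^sup>2 + 2 * M\<^sup>2 * (g ?y - g ?x)\<^sup>2"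
        using M(2)[OF xy(1)] N(2)[OF xy(2)] M(1) N(1)
        by (intro add_mono mult_mono mult_left_mono mult_right_mono)
           (auto simp: abs_le_square_iff[symmetric])
      finally show "(f ?y * g ?y - f ?x * g ?x) * (f ?y * g ?y - f ?x * g ?x) \<le>
        2 * N\<^sup>2 * ((f ?y - f ?x) * (f ?y - f ?x)) + 2 * M\<^sup>2 * ((g ?y - g ?x) * (g ?y - g ?x))"
        by (simp add: power2_eq_square mult.commute mult.left_commute)
    qed
    then have "energy_at m (\<lambda>x. f x * g x) (\<lambda>x. f x * g x) \<le> (5/3)^m / 2 *
        osum m (\<lambda>x y. 2 * N\<^sup>2 * ((f y - f x) * (f y - f x)) + 2 * M\<^sup>2 * ((g y - g x) * (g y - g x)))"
      unfolding energy_at_def by (rule mult_left_mono) simp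
    also have "\<dots> = 2 * N\<^sup>2 * energy_at m f f + 2 * M\<^sup>2 * energy_at m g g"
      unfolding energy_at_def by (simp only: osum_add osum_cmult) (simp add: algebra_simps)
    also have "\<dots> \<le> 2 * N\<^sup>2 * A + 2 * M\<^sup>2 * B"
      using AB by (intro add_mono mult_left_mono) auto
    finally show ?thesis .
  qed
  then show ?thesis using assms by (auto simp: finite_energy_iff intro!: continuous_intros)
qed

lemma finite_energy_cmult: "f \<in> finite_energy_fns \<Longrightarrow> (\<lambda>x. c * f x) \<in> finite_energy_fns"
  using finite_energy_mult[of "\<lambda>_. c" f] by simp

lemma finite_energy_diff:
  "f \<in> finite_energy_fns \<Longrightarrow> g \<in> finite_energy_fns \<Longrightarrow> (\<lambda>x. f x - g x) \<in> finite_energy_fns"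
  using finite_energy_add[of f "\<lambda>x. -1 * g x"] finite_energy_cmult[of g "-1"] by simp

lemma finite_energy_sum:
  "(\<And>i. i \<in> I \<Longrightarrow> f i \<in> finite_energy_fns) \<Longrightarrow> (\<lambda>x. \<Sum>i\<in>I. f i x) \<in> finite_energy_fns"
  by (induction I rule: infinite_finite_induct) (auto intro: finite_energy_add)

lemma energy_at_cong:
  assumes "\<And>x. x \<in> gasket \<Longrightarrow> f x = f' x" "\<And>x. x \<in> gasket \<Longrightarrow> g x = g' x"
  shows "energy_at m f g = energy_at m f' g'"
  unfolding energy_at_def
  by (intro arg_cong2[of _ _ _ _ "(*)"] refl osum_cong) (auto simp: vpairs_iff assms)

lemma finite_energy_cong:
  assumes "\<And>x. x \<in> gasket \<Longrightarrow> f x = g x"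
  shows "f \<in> finite_energy_fns \<longleftrightarrow> g \<in> finite_energy_fns"
  using energy_at_cong[OF assms assms] assms
  by (simp add: finite_energy_iff cong: continuous_on_cong)

lemma finite_energy_contr_word:
  assumes "f \<in> finite_energy_fns" "\<sigma> \<in> words n"
  shows "(\<lambda>x. f (contr_word \<sigma> x)) \<in> finite_energy_fns"
proof -
  obtain B where B: "\<And>m. energy_at m f f \<le> B" using assms by (auto simp: finite_energy_iff)
  have "energy_at m (\<lambda>x. f (contr_word \<sigma> x)) (\<lambda>x. f (contr_word \<sigma> x)) \<le> B" for m
  proof -
    have "energy_at m (\<lambda>x. f (contr_word \<sigma> x)) (\<lambda>x. f (contr_word \<sigma> x)) \<le>
      (\<Sum>\<sigma>\<in>words n. energy_at m (\<lambda>x. f (contr_word \<sigma> x)) (\<lambda>x. f (contr_word \<sigma> x)))"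
      using assms(2) by (intro member_le_sum) (auto simp: energy_at_nonneg)
    also have "\<dots> \<le> (5/3)^n * (\<Sum>\<sigma>\<in>words n. energy_at m (\<lambda>x. f (contr_word \<sigma> x)) (\<lambda>x. f (contr_word \<sigma> x)))"
      using mult_right_mono[OF one_le_power[of "5/3::real" n]
        sum_nonneg[OF energy_at_nonneg, where A = "words n"]] by simp
    also have "\<dots> = energy_at (n + m) f f" by (simp add: energy_at_add_level)
    also have "\<dots> \<le> B" by (rule B)
    finally show ?thesis .
  qed
  moreover have "continuous_on gasket (\<lambda>x. f (contr_word \<sigma> x))"
    using assms by (intro continuous_on_compose2[of gasket f _ "contr_word \<sigma>"] continuous_on_contr_word)
      (auto simp: finite_energy_iff)
  ultimately show ?thesis by (auto simp: finite_energy_iff)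
qed

lemma energy_form_tendsto:
  assumes "f \<in> finite_energy_fns" "g \<in> finite_energy_fns"
  shows "(\<lambda>m. energy_at m f g) \<longlonglongrightarrow> energy_form f g"
proof -
  have "energy (\<lambda>x. f x + g x) < \<infinity>" "energy (\<lambda>x. f x - g x) < \<infinity>"
    using finite_energy_add[OF assms] finite_energy_diff[OF assms] by (auto simp: finite_energy_fns_def)
  from this[THEN energy_tendsto]
  have "(\<lambda>m. (energy_at m (\<lambda>x. f x + g x) (\<lambda>x. f x + g x)
       - energy_at m (\<lambda>x. f x - g x) (\<lambda>x. f x - g x)) / 4) \<longlonglongrightarrow> energy_form f g"
    unfolding energy_form_def by (intro tendsto_intros) simp_all
  then show ?thesis
    by (simp add: energy_at_add_left energy_at_add_right energy_at_diff_left energy_at_diff_right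
        energy_at_commute[of _ g f])
qed

text \<open>The combination defining the energy measure collapses at every finite level: by a
  discrete Leibniz rule the three products add up to (h x + h y) times the two increments, and
  exchanging the ends of each edge turns this into twice the term with h y. Evaluating h at the
  target y matches \<open>form_integral\<close>.\<close>

lemma energy_measure_integral_tendsto:
  assumes "f \<in> finite_energy_fns" "g \<in> finite_energy_fns" "h \<in> finite_energy_fns"
  shows "(\<lambda>m. (5/3)^m / 2 * osum m (\<lambda>x y. h y * (f y - f x) * (g y - g x)))
    \<longlonglongrightarrow> energy_measure_integral f g h"
proof -
  have "(\<lambda>m. (energy_at m f (\<lambda>x. g x * h x) - energy_at m (\<lambda>x. f x * g x) h
       + energy_at m (\<lambda>x. h x * f x) g) / 2) \<longlonglongrightarrow> energy_measure_integral f g h"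
    unfolding energy_measure_integral_def
    by (intro tendsto_intros energy_form_tendsto finite_energy_mult assms) simp
  moreover have "(energy_at m f (\<lambda>x. g x * h x) - energy_at m (\<lambda>x. f x * g x) h
       + energy_at m (\<lambda>x. h x * f x) g) / 2
      = (5/3)^m / 2 * osum m (\<lambda>x y. h y * (f y - f x) * (g y - g x))" for m
  proof -
    have "osum m (\<lambda>x y. (f y - f x) * (g y * h y - g x * h x))
        - osum m (\<lambda>x y. (f y * g y - f x * g x) * (h y - h x))
        + osum m (\<lambda>x y. (h y * f y - h x * f x) * (g y - g x))
        = osum m (\<lambda>x y. h y * (f y - f x) * (g y - g x) + h x * (f x - f y) * (g x - g y))"
      unfolding osum_diff[symmetric] osum_add[symmetric] by (intro osum_cong) (simp add: algebra_simps)
    also have "\<dots> = 2 * osum m (\<lambda>x y. h y * (f y - f x) * (g y - g x))"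
      unfolding osum_add using osum_swap[of m "\<lambda>x y. h y * (f y - f x) * (g y - g x)"] by simp
    finally have "(5/3)^m / 2 * (osum m (\<lambda>x y. (f y - f x) * (g y * h y - g x * h x))
        - osum m (\<lambda>x y. (f y * g y - f x * g x) * (h y - h x))
        + osum m (\<lambda>x y. (h y * f y - h x * f x) * (g y - g x)))
        = (5/3)^m / 2 * (2 * osum m (\<lambda>x y. h y * (f y - f x) * (g y - g x)))"
      by (rule arg_cong)
    then show ?thesis
      unfolding energy_at_def by (simp only: right_diff_distrib distrib_left)
  qed
  ultimately show ?thesis by simp
qed

section \<open>Gluing and harmonic functions\<close>

lemma edge_increment_le:
  assumes B: "\<And>m. energy_at m f f \<le> B" and s: "\<sigma> \<in> words m" "i < 3" "j < 3"
  shows "\<bar>f (contr_word \<sigma> (vtx j)) - f (contr_word \<sigma> (vtx i))\<bar> \<le> sqrt (2 * B) * sqrt (3/5) ^ m"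
proof (cases "i = j")
  case True
  have "0 \<le> B" using B[of 0] energy_at_nonneg[of 0 f] by linarith
  then show ?thesis using True by simp
next
  case False
  let ?d = "f (contr_word \<sigma> (vtx j)) - f (contr_word \<sigma> (vtx i))"
  have "?d * ?d \<le> osum m (\<lambda>x y. (f y - f x) * (f y - f x))"
    by (rule osum_ge_term[OF zero_le_square s False])
  also have "\<dots> = 2 * (3/5)^m * energy_at m f f"
    by (simp add: energy_at_def power_divide)
  also have "\<dots> \<le> 2 * (3/5)^m * B" using B by (intro mult_left_mono) auto
  finally have "?d\<^sup>2 \<le> 2 * B * (3/5)^m" by (simp add: power2_eq_square mult_ac)
  then have "sqrt (?d\<^sup>2) \<le> sqrt (2 * B * (3/5)^m)" by (rule real_sqrt_le_mono)
  then show ?thesis unfolding real_sqrt_abs by (simp only: real_sqrt_mult real_sqrt_power)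
qed

text \<open>The vertex w_\<sigma>(p_i) is shared by C_\<sigma> and its subcell C_\<sigma>i, so each
  further letter costs one edge of the new level. With q = sqrt(3/5) the bound 5 - 4 q^m reproduces
  itself, since q \<le> 4/5 gives 5 q^(m+1) \<le> 4 q^m; for the empty word it allows one edge of
  level 0.\<close>

lemma skeleton_increment_le:
  assumes B: "\<And>m. energy_at m f f \<le> B" and "\<sigma> \<in> gwords" "j < 3"
  shows "\<bar>f (contr_word \<sigma> (vtx j)) - f (vtx 0)\<bar> \<le> sqrt (2 * B) * (5 - 4 * sqrt (3/5) ^ length \<sigma>)"
  using assms(2,3)
proof (induction \<sigma> arbitrary: j rule: rev_induct)
  case Nil
  show ?case using edge_increment_le[OF B, of "[]" 0 0 j] Nil by simp
next
  case (snoc i \<sigma>)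
  let ?q = "sqrt (3/5) :: real" and ?m = "length \<sigma>" and ?r = "sqrt (2 * B)"
  have s: "\<sigma> \<in> gwords" "i < 3" using snoc.prems unfolding gwords_def set012 by auto
  have w: "\<sigma> @ [i] \<in> words (Suc ?m)" using snoc.prems by (simp add: words_def)
  have "0 \<le> B" using B[of 0] energy_at_nonneg[of 0 f] by linarith
  have "contr_word (\<sigma> @ [i]) (vtx i) = contr_word \<sigma> (vtx i)"
    by (simp add: contr_word_append contr_word_single)
  then have "\<bar>f (contr_word (\<sigma> @ [i]) (vtx j)) - f (vtx 0)\<bar> \<le>
      ?r * ?q ^ Suc ?m + ?r * (5 - 4 * ?q ^ ?m)"
    using edge_increment_le[OF B w s(2) snoc.prems(2)] snoc.IH[OF s] by (smt (verit))
  also have "\<dots> = ?r * (?q ^ Suc ?m + (5 - 4 * ?q ^ ?m))" by (simp add: distrib_left)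
  also have "\<dots> \<le> ?r * (5 - 4 * ?q ^ Suc ?m)"
  proof (rule mult_left_mono)
    have "?q \<le> 4/5" by (rule real_le_lsqrt) (auto simp: power2_eq_square)
    then have "5 * ?q * ?q ^ ?m \<le> 4 * ?q ^ ?m" by (intro mult_right_mono) auto
    then show "?q ^ Suc ?m + (5 - 4 * ?q ^ ?m) \<le> 5 - 4 * ?q ^ Suc ?m" by simp
  qed (use \<open>0 \<le> B\<close> in simp)
  finally show ?case by simp
qed

lemma oscillation_le:
  assumes f: "continuous_on gasket f" and B: "\<And>m. energy_at m f f \<le> B" and x: "x \<in> gasket"
  shows "\<bar>f x - f (vtx 0)\<bar> \<le> 5 * sqrt (2 * B)"
proof -
  have "0 \<le> B" using B[of 0] energy_at_nonneg[of 0 f] by linarith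
  have "continuous_on (closure skeleton) (\<lambda>x. f x - f (vtx 0))"
    using f by (intro continuous_intros) (simp add: gasket_eq_closure)
  moreover have "\<forall>y\<in>skeleton. norm (f y - f (vtx 0)) \<le> 5 * sqrt (2 * B)"
  proof
    fix y assume "y \<in> skeleton"
    then obtain \<sigma> j where y: "\<sigma> \<in> gwords" "j < 3" "y = contr_word \<sigma> (vtx j)"
      by (auto simp: skeleton_def)
    have "\<bar>f y - f (vtx 0)\<bar> \<le> sqrt (2 * B) * (5 - 4 * sqrt (3/5) ^ length \<sigma>)"
      unfolding y(3) by (rule skeleton_increment_le[OF B y(1,2)])
    also have "\<dots> \<le> sqrt (2 * B) * 5" using \<open>0 \<le> B\<close> by (intro mult_left_mono) auto
    finally show "norm (f y - f (vtx 0)) \<le> 5 * sqrt (2 * B)" by simp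
  qed
  ultimately show ?thesis
    using continuous_on_closure_norm_le[of skeleton "\<lambda>x. f x - f (vtx 0)" "5 * sqrt (2 * B)" x] x
    by (simp add: gasket_eq_closure)
qed

text \<open>The maps x \<mapsto> 2x - p_i invert the contractions. The order of the tests matters
  only at the midpoints shared by two cells, where the condition
  \<open>u i (vtx j) = u j (vtx i)\<close> makes both choices agree.\<close>

definition glue :: "(nat \<Rightarrow> pt \<Rightarrow> real) \<Rightarrow> pt \<Rightarrow> real" where
  "glue u x =
     (if x \<in> contr 0 ` gasket then u 0 (2 *\<^sub>R x - vtx 0)
      else if x \<in> contr 1 ` gasket then u 1 (2 *\<^sub>R x - vtx 1) else u 2 (2 *\<^sub>R x - vtx 2))"

lemma uncontr_contr: "2 *\<^sub>R contr i x - vtx i = x"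
  by (simp add: contr_eq)

lemma glue_contr:
  assumes u: "\<And>i j. i < 3 \<Longrightarrow> j < 3 \<Longrightarrow> u i (vtx j) = u j (vtx i)" and i: "i < 3" and x: "x \<in> gasket"
  shows "glue u (contr i x) = u i x"
proof -
  have *: "u j (2 *\<^sub>R contr i x - vtx j) = u i x" if "contr i x \<in> contr j ` gasket" "j < 3" for j
  proof -
    from that obtain y where y: "y \<in> gasket" "contr i x = contr j y" by blast
    have "u j y = u i x"
    proof (cases "i = j")
      case False
      from contr_eq_contr[OF i that(2) False x y] have "x = vtx j" "y = vtx i" by auto
      with u i that(2) show ?thesis by simp
    qed (use y in simp)
    then show ?thesis by (simp add: y(2) uncontr_contr)
  qed
  have mem: "contr i x \<in> contr i ` gasket" using x by simp
  have "i = 0 \<or> i = 1 \<or> i = 2" using i by auto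
  then show ?thesis
    using *[of 0] *[of 1] *[OF mem i] mem unfolding glue_def
    by (elim disjE) (simp_all add: uncontr_contr)
qed

lemma continuous_on_glue:
  assumes u: "\<And>i j. i < 3 \<Longrightarrow> j < 3 \<Longrightarrow> u i (vtx j) = u j (vtx i)"
    and c: "\<And>i. i < 3 \<Longrightarrow> continuous_on gasket (u i)"
  shows "continuous_on gasket (glue u)"
proof -
  have "continuous_on (\<Union>i\<in>{..<3}. contr i ` gasket) (glue u)"
  proof (rule continuous_on_closed_Union)
    fix i :: nat assume "i \<in> {..<3}"
    then have i: "i < 3" by simp
    show "closed (contr i ` gasket)"
      by (intro compact_imp_closed compact_continuous_image continuous_on_contr compact_gasket)
    have "continuous_on (contr i ` gasket) (\<lambda>x. u i (2 *\<^sub>R x - vtx i))"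
      by (intro continuous_on_compose2[OF c[OF i]] continuous_intros) (auto simp: uncontr_contr)
    then show "continuous_on (contr i ` gasket) (glue u)"
      by (subst continuous_on_cong[OF refl, where g = "\<lambda>x. u i (2 *\<^sub>R x - vtx i)"])
         (use glue_contr[of u, OF u i] in \<open>auto simp: uncontr_contr\<close>)
  qed simp
  then show ?thesis by (simp flip: gasket_invariant)
qed

lemma finite_energyI_contr:
  assumes g: "continuous_on gasket g" and "\<And>i. i < 3 \<Longrightarrow> (\<lambda>x. g (contr i x)) \<in> finite_energy_fns"
  shows "g \<in> finite_energy_fns"
proof -
  have "\<exists>B. \<forall>m. energy_at m (\<lambda>x. g (contr i x)) (\<lambda>x. g (contr i x)) \<le> B" if "i < 3" for i
    using assms(2)[OF that] by (simp add: finite_energy_iff)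
  then obtain B where B: "\<And>i m. i < 3 \<Longrightarrow> energy_at m (\<lambda>x. g (contr i x)) (\<lambda>x. g (contr i x)) \<le> B i"
    by metis
  have "energy_at m g g \<le> 5/3 * (B 0 + B 1 + B 2)" for m
  proof -
    have "energy_at m g g \<le> energy_at (1 + m) g g" by (rule energy_at_mono) simp
    also have "\<dots> \<le> 5/3 * (B 0 + B 1 + B 2)"
      unfolding energy_at_add_level sum_words_1 contr_word_single power_one_right
      by (intro mult_left_mono add_mono B) auto
    finally show ?thesis .
  qed
  then have "\<exists>B. \<forall>m. energy_at m g g \<le> B" by blast
  with g show ?thesis by (simp add: finite_energy_iff)
qed

lemma glue_finite_energy:
  assumes u: "\<And>i j. i < 3 \<Longrightarrow> j < 3 \<Longrightarrow> u i (vtx j) = u j (vtx i)"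
    and F: "\<And>i. i < 3 \<Longrightarrow> u i \<in> finite_energy_fns"
  shows "glue u \<in> finite_energy_fns"
proof (rule finite_energyI_contr)
  show "continuous_on gasket (glue u)"
    using F by (intro continuous_on_glue u) (auto simp: finite_energy_iff)
  fix i :: nat assume i: "i < 3"
  then show "(\<lambda>x. glue u (contr i x)) \<in> finite_energy_fns"
    using F[OF i] finite_energy_cong[of "\<lambda>x. glue u (contr i x)" "u i"] glue_contr[of u, OF u i] by blast
qed

lemma glue_family:
  assumes "\<And>\<sigma>. \<sigma> \<in> words n \<Longrightarrow> u \<sigma> \<in> finite_energy_fns"
    and "\<And>\<sigma> \<tau> i j. \<sigma> \<in> words n \<Longrightarrow> \<tau> \<in> words n \<Longrightarrow> i < 3 \<Longrightarrow> j < 3 \<Longrightarrow>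
      contr_word \<sigma> (vtx i) = contr_word \<tau> (vtx j) \<Longrightarrow> u \<sigma> (vtx i) = u \<tau> (vtx j)"
  shows "\<exists>g\<in>finite_energy_fns. \<forall>\<sigma>\<in>words n. \<forall>x\<in>gasket. g (contr_word \<sigma> x) = u \<sigma> x"
  using assms
proof (induction n arbitrary: u)
  case 0
  then show ?case by (intro bexI[of _ "u []"]) auto
next
  case (Suc n)
  have "\<exists>g\<in>finite_energy_fns. \<forall>\<sigma>\<in>words n. \<forall>x\<in>gasket. g (contr_word \<sigma> x) = u (i # \<sigma>) x" if i: "i < 3" for i
  proof (rule Suc.IH)
    fix \<sigma> \<tau> k l assume "\<sigma> \<in> words n" "\<tau> \<in> words n" "k < 3" "l < 3"
      "contr_word \<sigma> (vtx k) = contr_word \<tau> (vtx l)"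
    then show "u (i # \<sigma>) (vtx k) = u (i # \<tau>) (vtx l)"
      using i by (intro Suc.prems(2)) (auto simp: contr_word_Cons)
  qed (use Suc.prems(1) i in auto)
  then obtain G where G: "\<And>i. i < 3 \<Longrightarrow> G i \<in> finite_energy_fns"
    "\<And>i \<sigma> x. i < 3 \<Longrightarrow> \<sigma> \<in> words n \<Longrightarrow> x \<in> gasket \<Longrightarrow> G i (contr_word \<sigma> x) = u (i # \<sigma>) x"
    by metis
  have comp: "G i (vtx j) = G j (vtx i)" if "i < 3" "j < 3" for i j
  proof -
    \<comment> \<open>The junction contr i p_j = contr j p_i is a vertex of the small cells with
      words i j^n and j i^n, because p_j is the fixed point of w_j.\<close>
    have "G i (vtx j) = u (i # replicate n j) (vtx j)"
      using G(2)[of i "replicate n j" "vtx j"] that by simp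
    also have "\<dots> = u (j # replicate n i) (vtx i)"
      using that by (intro Suc.prems(2)) (auto simp: contr_word_Cons contr_vtx_commute)
    also have "\<dots> = G j (vtx i)" using G(2)[of j "replicate n i" "vtx i"] that by simp
    finally show ?thesis .
  qed
  show ?case
  proof (intro bexI[of _ "glue G"] ballI)
    show "glue G \<in> finite_energy_fns" using comp G(1) by (rule glue_finite_energy)
    fix \<sigma> x assume *: "\<sigma> \<in> words (Suc n)" "x \<in> gasket"
    obtain i \<tau> where t: "\<sigma> = i # \<tau>" "i < 3" "\<tau> \<in> words n" using *(1) by (rule words_SucE)
    then show "glue G (contr_word \<sigma> x) = u \<sigma> x"
      using glue_contr[of G i "contr_word \<tau> x"] comp G(2)[of i \<tau> x] *(2) by (simp add: contr_word_Cons)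
  qed
qed

text \<open>The values at the vertices of \<open>C\<^sub>i\<close> of the harmonic function with values \<open>v\<close> at the \<open>p\<^sub>j\<close>;
  for distinct \<open>i, j < 3\<close>, the third index is \<open>3 - i - j\<close>.\<close>

definition harm_vals :: "nat \<Rightarrow> (nat \<Rightarrow> real) \<Rightarrow> nat \<Rightarrow> real" where
  "harm_vals i v j = (if j = i then v i else (2 * v i + 2 * v j + v (3 - i - j)) / 5)"

lemma harm_vals_commute: "i < 3 \<Longrightarrow> j < 3 \<Longrightarrow> harm_vals i v j = harm_vals j v i"
  by (auto simp: harm_vals_def add.commute)

text \<open>The 2/5, 2/5, 1/5 rule is applied k times; inside the cells of level k the vertex values
  are interpolated affinely. The harmonic function is the uniform limit in k.\<close>

primrec harm_approx :: "nat \<Rightarrow> (nat \<Rightarrow> real) \<Rightarrow> pt \<Rightarrow> real" where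
  "harm_approx 0 v = (\<lambda>x. v 0 * bary 0 x + v 1 * bary 1 x + v 2 * bary 2 x)"
| "harm_approx (Suc k) v = glue (\<lambda>i. harm_approx k (harm_vals i v))"

lemma harm_approx_vtx: "j < 3 \<Longrightarrow> harm_approx k v (vtx j) = v j"
proof (induction k arbitrary: v j)
  case 0
  then show ?case by (auto simp: less3 bary_vtx)
next
  case (Suc k)
  have "harm_approx (Suc k) v (contr j (vtx j)) = harm_approx k (harm_vals j v) (vtx j)"
    unfolding harm_approx.simps
    by (rule glue_contr) (use Suc harm_vals_commute in auto)
  also have "\<dots> = v j" using Suc by (simp add: harm_vals_def)
  finally show ?case by simp
qed

lemma harm_approx_contr:
  "i < 3 \<Longrightarrow> x \<in> gasket \<Longrightarrow> harm_approx (Suc k) v (contr i x) = harm_approx k (harm_vals i v) x"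
  unfolding harm_approx.simps
  by (rule glue_contr) (use harm_vals_commute harm_approx_vtx in auto)

lemma continuous_on_harm_approx: "continuous_on gasket (harm_approx k v)"
proof (induction k arbitrary: v)
  case 0
  then show ?case by (auto intro!: continuous_intros)
next
  case (Suc k)
  then show ?case
    unfolding harm_approx.simps
    by (intro continuous_on_glue) (auto simp: harm_approx_vtx harm_vals_commute)
qed

lemma harm_approx_0_convex:
  assumes "\<And>j. j < 3 \<Longrightarrow> \<bar>v j - c\<bar> \<le> D" "x \<in> gasket"
  shows "\<bar>harm_approx 0 v x - c\<bar> \<le> D"
proof -
  have "harm_approx 0 v x - c * (bary 0 x + bary 1 x + bary 2 x)
      = (v 0 - c) * bary 0 x + (v 1 - c) * bary 1 x + (v 2 - c) * bary 2 x"
    by (simp add: algebra_simps)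
  then have "\<bar>harm_approx 0 v x - c\<bar> = \<bar>(v 0 - c) * bary 0 x + (v 1 - c) * bary 1 x + (v 2 - c) * bary 2 x\<bar>"
    by (simp only: bary_sum mult_1_right)
  also have "\<dots> \<le> \<bar>(v 0 - c) * bary 0 x\<bar> + \<bar>(v 1 - c) * bary 1 x\<bar> + \<bar>(v 2 - c) * bary 2 x\<bar>"
    by linarith
  also have "\<dots> \<le> D * bary 0 x + D * bary 1 x + D * bary 2 x"
    unfolding abs_mult using bary_gasket_nonneg[OF assms(2)] assms(1)
    by (intro add_mono mult_mono) (auto intro: order_trans[OF abs_ge_zero assms(1)[of 0]])
  also have "\<dots> = D" using bary_sum[of x] by (simp flip: distrib_left)
  finally show ?thesis .
qed

lemma harm_vals_near:
  assumes v: "\<And>j. j < 3 \<Longrightarrow> \<bar>v j - c\<bar> \<le> D" and ij: "i < 3" "j < 3"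
  shows "\<bar>harm_vals i v j - c\<bar> \<le> D"
proof (cases "j = i")
  case False
  then have "3 - i - j < 3" using ij by linarith
  from v[OF ij(1)] v[OF ij(2)] v[OF this] False show ?thesis
    unfolding harm_vals_def abs_le_iff by (simp add: field_simps)
qed (use v ij in \<open>simp add: harm_vals_def\<close>)

text \<open>The differences are (2(a-b) + (a-c))/5, the same with b and c exchanged, and (b-c)/5.
  The spread of the vertex values thus shrinks by 3/5 from a cell to a subcell, which makes
  \<open>harm_approx\<close> converge geometrically.\<close>

lemma harm_spread:
  fixes a b c D :: real
  assumes "\<bar>a - b\<bar> \<le> D" "\<bar>a - c\<bar> \<le> D" "\<bar>b - c\<bar> \<le> D"
  shows "\<bar>a - (2 * a + 2 * b + c) / 5\<bar> \<le> 3/5 * D" "\<bar>a - (2 * a + 2 * c + b) / 5\<bar> \<le> 3/5 * D"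
    "\<bar>(2 * a + 2 * b + c) / 5 - (2 * a + 2 * c + b) / 5\<bar> \<le> 3/5 * D"
  using assms unfolding abs_le_iff by (simp_all add: field_simps)

lemma harm_approx_Suc_diff:
  assumes "\<And>i j. i < 3 \<Longrightarrow> j < 3 \<Longrightarrow> \<bar>v i - v j\<bar> \<le> D" "x \<in> gasket"
  shows "\<bar>harm_approx (Suc k) v x - harm_approx k v x\<bar> \<le> 2 * D * (3/5) ^ k"
  using assms
proof (induction k arbitrary: v x D)
  case (0 v x D)
  have d: "\<bar>v 0 - v 1\<bar> \<le> D" "\<bar>v 0 - v 2\<bar> \<le> D" "\<bar>v 1 - v 2\<bar> \<le> D"
    using 0 by auto
  obtain i y where y: "i < 3" "y \<in> gasket" "x = contr i y" using 0(2) by (rule gasketE)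
  \<comment> \<open>Both approximations are averages of numbers within D of \<open>v 0\<close>; the
    factor 2 in the bound is the triangle inequality.\<close>
  have "\<bar>harm_vals i v j - v 0\<bar> \<le> D" if "j < 3" for j
    by (rule harm_vals_near[OF _ y(1) that]) (use d in \<open>auto simp: less3\<close>)
  then have "\<bar>harm_approx 0 (harm_vals i v) y - v 0\<bar> \<le> D"
    using y(2) by (rule harm_approx_0_convex)
  moreover have "\<bar>harm_approx 0 v x - v 0\<bar> \<le> D"
    using d by (intro harm_approx_0_convex 0) (auto simp: less3)
  moreover have "harm_approx (Suc 0) v x = harm_approx 0 (harm_vals i v) y"
    unfolding y(3) by (rule harm_approx_contr[OF y(1,2)])
  ultimately show ?case unfolding power_0 by linarith
next
  case (Suc k v x D)
  obtain i y where y: "i < 3" "y \<in> gasket" "x = contr i y" using Suc.prems(2) by (rule gasketE)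
  have "\<bar>harm_vals i v j - harm_vals i v l\<bar> \<le> 3/5 * D" if jl: "j < 3" "l < 3" for j l
  proof -
    have one: "\<bar>v i - harm_vals i v k\<bar> \<le> 3/5 * D" if "k < 3" "k \<noteq> i" for k
    proof -
      have "3 - i - k < 3" using y(1) that by linarith
      then show ?thesis
        using harm_spread(1)[of "v i" "v k" D "v (3 - i - k)"] Suc.prems(1) y(1) that by (simp add: harm_vals_def)
    qed
    have D0: "0 \<le> D" using Suc.prems(1)[of 0 0] by simp
    consider "j = l" | "j = i" "l \<noteq> i" | "j \<noteq> i" "l = i" | "j \<noteq> i" "l \<noteq> i" "j \<noteq> l" by blast
    then show ?thesis
    proof cases
      case 1
      then show ?thesis using D0 by simp
    next
      case 2
      then show ?thesis using one[OF jl(2)] by (simp add: harm_vals_def)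
    next
      case 3
      then show ?thesis using one[OF jl(1)] by (simp add: harm_vals_def abs_minus_commute)
    next
      case 4
      then have "3 - i - j = l" "3 - i - l = j" using y(1) jl by linarith+
      then show ?thesis
        using harm_spread(3)[of "v i" "v j" D "v l"] Suc.prems(1) y(1) jl 4 by (simp add: harm_vals_def)
    qed
  qed
  from Suc.IH[of "harm_vals i v", OF this y(2)]
  show ?case unfolding y(3) harm_approx_contr[OF y(1,2)] by simp
qed

text \<open>The identity against arbitrary u is the weak form of harmonicity: only the values of u
  at the three vertices count. With u = h it bounds the energy of h; with other u it evaluates inner
  products with \<open>dz\<close> without any limit.\<close>

lemma harmonic_extension_exists:
  fixes v :: "nat \<Rightarrow> real"
  shows "\<exists>h\<in>finite_energy_fns. (\<forall>j<3. h (vtx j) = v j) \<and> (\<forall>m u. energy_at m h u = energy_at 0 h u)"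
proof -
  define h where "h v x = lim (\<lambda>k. harm_approx k v x)" for v x
  have ul: "uniform_limit gasket (\<lambda>k. harm_approx k v) (h v) sequentially" for v
  proof -
    define D where "D = \<bar>v 0 - v 1\<bar> + \<bar>v 0 - v 2\<bar> + \<bar>v 1 - v 2\<bar>"
    have D: "\<bar>v i - v j\<bar> \<le> D" if "i < 3" "j < 3" for i j
      using that unfolding less3 D_def by (elim disjE) simp_all
    let ?d = "\<lambda>k x. harm_approx (Suc k) v x - harm_approx k v x"
    have "uniform_limit gasket (\<lambda>n x. \<Sum>k<n. ?d k x) (\<lambda>x. suminf (\<lambda>k. ?d k x)) sequentially"
    proof (rule Weierstrass_m_test)
      show "norm (?d k x) \<le> 2 * D * (3/5) ^ k" if "x \<in> gasket" for k x
        using harm_approx_Suc_diff[of v D x k] D that by simp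
      show "summable (\<lambda>k. 2 * D * (3/5::real) ^ k)" by (intro summable_mult summable_geometric) simp
    qed
    then have "uniform_limit gasket (\<lambda>n x. harm_approx n v x - harm_approx 0 v x)
        (\<lambda>x. suminf (\<lambda>k. ?d k x)) sequentially"
      unfolding sum_lessThan_telescope[of "\<lambda>k. harm_approx k v _"] .
    from uniform_limit_add[OF this uniform_limit_const[where c = "harm_approx 0 v"]]
    have *: "uniform_limit gasket (\<lambda>n. harm_approx n v)
        (\<lambda>x. suminf (\<lambda>k. ?d k x) + harm_approx 0 v x) sequentially"
      by (simp only: diff_add_cancel)
    have "suminf (\<lambda>k. ?d k x) + harm_approx 0 v x = h v x" if "x \<in> gasket" for x
      unfolding h_def using limI[OF tendsto_uniform_limitI[OF * that]] by simp
    then show ?thesis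
      by (subst uniform_limit_cong'[where g = "\<lambda>n. harm_approx n v" and
          i = "\<lambda>x. suminf (\<lambda>k. ?d k x) + harm_approx 0 v x"]) (use * in auto)
  qed
  have lim: "(\<lambda>k. harm_approx k v x) \<longlonglongrightarrow> h v x" if "x \<in> gasket" for v x
    by (rule tendsto_uniform_limitI[OF ul that])
  have cont: "continuous_on gasket (h v)" for v
    by (rule uniform_limit_theorem[OF _ ul]) (simp_all add: continuous_on_harm_approx)
  have hv: "h v (vtx j) = v j" if "j < 3" for v j
    using lim[of "vtx j" v] harm_approx_vtx[OF that] that by (simp add: LIMSEQ_const_iff)
  have hc: "h v (contr i x) = h (harm_vals i v) x" if "i < 3" "x \<in> gasket" for v i x
  proof (rule LIMSEQ_unique)
    show "(\<lambda>k. harm_approx (Suc k) v (contr i x)) \<longlonglongrightarrow> h v (contr i x)"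
      using that by (intro LIMSEQ_Suc lim) simp
    show "(\<lambda>k. harm_approx (Suc k) v (contr i x)) \<longlonglongrightarrow> h (harm_vals i v) x"
      unfolding harm_approx_contr[OF that] by (rule lim[OF that(2)])
  qed
  \<comment> \<open>The weights 2/5, 2/5, 1/5 make each midpoint value the mean of its four
    neighbours, so the values of u at the midpoints cancel.\<close>
  have e1: "energy_at 1 (h v) u = energy_at 0 (h v) u" for v u
    unfolding energy_at_1 energy_at_0
    by (simp add: hc hv harm_vals_def contr_vtx_commute[of 1 0, unfolded One_nat_def]
        contr_vtx_commute[of 2 0] contr_vtx_commute[of 2 1, unfolded One_nat_def] numeral_eq_Suc[symmetric])
       (simp add: field_simps)
  \<comment> \<open>Restricted to a cell, h belongs to the same family with other vertex values, so
    the one-step identity applies in every cell.\<close>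
  have hw: "\<exists>v'. \<forall>x\<in>gasket. h v (contr_word \<sigma> x) = h v' x" if "\<sigma> \<in> words n" for \<sigma> n v
    using that
  proof (induction n arbitrary: \<sigma> v)
    case (Suc n)
    obtain i \<tau> where t: "\<sigma> = i # \<tau>" "i < 3" "\<tau> \<in> words n" using Suc.prems by (rule words_SucE)
    obtain v' where "\<forall>x\<in>gasket. h (harm_vals i v) (contr_word \<tau> x) = h v' x" using Suc.IH t(3) by blast
    then show ?case using t by (intro exI[of _ v']) (auto simp: contr_word_Cons hc)
  qed auto
  have "energy_at (Suc m) (h v) u = energy_at m (h v) u" for m v u
  proof -
    have "energy_at (m + 1) (h v) u = energy_at (m + 0) (h v) u"
      unfolding energy_at_add_level
    proof (intro arg_cong2[of _ _ _ _ "(*)"] sum.cong refl)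
      fix \<sigma> assume s: "\<sigma> \<in> words m"
      obtain v' where v': "\<forall>x\<in>gasket. h v (contr_word \<sigma> x) = h v' x" using hw[OF s] by blast
      have "energy_at k (\<lambda>x. h v (contr_word \<sigma> x)) (\<lambda>x. u (contr_word \<sigma> x))
          = energy_at k (h v') (\<lambda>x. u (contr_word \<sigma> x))" for k
        using v' by (intro energy_at_cong) auto
      then show "energy_at 1 (\<lambda>x. h v (contr_word \<sigma> x)) (\<lambda>x. u (contr_word \<sigma> x))
          = energy_at 0 (\<lambda>x. h v (contr_word \<sigma> x)) (\<lambda>x. u (contr_word \<sigma> x))" using e1 by simp
    qed
    then show ?thesis by simp
  qed
  then have e: "energy_at m (h v) u = energy_at 0 (h v) u" for m u
    by (induction m) auto
  have "\<forall>m. energy_at m (h v) (h v) \<le> energy_at 0 (h v) (h v)"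
    using e[of _ "h v"] by (metis order_refl)
  then have "h v \<in> finite_energy_fns" unfolding finite_energy_iff using cont by blast
  then show ?thesis using e hv by blast
qed

lemma corner_extension_exists:
  assumes j: "j < 3" and u: "u \<in> finite_energy_fns" "\<And>k. k < 3 \<Longrightarrow> k \<noteq> j \<Longrightarrow> u (vtx k) = 0"
  shows "\<exists>g\<in>finite_energy_fns. \<forall>x\<in>gasket. \<forall>i<3. g (contr i x) = (if i = j then u x else 0)"
proof -
  let ?u = "\<lambda>i. if i = j then u else (\<lambda>_. 0)"
  have "glue ?u \<in> finite_energy_fns"
    by (rule glue_finite_energy) (use u in auto)
  moreover have "glue ?u (contr i x) = ?u i x" if "i < 3" "x \<in> gasket" for i x
    by (rule glue_contr) (use u that in auto)
  ultimately show ?thesis by (intro bexI[of _ "glue ?u"]) auto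
qed

text \<open>The last condition gives \<open>\<phi> d\<psi> = d\<psi>\<close> and \<open>\<psi> d\<phi> = 0\<close> on the edges of level at least 2.\<close>

definition corner_bumps :: "nat \<Rightarrow> (pt \<Rightarrow> real) \<Rightarrow> (pt \<Rightarrow> real) \<Rightarrow> bool" where
  "corner_bumps j \<phi> \<psi> \<longleftrightarrow> \<phi> \<in> finite_energy_fns \<and> \<psi> \<in> finite_energy_fns \<and>
    (\<forall>k<3. \<phi> (vtx k) = of_bool (k = j) \<and> \<psi> (vtx k) = of_bool (k = j)) \<and>
    (\<forall>\<rho>\<in>words 2. (\<forall>x\<in>gasket. \<phi> (contr_word \<rho> x) = 1) \<or> (\<forall>x\<in>gasket. \<psi> (contr_word \<rho> x) = 0))"

text \<open>\<psi> falls from 1 to 0 inside the level-2 cell at p_j and vanishes outside it. \<phi>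
  is 1 on that cell, falls to 0 in the other two level-2 cells of C_j, and vanishes outside C_j. Two
  levels leave \<phi> room to descend beyond the support of \<psi>.\<close>

lemma corner_bumps_exist:
  assumes j: "j < 3"
  shows "\<exists>\<phi> \<psi>. corner_bumps j \<phi> \<psi>"
proof -
  obtain h where h: "h \<in> finite_energy_fns" "\<And>k. k < 3 \<Longrightarrow> h (vtx k) = of_bool (k = j)"
    using harmonic_extension_exists[of "\<lambda>k. of_bool (k = j)"] by blast
  have vtx_val: "g (vtx k) = (if k = j then u (vtx j) else 0)"
    if "\<forall>x\<in>gasket. \<forall>i<3. g (contr i x) = (if i = j then u x else 0)" "k < 3" for g u :: "pt \<Rightarrow> real" and k
    using that(1)[rule_format, of "vtx k" k] that(2) by simp
  obtain \<psi>' where p': "\<psi>' \<in> finite_energy_fns" "\<forall>x\<in>gasket. \<forall>i<3. \<psi>' (contr i x) = (if i = j then h x else 0)"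
    using corner_extension_exists[of j h] j h by auto
  obtain \<psi> where p: "\<psi> \<in> finite_energy_fns" "\<forall>x\<in>gasket. \<forall>i<3. \<psi> (contr i x) = (if i = j then \<psi>' x else 0)"
    using corner_extension_exists[of j \<psi>'] j p'(1) vtx_val[OF p'(2)] by auto
  let ?u = "\<lambda>i. if i = j then (\<lambda>_. 1) else h"
  have comp: "?u i (vtx k) = ?u k (vtx i)" if "i < 3" "k < 3" for i k
    using that j h(2) by auto
  have f'1: "glue ?u \<in> finite_energy_fns"
    by (rule glue_finite_energy) (use h comp in auto)
  have f'2: "glue ?u (contr i x) = ?u i x" if "i < 3" "x \<in> gasket" for i x
    by (rule glue_contr) (use comp that in auto)
  have f'3: "glue ?u (vtx k) = of_bool (k = j)" if "k < 3" for k
    using f'2[OF that, of "vtx k"] that h(2) by simp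
  obtain \<phi> where f: "\<phi> \<in> finite_energy_fns" "\<forall>x\<in>gasket. \<forall>i<3. \<phi> (contr i x) = (if i = j then glue ?u x else 0)"
    using corner_extension_exists[of j "glue ?u"] j f'1 f'3 by auto
  have w2: "\<exists>a b. a < 3 \<and> b < 3 \<and> contr_word \<rho> = contr a \<circ> contr b" if "\<rho> \<in> words 2" for \<rho>
  proof -
    from that obtain a b where "\<rho> = [a, b]" "a < 3" "b < 3"
      by (auto simp: numeral_2_eq_2 elim!: words_SucE)
    then show ?thesis
      by (intro exI[of _ a] exI[of _ b] conjI ext) (simp_all add: contr_word_Cons)
  qed
  have key: "(\<forall>x\<in>gasket. \<phi> (contr_word \<rho> x) = 1) \<or> (\<forall>x\<in>gasket. \<psi> (contr_word \<rho> x) = 0)"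
    if \<rho>: "\<rho> \<in> words 2" for \<rho>
  proof -
    from w2[OF \<rho>] obtain a b where ab: "a < 3" "b < 3" "contr_word \<rho> = contr a \<circ> contr b" by blast
    show ?thesis
      using ab p(2) p'(2) f(2) f'2 by (cases "a = j \<and> b = j") auto
  qed
  have "\<phi> (vtx k) = of_bool (k = j)" "\<psi> (vtx k) = of_bool (k = j)" if "k < 3" for k
    using vtx_val[OF f(2) that] f'3[OF j] vtx_val[OF p(2) that] vtx_val[OF p'(2) j] h(2)[OF j] by simp_all
  then show ?thesis
    unfolding corner_bumps_def using f(1) p(1) key by (intro exI[of _ \<phi>] exI[of _ \<psi>]) blast
qed

section \<open>Sums of one-forms along edges\<close>

inductive_set fdg_sums :: "form set" where
  gen: "f \<in> finite_energy_fns \<Longrightarrow> g \<in> finite_energy_fns \<Longrightarrow> fdg f g \<in> fdg_sums"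
| add: "\<omega> \<in> fdg_sums \<Longrightarrow> \<eta> \<in> fdg_sums \<Longrightarrow> (\<lambda>z. \<omega> z + \<eta> z) \<in> fdg_sums"

text \<open>The Leibniz rule \<open>(f dg) h = f d(gh) - fg dh\<close> makes sums of terms \<open>f dg\<close> a right module.\<close>

lemma one_forms_eq: "one_forms = fdg_sums"
proof
  have left: "(\<lambda>(x, y). h x * \<omega> (x, y)) \<in> fdg_sums"
    if "\<omega> \<in> fdg_sums" "h \<in> finite_energy_fns" for h \<omega>
    using that(1)
  proof induction
    case (gen f g)
    have "(\<lambda>(x, y). h x * fdg f g (x, y)) = fdg (\<lambda>x. h x * f x) g"
      by (rule ext) (simp add: fdg_def case_prod_unfold)
    then show ?case using gen that(2) by (simp add: fdg_sums.gen finite_energy_mult)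
  next
    case (add \<omega> \<eta>)
    then show ?case using fdg_sums.add[OF add.IH] by (simp add: case_prod_unfold distrib_left)
  qed
  have right: "(\<lambda>(x, y). \<omega> (x, y) * h y) \<in> fdg_sums"
    if "\<omega> \<in> fdg_sums" "h \<in> finite_energy_fns" for h \<omega>
    using that(1)
  proof induction
    case (gen f g)
    have "(\<lambda>(x, y). fdg f g (x, y) * h y) =
        (\<lambda>z. fdg f (\<lambda>x. g x * h x) z + fdg (\<lambda>x. (-1) * (f x * g x)) h z)"
      by (rule ext) (simp add: fdg_def case_prod_unfold algebra_simps)
    moreover have "fdg f (\<lambda>x. g x * h x) \<in> fdg_sums" "fdg (\<lambda>x. (-1) * (f x * g x)) h \<in> fdg_sums"
      by (intro fdg_sums.gen finite_energy_mult finite_energy_cmult gen that(2))+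
    ultimately show ?case using fdg_sums.add by simp
  next
    case (add \<omega> \<eta>)
    then show ?case using fdg_sums.add[OF add.IH] by (simp add: case_prod_unfold distrib_right)
  qed
  show "one_forms \<subseteq> fdg_sums"
  proof
    fix \<omega> assume "\<omega> \<in> one_forms"
    then show "\<omega> \<in> fdg_sums" by induction (auto intro: fdg_sums.intros left right)
  qed
  show "fdg_sums \<subseteq> one_forms"
  proof
    fix \<omega> assume "\<omega> \<in> fdg_sums"
    then show "\<omega> \<in> one_forms" by induction (auto intro: one_forms.intros)
  qed
qed

text \<open>With the two module actions absorbed by \<open>one_forms_eq\<close>, an estimate for all
  one-forms needs only the case f dg and stability under sums.\<close>

lemma one_forms_induct [consumes 1, case_names gen add]:
  assumes "\<omega> \<in> one_forms"
    and "\<And>f g. f \<in> finite_energy_fns \<Longrightarrow> g \<in> finite_energy_fns \<Longrightarrow> P (fdg f g)"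
    and "\<And>\<omega> \<eta>. \<omega> \<in> one_forms \<Longrightarrow> \<eta> \<in> one_forms \<Longrightarrow> P \<omega> \<Longrightarrow> P \<eta> \<Longrightarrow> P (\<lambda>z. \<omega> z + \<eta> z)"
  shows "P \<omega>"
  using assms(1) unfolding one_forms_eq
proof induction
  case (add \<omega> \<eta>)
  then show ?case by (intro assms(3)) (auto simp: one_forms_eq)
qed (rule assms(2))

lemma one_forms_cmult: "\<omega> \<in> one_forms \<Longrightarrow> (\<lambda>z. c * \<omega> z) \<in> one_forms"
  using one_forms.left[of "\<lambda>_. c" \<omega>] by (simp add: case_prod_unfold)

lemma one_forms_sum:
  "(\<And>i. i \<in> I \<Longrightarrow> \<omega> i \<in> one_forms) \<Longrightarrow> (\<lambda>z. \<Sum>i\<in>I. \<omega> i z) \<in> one_forms"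
proof (induction I rule: infinite_finite_induct)
  case (insert i I)
  then show ?case using one_forms.add[of "\<omega> i" "\<lambda>z. \<Sum>i\<in>I. \<omega> i z"] by simp
qed (use one_forms.gen[of "\<lambda>_. 0" "\<lambda>_. 0"] in \<open>simp_all add: fdg_def case_prod_unfold\<close>)

lemma one_form_edge_bound:
  assumes "\<omega> \<in> one_forms"
  shows "\<exists>M. \<forall>m. \<forall>\<sigma>\<in>words m. \<forall>i<3. \<forall>j<3.
    \<bar>\<omega> (contr_word \<sigma> (vtx j), contr_word \<sigma> (vtx i))\<bar> \<le> M * sqrt (3/5) ^ m"
  using assms
proof (induction rule: one_forms_induct)
  case (gen f g)
  obtain M where M: "M > 0" "\<And>x. x \<in> gasket \<Longrightarrow> \<bar>f x\<bar> \<le> M"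
    using finite_energy_gasket_bounded[OF gen(1)] by blast
  obtain B where B: "\<And>m. energy_at m g g \<le> B" using gen(2) by (auto simp: finite_energy_iff)
  have "\<bar>fdg f g (contr_word \<sigma> (vtx j), contr_word \<sigma> (vtx i))\<bar> \<le> M * sqrt (2 * B) * sqrt (3/5) ^ m"
    if s: "\<sigma> \<in> words m" "i < 3" "j < 3" for m \<sigma> i j
  proof -
    have "\<bar>f (contr_word \<sigma> (vtx j))\<bar> * \<bar>g (contr_word \<sigma> (vtx j)) - g (contr_word \<sigma> (vtx i))\<bar>
        \<le> M * (sqrt (2 * B) * sqrt (3/5) ^ m)"
      using M(1) s by (intro mult_mono M(2) edge_increment_le[OF B]) auto
    then show ?thesis by (simp add: fdg_def abs_mult mult.assoc)
  qed
  then show ?case by blast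
next
  case (add \<omega> \<eta>)
  obtain M where M: "\<And>m \<sigma> i j. \<sigma> \<in> words m \<Longrightarrow> i < 3 \<Longrightarrow> j < 3 \<Longrightarrow>
    \<bar>\<omega> (contr_word \<sigma> (vtx j), contr_word \<sigma> (vtx i))\<bar> \<le> M * sqrt (3/5) ^ m"
    using add.IH(1) by blast
  obtain N where N: "\<And>m \<sigma> i j. \<sigma> \<in> words m \<Longrightarrow> i < 3 \<Longrightarrow> j < 3 \<Longrightarrow>
    \<bar>\<eta> (contr_word \<sigma> (vtx j), contr_word \<sigma> (vtx i))\<bar> \<le> N * sqrt (3/5) ^ m"
    using add.IH(2) by blast
  have "\<bar>\<omega> (contr_word \<sigma> (vtx j), contr_word \<sigma> (vtx i)) + \<eta> (contr_word \<sigma> (vtx j), contr_word \<sigma> (vtx i))\<bar>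
    \<le> (M + N) * sqrt (3/5) ^ m" if "\<sigma> \<in> words m" "i < 3" "j < 3" for m \<sigma> i j
    using M[OF that] N[OF that] unfolding distrib_right by linarith
  then show ?case by blast
qed

text \<open>The change of the Riemann sum of a form when the edge from x to y is replaced by its two
  halves.\<close>

definition refine_defect :: "form \<Rightarrow> pt \<Rightarrow> pt \<Rightarrow> real" where
  "refine_defect \<omega> x y = \<omega> (midpoint x y, x) + \<omega> (y, midpoint x y) - \<omega> (y, x)"

text \<open>The half of an edge of C_\<sigma> next to w_\<sigma>(p_i) is an edge of the subcell
  C_\<sigma>i. Distinct oriented edges have distinct first halves and distinct second halves, so
  each of the two sums is part of the sum over the next level.\<close>

lemma osum_half_le:
  assumes F: "\<And>x y. 0 \<le> F x y"
  shows "osum m (\<lambda>x y. F x (midpoint x y)) \<le> osum (Suc m) F"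
    and "osum m (\<lambda>x y. F (midpoint x y) y) \<le> osum (Suc m) F"
proof -
  have 1: "osum 0 (\<lambda>x y. G x (midpoint x y)) \<le> osum 1 G \<and> osum 0 (\<lambda>x y. G (midpoint x y) y) \<le> osum 1 G"
    if G: "\<And>x y. 0 \<le> G x y" for G
  proof -
    let ?s = "\<lambda>p. \<Sum>l<3. G (contr l (vtx (fst p))) (contr l (vtx (snd p)))"
    have o1: "osum 1 G = (\<Sum>p\<in>vpairs. ?s p)"
      unfolding osum_def sum_words_1 contr_word_single set012[symmetric]
      by (simp add: case_prod_unfold sum.distrib add.assoc)
    have le: "G (contr l (vtx (fst p))) (contr l (vtx (snd p))) \<le> ?s p" if "l < 3" for l p
      using that G by (intro member_le_sum) auto
    have "(\<Sum>p\<in>vpairs. G (vtx (fst p)) (midpoint (vtx (fst p)) (vtx (snd p)))) \<le> (\<Sum>p\<in>vpairs. ?s p)"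
    proof (rule sum_mono)
      fix p assume "p \<in> vpairs"
      then show "G (vtx (fst p)) (midpoint (vtx (fst p)) (vtx (snd p))) \<le> ?s p"
        using le[of "fst p" p] by (cases p) (auto simp: vpairs_iff contr_vtx_midpoint[symmetric])
    qed
    moreover have "(\<Sum>p\<in>vpairs. G (midpoint (vtx (fst p)) (vtx (snd p))) (vtx (snd p))) \<le> (\<Sum>p\<in>vpairs. ?s p)"
    proof (rule sum_mono)
      fix p assume "p \<in> vpairs"
      then show "G (midpoint (vtx (fst p)) (vtx (snd p))) (vtx (snd p)) \<le> ?s p"
        using le[of "snd p" p] by (cases p) (auto simp: vpairs_iff contr_vtx_midpoint[symmetric] contr_vtx_commute)
    qed
    ultimately show ?thesis unfolding o1 by (simp add: osum_def case_prod_unfold)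
  qed
  have "osum (m + 0) (\<lambda>x y. F x (midpoint x y)) \<le> osum (m + 1) F"
    unfolding osum_add_level contr_word_midpoint[symmetric]
  proof (rule sum_mono)
    fix \<sigma> show "osum 0 (\<lambda>x y. F (contr_word \<sigma> x) (contr_word \<sigma> (midpoint x y))) \<le>
        osum 1 (\<lambda>x y. F (contr_word \<sigma> x) (contr_word \<sigma> y))"
      by (rule conjunct1[OF 1[of "\<lambda>x y. F (contr_word \<sigma> x) (contr_word \<sigma> y)"]]) (rule F)
  qed
  then show "osum m (\<lambda>x y. F x (midpoint x y)) \<le> osum (Suc m) F" by simp
  have "osum (m + 0) (\<lambda>x y. F (midpoint x y) y) \<le> osum (m + 1) F"
    unfolding osum_add_level contr_word_midpoint[symmetric]
  proof (rule sum_mono)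
    fix \<sigma> show "osum 0 (\<lambda>x y. F (contr_word \<sigma> (midpoint x y)) (contr_word \<sigma> y)) \<le>
        osum 1 (\<lambda>x y. F (contr_word \<sigma> x) (contr_word \<sigma> y))"
      by (rule conjunct2[OF 1[of "\<lambda>x y. F (contr_word \<sigma> x) (contr_word \<sigma> y)"]]) (rule F)
  qed
  then show "osum m (\<lambda>x y. F (midpoint x y) y) \<le> osum (Suc m) F" by simp
qed

lemma osum_increment: "osum m (\<lambda>x y. (f y - f x)\<^sup>2) = 2 * (3/5) ^ m * energy_at m f f"
  by (simp add: energy_at_def power_divide power2_eq_square)

text \<open>For f dg and midpoint z the defect is (f z - f y)(g z - g x). Bounding the product by
  the squares of its factors leaves sums of squared increments at level m+1, that is, energies
  divided by (5/3)^(m+1); hence the decay, and 6/5 = 2 * 3/5.\<close>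

lemma refine_defect_sum_le:
  assumes "\<omega> \<in> one_forms"
  shows "\<exists>C. \<forall>m. osum m (\<lambda>x y. \<bar>refine_defect \<omega> x y\<bar>) \<le> C * (3/5) ^ m"
  using assms
proof (induction rule: one_forms_induct)
  case (gen f g)
  obtain A B where AB: "\<And>m. energy_at m f f \<le> A" "\<And>m. energy_at m g g \<le> B"
    using gen by (auto simp: finite_energy_iff)
  have "osum m (\<lambda>x y. \<bar>refine_defect (fdg f g) x y\<bar>) \<le> 6/5 * (A + B) * (3/5) ^ m" for m
  proof -
    let ?F = "\<lambda>x y. (f y - f x)\<^sup>2" and ?G = "\<lambda>x y. (g y - g x)\<^sup>2"
    have "osum m (\<lambda>x y. \<bar>refine_defect (fdg f g) x y\<bar>) \<le>
        osum m (\<lambda>x y. ?F (midpoint x y) y + ?G x (midpoint x y))"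
    proof (rule osum_mono)
      fix \<sigma> i j
      let ?x = "contr_word \<sigma> (vtx i)" and ?y = "contr_word \<sigma> (vtx j)"
      define z where "z = midpoint ?x ?y"
      have "refine_defect (fdg f g) ?x ?y = (f z - f ?y) * (g z - g ?x)"
        by (simp add: refine_defect_def fdg_def algebra_simps flip: z_def)
      moreover have "2 * \<bar>a * b\<bar> \<le> a\<^sup>2 + b\<^sup>2" for a b :: real
        using sum_squares_bound[of "\<bar>a\<bar>" "\<bar>b\<bar>"] by (simp add: abs_mult)
      from this[of "f z - f ?y" "g z - g ?x"]
      have "\<bar>(f z - f ?y) * (g z - g ?x)\<bar> \<le> (f ?y - f z)\<^sup>2 + (g z - g ?x)\<^sup>2"
        by (smt (verit) power2_commute zero_le_power2)
      ultimately show "\<bar>refine_defect (fdg f g) ?x ?y\<bar> \<le> ?F (midpoint ?x ?y) ?y + ?G ?x (midpoint ?x ?y)"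
        by (simp flip: z_def)
    qed
    also have "\<dots> \<le> osum (Suc m) ?F + osum (Suc m) ?G"
      unfolding osum_add by (intro add_mono osum_half_le) auto
    also have "\<dots> \<le> 2 * (3/5) ^ Suc m * A + 2 * (3/5) ^ Suc m * B"
      unfolding osum_increment using AB by (intro add_mono mult_left_mono) auto
    also have "\<dots> = 6/5 * (A + B) * (3/5) ^ m" by (simp add: field_simps)
    finally show ?thesis .
  qed
  then show ?case by blast
next
  case (add \<omega> \<eta>)
  then obtain C D where CD: "\<And>m. osum m (\<lambda>x y. \<bar>refine_defect \<omega> x y\<bar>) \<le> C * (3/5) ^ m"
    "\<And>m. osum m (\<lambda>x y. \<bar>refine_defect \<eta> x y\<bar>) \<le> D * (3/5) ^ m" by blast
  have "osum m (\<lambda>x y. \<bar>refine_defect (\<lambda>z. \<omega> z + \<eta> z) x y\<bar>) \<le> (C + D) * (3/5) ^ m" for m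
  proof -
    have "osum m (\<lambda>x y. \<bar>refine_defect (\<lambda>z. \<omega> z + \<eta> z) x y\<bar>) \<le>
        osum m (\<lambda>x y. \<bar>refine_defect \<omega> x y\<bar> + \<bar>refine_defect \<eta> x y\<bar>)"
      by (intro osum_mono) (simp add: refine_defect_def)
    then show ?thesis using CD[of m] unfolding osum_add distrib_right by linarith
  qed
  then show ?case by blast
qed

text \<open>The sum of F over the 2^k level-k pieces of the side from p_i to p_j: only cells whose
  words use the letters i and j touch this side in an edge.\<close>

primrec subsum :: "nat \<Rightarrow> nat \<Rightarrow> nat \<Rightarrow> (pt \<Rightarrow> pt \<Rightarrow> real) \<Rightarrow> real" where
  "subsum 0 i j F = F (vtx i) (vtx j)"
| "subsum (Suc k) i j F = subsum k i j (\<lambda>x y. F (contr i x) (contr i y))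
     + subsum k i j (\<lambda>x y. F (contr j x) (contr j y))"

lemma subsum_diff: "subsum k i j (\<lambda>x y. F x y - G x y) = subsum k i j F - subsum k i j G"
  by (induction k arbitrary: F G) simp_all

lemma subsum_abs_le: "\<bar>subsum k i j F\<bar> \<le> subsum k i j (\<lambda>x y. \<bar>F x y\<bar>)"
proof (induction k arbitrary: F)
  case (Suc k)
  show ?case
    using Suc[of "\<lambda>x y. F (contr i x) (contr i y)"] Suc[of "\<lambda>x y. F (contr j x) (contr j y)"]
    by simp
qed simp

lemma subsum_nonneg:
  assumes "\<And>x y. 0 \<le> F x y" shows "0 \<le> subsum k i j F"
  using assms
proof (induction k arbitrary: F)
  case (Suc k)
  show ?case unfolding subsum.simps by (intro add_nonneg_nonneg Suc.IH Suc.prems)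
qed simp

lemma subsum_telescope: "subsum k i j (\<lambda>x y. u y - u x) = u (vtx j) - u (vtx i)"
proof (induction k arbitrary: u)
  case (Suc k)
  show ?case
    using Suc[of "\<lambda>x. u (contr i x)"] Suc[of "\<lambda>x. u (contr j x)"] by (simp add: contr_vtx_commute[of j i])
qed simp

lemma contr_midpoint: "contr i (midpoint x y) = midpoint (contr i x) (contr i y)"
  using contr_word_midpoint[of "[i]"] by (simp add: contr_word_single)

text \<open>The definition recurses at the coarse end, through the first letter. This is the
  recursion at the fine end, where every piece is halved, as needed to compare successive Riemann
  sums.\<close>

lemma subsum_Suc:
  "subsum (Suc k) i j F = subsum k i j (\<lambda>x y. F x (midpoint x y) + F (midpoint x y) y)"
proof (induction k arbitrary: F)
  case 0
  show ?case by (simp add: contr_vtx_commute[of j i] contr_vtx_midpoint[of i j])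
next
  case (Suc k)
  show ?case
    by (subst subsum.simps(2), subst (1 2) Suc, subst subsum.simps(2)) (simp only: contr_midpoint)
qed

lemma sum_subsum_le:
  assumes "\<And>x y. 0 \<le> F x y"
  shows "(\<Sum>(i, j)\<in>vpairs. subsum k i j F) \<le> osum k F"
  using assms
proof (induction k arbitrary: F)
  case 0
  then show ?case by (simp add: osum_def)
next
  case (Suc k)
  let ?A = "\<lambda>l p. subsum k (fst p) (snd p) (\<lambda>x y. F (contr l x) (contr l y))"
  have nn: "0 \<le> ?A l p" for l p by (intro subsum_nonneg Suc.prems)
  have "(\<Sum>(i, j)\<in>vpairs. subsum (Suc k) i j F) \<le> (\<Sum>p\<in>vpairs. ?A 0 p + ?A 1 p + ?A 2 p)"
  proof (unfold case_prod_unfold, rule sum_mono)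
    fix p assume "p \<in> vpairs"
    then consider "p = (0,1)" | "p = (1,2)" | "p = (2,0)" | "p = (1,0)" | "p = (2,1)" | "p = (0,2)"
      unfolding vpairs_eq by blast
    then show "subsum (Suc k) (fst p) (snd p) F \<le> ?A 0 p + ?A 1 p + ?A 2 p"
      using nn[of p 0] nn[of p 1] nn[of p 2] by cases simp_all
  qed
  also have "\<dots> \<le> osum k (\<lambda>x y. F (contr 0 x) (contr 0 y)) + osum k (\<lambda>x y. F (contr 1 x) (contr 1 y))
      + osum k (\<lambda>x y. F (contr 2 x) (contr 2 y))"
    unfolding sum.distrib using Suc.IH[OF Suc.prems] unfolding case_prod_unfold by (intro add_mono)
  also have "\<dots> = osum (1 + k) F"
    unfolding osum_add_level sum_words_1 contr_word_single by simp
  finally show ?case by simp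
qed

section \<open>Edge integrals\<close>

lemma edges_memI:
  "\<sigma> \<in> words m \<Longrightarrow> (i, j) \<in> {(0,1), (1,2), (2,0)} \<Longrightarrow>
    (contr_word \<sigma> (vtx i), contr_word \<sigma> (vtx j)) \<in> edges m"
  unfolding edges_eq by (rule image_eqI[of _ _ "(\<sigma>, i, j)"]) simp_all

lemma oriented_edgesI:
  assumes "\<sigma> \<in> words m" "(i, j) \<in> vpairs"
  shows "(contr_word \<sigma> (vtx i), contr_word \<sigma> (vtx j)) \<in> oriented_edges m"
proof -
  have "(i, j) \<in> {(0,1), (1,2), (2,0)} \<or> (j, i) \<in> {(0,1), (1,2), (2,0)}"
    using assms(2) unfolding vpairs_eq by blast
  then show ?thesis
    unfolding oriented_edges_def using edges_memI[OF assms(1)] by blast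
qed

lemma oriented_edgesE:
  assumes "(x, y) \<in> oriented_edges m"
  obtains \<sigma> i j where "\<sigma> \<in> words m" "(i, j) \<in> vpairs" "x = contr_word \<sigma> (vtx i)" "y = contr_word \<sigma> (vtx j)"
proof -
  have *: "\<exists>\<sigma> i j. \<sigma> \<in> words m \<and> (i, j) \<in> {(0,1), (1,2), (2,0)} \<and> a = contr_word \<sigma> (vtx i) \<and> b = contr_word \<sigma> (vtx j)"
    if "(a, b) \<in> edges m" for a b
    using that unfolding edges_eq by auto
  from assms have "(x, y) \<in> edges m \<or> (y, x) \<in> edges m" unfolding oriented_edges_def by auto
  then show thesis
  proof
    assume "(x, y) \<in> edges m"
    from *[OF this] obtain \<sigma> i j where "\<sigma> \<in> words m" "(i, j) \<in> {(0,1), (1,2), (2,0)}"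
      "x = contr_word \<sigma> (vtx i)" "y = contr_word \<sigma> (vtx j)" by blast
    then show thesis by (intro that[of \<sigma> i j]) (auto simp: vpairs_eq)
  next
    assume "(y, x) \<in> edges m"
    from *[OF this] obtain \<sigma> i j where "\<sigma> \<in> words m" "(i, j) \<in> {(0,1), (1,2), (2,0)}"
      "y = contr_word \<sigma> (vtx i)" "x = contr_word \<sigma> (vtx j)" by blast
    then show thesis by (intro that[of \<sigma> j i]) (auto simp: vpairs_eq)
  qed
qed

lemma oriented_edges_gasket: "(x, y) \<in> oriented_edges m \<Longrightarrow> x \<in> gasket \<and> y \<in> gasket"
  by (elim oriented_edgesE) (auto simp: vpairs_iff)

lemma oriented_edges_neq: "(x, y) \<in> oriented_edges m \<Longrightarrow> x \<noteq> y"
  by (elim oriented_edgesE) (auto simp: vpairs_iff)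

lemma oriented_edges_addI:
  assumes "\<sigma> \<in> words m" "(x, y) \<in> oriented_edges k"
  shows "(contr_word \<sigma> x, contr_word \<sigma> y) \<in> oriented_edges (m + k)"
proof -
  obtain \<tau> i j where t: "\<tau> \<in> words k" "(i, j) \<in> vpairs" "x = contr_word \<tau> (vtx i)" "y = contr_word \<tau> (vtx j)"
    using assms(2) by (rule oriented_edgesE)
  show ?thesis
    using oriented_edgesI[OF words_append[OF assms(1) t(1)] t(2)] by (simp add: t contr_word_append)
qed

lemma oriented_edges_addE:
  assumes "(x, y) \<in> oriented_edges (m + k)"
  obtains \<sigma> x' y' where "\<sigma> \<in> words m" "(x', y') \<in> oriented_edges k" "x = contr_word \<sigma> x'" "y = contr_word \<sigma> y'"
proof -
  obtain \<rho> i j where r: "\<rho> \<in> words (m + k)" "(i, j) \<in> vpairs" "x = contr_word \<rho> (vtx i)" "y = contr_word \<rho> (vtx j)"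
    using assms by (rule oriented_edgesE)
  obtain \<sigma> \<tau> where st: "\<rho> = \<sigma> @ \<tau>" "\<sigma> \<in> words m" "\<tau> \<in> words k" using r(1) by (rule words_addE)
  show thesis
    by (rule that[OF st(2) oriented_edgesI[OF st(3) r(2)]]) (simp_all add: r st(1) contr_word_append)
qed

lemma finite_oriented_edges [simp]: "finite (oriented_edges m)"
proof -
  have "finite (edges m)" unfolding edges_eq by simp
  then show ?thesis unfolding oriented_edges_def by simp
qed

text \<open>A side is covered by its own images under the contractions: the half next to p_i by
  \<open>contr i\<close>, the other half by \<open>contr j\<close>. A compact set covered in this
  way lies in the attractor.\<close>

lemma segment_subset_gasket:
  assumes "i < 3" "j < 3" shows "closed_segment (vtx i) (vtx j) \<subseteq> gasket"
proof (rule attractor_subset[of _ "{..<3}"])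
  show "closed_segment (vtx i) (vtx j) \<subseteq> (\<Union>l\<in>{..<3}. contr l ` closed_segment (vtx i) (vtx j))"
  proof
    fix x assume "x \<in> closed_segment (vtx i) (vtx j)"
    then obtain t where t: "0 \<le> t" "t \<le> 1" "x = (1 - t) *\<^sub>R vtx i + t *\<^sub>R vtx j"
      by (auto simp: closed_segment_def)
    show "x \<in> (\<Union>l\<in>{..<3}. contr l ` closed_segment (vtx i) (vtx j))"
    proof (cases "t \<le> 1/2")
      case True
      let ?y = "(1 - 2 * t) *\<^sub>R vtx i + (2 * t) *\<^sub>R vtx j"
      have "?y \<in> closed_segment (vtx i) (vtx j)" using t True by (auto simp: closed_segment_def)
      moreover have "x = contr i ?y" by (simp add: contr_eq t(3) prod_eq_iff algebra_simps)
      ultimately show ?thesis using assms by blast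
    next
      case False
      let ?y = "(1 - (2 * t - 1)) *\<^sub>R vtx i + (2 * t - 1) *\<^sub>R vtx j"
      have "?y \<in> closed_segment (vtx i) (vtx j)"
        unfolding closed_segment_def using t False by (intro CollectI exI[of _ "2 * t - 1"]) auto
      moreover have "x = contr j ?y" by (simp add: contr_eq t(3) prod_eq_iff algebra_simps)
      ultimately show ?thesis using assms by blast
    qed
  qed
  show "(\<Union>l\<in>{..<3}. contr l ` gasket) \<subseteq> gasket" using gasket_invariant by blast
  show "gasket \<noteq> {}" by (metis vtx_in_gasket empty_iff zero_less_numeral)
qed auto

text \<open>\<open>subedges\<close> is defined by inclusion of segments. On the gasket this becomes
  the vanishing of the third barycentric coordinate, a condition that transforms simply under
  \<open>contr\<close>.\<close>

lemma in_side_iff: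
  assumes ij: "(i, j) \<in> vpairs" and z: "z \<in> gasket"
  shows "z \<in> closed_segment (vtx i) (vtx j) \<longleftrightarrow> (\<forall>l<3. l \<noteq> i \<longrightarrow> l \<noteq> j \<longrightarrow> bary l z = 0)"
proof
  assume "z \<in> closed_segment (vtx i) (vtx j)"
  then obtain t where "z = (1 - t) *\<^sub>R vtx i + t *\<^sub>R vtx j" by (auto simp: closed_segment_def)
  then show "\<forall>l<3. l \<noteq> i \<longrightarrow> l \<noteq> j \<longrightarrow> bary l z = 0"
    using ij by (auto simp: bary_convex bary_vtx vpairs_iff)
next
  assume *: "\<forall>l<3. l \<noteq> i \<longrightarrow> l \<noteq> j \<longrightarrow> bary l z = 0"
  define t where "t = bary j z"
  have "0 \<le> bary i z" "0 \<le> bary j z" using bary_gasket_nonneg[OF z] ij by (auto simp: vpairs_iff)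
  moreover have s: "bary i z + bary j z = 1"
    using ij * bary_sum[of z] unfolding vpairs_eq by auto
  ultimately have t01: "0 \<le> t" "t \<le> 1" unfolding t_def by linarith+
  have z_eq: "z = (1 - t) *\<^sub>R vtx i + t *\<^sub>R vtx j"
  proof -
    have "bary l z = bary l ((1 - t) *\<^sub>R vtx i + t *\<^sub>R vtx j)" if "l < 3" for l
    proof (cases "l = i \<or> l = j")
      case True
      then show ?thesis using ij s that by (auto simp: t_def vpairs_iff bary_convex bary_vtx)
    next
      case False
      then show ?thesis using * ij that by (auto simp: vpairs_iff bary_convex bary_vtx)
    qed
    then show ?thesis by (intro bary_eqI) simp_all
  qed
  show "z \<in> closed_segment (vtx i) (vtx j)"
    unfolding closed_segment_def by (intro CollectI exI[of _ t] conjI t01 z_eq)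
qed

lemma subedges_iff:
  "(x, y) \<in> subedges n (a, b) \<longleftrightarrow> (x, y) \<in> oriented_edges n \<and> x \<in> closed_segment a b \<and>
     y \<in> closed_segment a b \<and> 0 < inner (y - x) (b - a)"
  by (auto simp: subedges_def subset_closed_segment)

lemma finite_subedges [simp]: "finite (subedges n e)"
  by (rule finite_subset[OF _ finite_oriented_edges[of n]]) (auto simp: subedges_def)

lemma inner_contr_word_diff:
  "0 < inner (contr_word \<sigma> y - contr_word \<sigma> x) v \<longleftrightarrow> 0 < inner (y - x) v"
  by (simp add: contr_word_diff zero_less_mult_iff)

lemma subedges_contr_word:
  assumes s: "\<sigma> \<in> words m" and ab: "closed_segment a b \<subseteq> gasket"
  shows "subedges (m + k) (contr_word \<sigma> a, contr_word \<sigma> b) =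
    map_prod (contr_word \<sigma>) (contr_word \<sigma>) ` subedges k (a, b)"
proof -
  have inner: "0 < inner (contr_word \<sigma> y - contr_word \<sigma> x) (contr_word \<sigma> b - contr_word \<sigma> a)
    \<longleftrightarrow> 0 < inner (y - x) (b - a)" for x y
    by (simp add: contr_word_diff zero_less_mult_iff)
  have mem: "contr_word \<sigma> x \<in> closed_segment (contr_word \<sigma> a) (contr_word \<sigma> b) \<longleftrightarrow> x \<in> closed_segment a b" for x
    by (auto simp: contr_word_segment)
  have 1: "p \<in> map_prod (contr_word \<sigma>) (contr_word \<sigma>) ` subedges k (a, b)"
    if p: "p \<in> subedges (m + k) (contr_word \<sigma> a, contr_word \<sigma> b)" for p
  proof -
    obtain x y where xy: "p = (x, y)" by (cases p)
    note * = p[unfolded xy subedges_iff]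
    obtain \<tau> x' y' where t: "\<tau> \<in> words m" "(x', y') \<in> oriented_edges k" "x = contr_word \<tau> x'" "y = contr_word \<tau> y'"
      using * by (blast elim: oriented_edges_addE)
    obtain x'' y'' where s2: "x'' \<in> closed_segment a b" "y'' \<in> closed_segment a b" "x = contr_word \<sigma> x''" "y = contr_word \<sigma> y''"
      using * unfolding contr_word_segment by blast
    have "x'' \<in> gasket" "y'' \<in> gasket" using s2 ab by blast+
    then have eq: "\<tau> = \<sigma>" "x' = x''" "y' = y''"
      using edge_determines_word[OF t(1) s, of x' y' x'' y''] oriented_edges_gasket[OF t(2)]
        oriented_edges_neq[OF t(2)] s2 t by auto
    then have "(x'', y'') \<in> subedges k (a, b)"
      using * t s2 inner[of y'' x''] by (simp add: subedges_iff)
    then show ?thesis using s2 by (auto simp: xy)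
  qed
  have 2: "map_prod (contr_word \<sigma>) (contr_word \<sigma>) p \<in> subedges (m + k) (contr_word \<sigma> a, contr_word \<sigma> b)"
    if p: "p \<in> subedges k (a, b)" for p
  proof -
    obtain x y where xy: "p = (x, y)" by (cases p)
    note * = p[unfolded xy subedges_iff]
    then show ?thesis
      unfolding xy map_prod_simp subedges_iff mem inner using oriented_edges_addI[OF s] by blast
  qed
  show ?thesis by (intro subset_antisym subsetI image_subsetI 1 2)
qed

lemma subedges_0:
  assumes ij: "(i, j) \<in> vpairs"
  shows "subedges 0 (vtx i, vtx j) = {(vtx i, vtx j)}"
proof -
  have i: "i < 3" "j < 3" "i \<noteq> j" using ij by (auto simp: vpairs_iff)
  have *: "p = i \<or> p = j" if "p < 3" "vtx p \<in> closed_segment (vtx i) (vtx j)" for p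
  proof (rule ccontr)
    assume "\<not> (p = i \<or> p = j)"
    then have "bary p (vtx p) = 0" using that in_side_iff[OF ij, of "vtx p"] by simp
    then show False using that(1) by (simp add: bary_vtx)
  qed
  have 1: "e = (vtx i, vtx j)" if e: "e \<in> subedges 0 (vtx i, vtx j)" for e
  proof -
    obtain x y where xy: "e = (x, y)" by (cases e)
    note m = e[unfolded xy subedges_iff]
    obtain \<sigma> p q where pq: "\<sigma> \<in> words 0" "(p, q) \<in> vpairs" "x = contr_word \<sigma> (vtx p)" "y = contr_word \<sigma> (vtx q)"
      using m by (blast elim: oriented_edgesE)
    have pq': "x = vtx p" "y = vtx q" "p < 3" "q < 3" "p \<noteq> q" using pq by (auto simp: vpairs_iff)
    have "p = i \<or> p = j" "q = i \<or> q = j" using *[of p] *[of q] pq' m by auto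
    moreover have "\<not> (p = j \<and> q = i)"
    proof
      assume "p = j \<and> q = i"
      then have "0 < - inner (vtx j - vtx i) (vtx j - vtx i)"
        using m pq' by (simp add: inner_diff_left inner_diff_right)
      then show False using inner_ge_zero[of "vtx j - vtx i"] by linarith
    qed
    ultimately show ?thesis using pq' xy by auto
  qed
  have "(vtx i, vtx j) \<in> subedges 0 (vtx i, vtx j)"
    using oriented_edgesI[of "[]" 0, OF _ ij] i by (simp add: subedges_iff)
  with 1 show ?thesis by blast
qed

lemma subedges_Suc:
  assumes ij: "(i, j) \<in> vpairs"
  shows "subedges (Suc k) (vtx i, vtx j) =
    map_prod (contr i) (contr i) ` subedges k (vtx i, vtx j) \<union> map_prod (contr j) (contr j) ` subedges k (vtx i, vtx j)"
proof -
  have i: "i < 3" "j < 3" "i \<noteq> j" using ij by (auto simp: vpairs_iff)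
  have inner: "0 < inner (contr l y - contr l x) v \<longleftrightarrow> 0 < inner (y - x) v" for l x y v
    using inner_contr_word_diff[of "[l]"] by (simp add: contr_word_single)
  have mem: "contr l x \<in> closed_segment (vtx i) (vtx j) \<longleftrightarrow> x \<in> closed_segment (vtx i) (vtx j)"
    if "l = i \<or> l = j" "x \<in> gasket" for l x
    using that i in_side_iff[OF ij that(2)] in_side_iff[OF ij contr_in_gasket[of l x]]
    by (auto simp: bary_contr bary_vtx)
  \<comment> \<open>The cell opposite the side stays away from it: there the third coordinate is at
    least 1/2.\<close>
  have mem': "l = i \<or> l = j"
    if "contr l x \<in> closed_segment (vtx i) (vtx j)" "l < 3" "x \<in> gasket" for l x
    using that in_side_iff[OF ij contr_in_gasket[OF that(2,3)]] bary_contr_ge[OF that(2,3)] by force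
  have oe: "(contr l x, contr l y) \<in> oriented_edges (Suc k)" if "(x, y) \<in> oriented_edges k" "l < 3" for l x y
    using oriented_edges_addI[of "[l]" 1 x y k] that words_1 by (auto simp: contr_word_single less3)
  have 1: "p \<in> map_prod (contr i) (contr i) ` subedges k (vtx i, vtx j) \<union> map_prod (contr j) (contr j) ` subedges k (vtx i, vtx j)"
    if p: "p \<in> subedges (Suc k) (vtx i, vtx j)" for p
  proof -
    obtain x y where xy: "p = (x, y)" by (cases p)
    note * = p[unfolded xy subedges_iff]
    obtain \<tau> x' y' where t: "\<tau> \<in> words 1" "(x', y') \<in> oriented_edges k" "x = contr_word \<tau> x'" "y = contr_word \<tau> y'"
      using * by (auto intro: oriented_edges_addE[of x y 1 k])
    obtain l where l: "l < 3" "\<tau> = [l]" using t(1) unfolding words_1 by auto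
    have g: "x' \<in> gasket" "y' \<in> gasket" using oriented_edges_gasket[OF t(2)] by auto
    have xl: "x = contr l x'" "y = contr l y'" using t l by (simp_all add: contr_word_single)
    have lij: "l = i \<or> l = j" using mem'[OF _ l(1) g(1)] * xl by simp
    have "(x', y') \<in> subedges k (vtx i, vtx j)"
      using * t(2) mem[OF lij] g inner unfolding xl subedges_iff by blast
    then have "p \<in> map_prod (contr l) (contr l) ` subedges k (vtx i, vtx j)"
      using xl xy by auto
    then show ?thesis using lij by blast
  qed
  have 2: "map_prod (contr l) (contr l) p \<in> subedges (Suc k) (vtx i, vtx j)"
    if p: "p \<in> subedges k (vtx i, vtx j)" and l: "l = i \<or> l = j" for p l
  proof -
    obtain x y where xy: "p = (x, y)" by (cases p)
    note * = p[unfolded xy subedges_iff]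
    have l3: "l < 3" using l i by auto
    show ?thesis
      unfolding xy map_prod_simp subedges_iff inner
      using * oe[OF _ l3] oriented_edges_gasket[of x y k] mem[OF l, of x] mem[OF l, of y] by blast
  qed
  show ?thesis
    by (intro subset_antisym Un_least) ((rule subsetI, erule 1) | (rule image_subsetI, erule 2, simp))+
qed

lemma sum_subedges_vtx:
  assumes ij: "(i, j) \<in> vpairs"
  shows "(\<Sum>(x, y)\<in>subedges k (vtx i, vtx j). F x y) = subsum k i j F"
proof (induction k arbitrary: F)
  case 0
  show ?case by (simp add: subedges_0[OF ij])
next
  case (Suc k)
  let ?S = "subedges k (vtx i, vtx j)"
  have i: "i < 3" "j < 3" "i \<noteq> j" using ij by (auto simp: vpairs_iff)
  have inj: "inj_on (map_prod (contr l) (contr l)) ?S" for l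
    by (rule inj_onI) (auto simp: map_prod_def split: prod.splits)
  have "map_prod (contr i) (contr i) ` ?S \<inter> map_prod (contr j) (contr j) ` ?S = {}"
  proof (rule equals0I, elim IntE imageE)
    fix e p q
    assume *: "e = map_prod (contr i) (contr i) p" "e = map_prod (contr j) (contr j) q" and pq: "p \<in> ?S" "q \<in> ?S"
    obtain x y x' y' where xy: "p = (x, y)" "q = (x', y')" by (metis surj_pair)
    have e: "(x, y) \<in> oriented_edges k" "(x', y') \<in> oriented_edges k"
      using pq xy by (simp_all add: subedges_iff)
    have "contr i x = contr j x'" "contr i y = contr j y'" using * xy by simp_all
    from contr_eq_contr(1)[OF i _ _ this(1)] contr_eq_contr(1)[OF i _ _ this(2)]
    have "x = y" using oriented_edges_gasket[OF e(1)] oriented_edges_gasket[OF e(2)] by simp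
    with oriented_edges_neq[OF e(1)] show False by simp
  qed
  then have "(\<Sum>(x, y)\<in>subedges (Suc k) (vtx i, vtx j). F x y) =
      (\<Sum>(x, y)\<in>map_prod (contr i) (contr i) ` ?S. F x y) + (\<Sum>(x, y)\<in>map_prod (contr j) (contr j) ` ?S. F x y)"
    unfolding subedges_Suc[OF ij] by (intro sum.union_disjoint) simp_all
  also have "\<dots> = (\<Sum>(x, y)\<in>?S. F (contr i x) (contr i y)) + (\<Sum>(x, y)\<in>?S. F (contr j x) (contr j y))"
    unfolding sum.reindex[OF inj] by (simp add: o_def case_prod_unfold)
  finally show ?case by (simp add: Suc.IH)
qed

lemma sum_subedges:
  assumes s: "\<sigma> \<in> words m" and ij: "(i, j) \<in> vpairs"
  shows "(\<Sum>(x, y)\<in>subedges (m + k) (contr_word \<sigma> (vtx i), contr_word \<sigma> (vtx j)). F x y) =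
    subsum k i j (\<lambda>x y. F (contr_word \<sigma> x) (contr_word \<sigma> y))"
proof -
  have seg: "closed_segment (vtx i) (vtx j) \<subseteq> gasket"
    using ij by (intro segment_subset_gasket) (auto simp: vpairs_iff)
  have inj: "inj_on (map_prod (contr_word \<sigma>) (contr_word \<sigma>)) S" for S
    by (rule inj_onI) (auto simp: map_prod_def split: prod.splits)
  have "(\<Sum>(x, y)\<in>subedges (m + k) (contr_word \<sigma> (vtx i), contr_word \<sigma> (vtx j)). F x y) =
    (\<Sum>(x, y)\<in>subedges k (vtx i, vtx j). F (contr_word \<sigma> x) (contr_word \<sigma> y))"
    unfolding subedges_contr_word[OF s seg] sum.reindex[OF inj] by (simp add: o_def case_prod_unfold)
  then show ?thesis by (simp add: sum_subedges_vtx[OF ij])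
qed

definition edge_integral :: "form \<Rightarrow> pt \<Rightarrow> pt \<Rightarrow> real" where
  "edge_integral \<omega> x y = lim (\<lambda>n. \<Sum>(a, b)\<in>subedges n (x, y). \<omega> (b, a))"

lemma subsum_one_form_step:
  "subsum (Suc k) i j (\<lambda>x y. \<omega> (contr_word \<sigma> y, contr_word \<sigma> x)) - subsum k i j (\<lambda>x y. \<omega> (contr_word \<sigma> y, contr_word \<sigma> x))
   = subsum k i j (\<lambda>x y. refine_defect \<omega> (contr_word \<sigma> x) (contr_word \<sigma> y))"
  unfolding subsum_Suc subsum_diff[symmetric] refine_defect_def
  by (simp add: contr_word_midpoint)

lemma sum_subsum_words_le:
  assumes "\<And>x y. 0 \<le> F x y"
  shows "(\<Sum>\<sigma>\<in>words m. \<Sum>(i, j)\<in>vpairs. subsum k i j (\<lambda>x y. F (contr_word \<sigma> x) (contr_word \<sigma> y))) \<le> osum (m + k) F"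
  unfolding osum_add_level by (intro sum_mono sum_subsum_le assms)

text \<open>The k-th subdivision changes the sum by defects of edges of level m+k, and already the
  total of the defects over the whole gasket is O((3/5)^(m+k)). A geometric series therefore
  dominates the changes on a single edge.\<close>

lemma subsum_one_form_convergent:
  assumes w: "\<omega> \<in> one_forms" and s: "\<sigma> \<in> words m" and ij: "(i, j) \<in> vpairs"
  shows "convergent (\<lambda>k. subsum k i j (\<lambda>x y. \<omega> (contr_word \<sigma> y, contr_word \<sigma> x)))"
proof -
  obtain C where C: "\<And>m. osum m (\<lambda>x y. \<bar>refine_defect \<omega> x y\<bar>) \<le> C * (3/5) ^ m"
    using refine_defect_sum_le[OF w] by blast
  let ?S = "\<lambda>k. subsum k i j (\<lambda>x y. \<omega> (contr_word \<sigma> y, contr_word \<sigma> x))"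
  have b: "norm (?S (Suc k) - ?S k) \<le> C * (3/5) ^ m * (3/5) ^ k" for k
  proof -
    let ?T = "\<lambda>\<sigma> p. subsum k (fst p) (snd p) (\<lambda>x y. \<bar>refine_defect \<omega> (contr_word \<sigma> x) (contr_word \<sigma> y)\<bar>)"
    have nn: "0 \<le> ?T \<sigma> p" for \<sigma> p by (rule subsum_nonneg) simp
    have "norm (?S (Suc k) - ?S k) \<le> ?T \<sigma> (i, j)"
      unfolding subsum_one_form_step real_norm_def fst_conv snd_conv by (rule subsum_abs_le)
    also have "\<dots> \<le> (\<Sum>p\<in>vpairs. ?T \<sigma> p)" using ij by (intro member_le_sum nn finite_vpairs)
    also have "\<dots> \<le> (\<Sum>\<sigma>\<in>words m. \<Sum>p\<in>vpairs. ?T \<sigma> p)"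
      using s by (intro member_le_sum sum_nonneg nn finite_words)
    also have "\<dots> \<le> osum (m + k) (\<lambda>x y. \<bar>refine_defect \<omega> x y\<bar>)"
      using sum_subsum_words_le[of "\<lambda>x y. \<bar>refine_defect \<omega> x y\<bar>" k m] by (simp add: case_prod_unfold)
    also have "\<dots> \<le> C * (3/5) ^ (m + k)" by (rule C)
    finally show ?thesis by (simp add: power_add mult.assoc)
  qed
  have "summable (\<lambda>k. ?S (Suc k) - ?S k)"
    by (rule summable_comparison_test'[OF _ b]) (intro summable_mult summable_geometric; simp)
  then have "convergent (\<lambda>n. ?S n - ?S 0)"
    unfolding summable_iff_convergent sum_lessThan_telescope[of ?S] .
  then have "convergent (\<lambda>n. (?S n - ?S 0) + ?S 0)" by (intro convergent_add convergent_const)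
  then show ?thesis by simp
qed

lemma edge_integral_tendsto:
  assumes w: "\<omega> \<in> one_forms" and s: "\<sigma> \<in> words m" and ij: "(i, j) \<in> vpairs"
  shows "(\<lambda>n. \<Sum>(a, b)\<in>subedges n (contr_word \<sigma> (vtx i), contr_word \<sigma> (vtx j)). \<omega> (b, a))
      \<longlonglongrightarrow> edge_integral \<omega> (contr_word \<sigma> (vtx i)) (contr_word \<sigma> (vtx j))"
    and "(\<lambda>k. subsum k i j (\<lambda>x y. \<omega> (contr_word \<sigma> y, contr_word \<sigma> x)))
      \<longlonglongrightarrow> edge_integral \<omega> (contr_word \<sigma> (vtx i)) (contr_word \<sigma> (vtx j))"
proof -
  let ?N = "\<lambda>n. \<Sum>(a, b)\<in>subedges n (contr_word \<sigma> (vtx i), contr_word \<sigma> (vtx j)). \<omega> (b, a)"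
  let ?S = "\<lambda>k. subsum k i j (\<lambda>x y. \<omega> (contr_word \<sigma> y, contr_word \<sigma> x))"
  have eq: "?N (k + m) = ?S k" for k
    using sum_subedges[OF s ij, of "\<lambda>x y. \<omega> (y, x)" k] by (simp add: add.commute)
  obtain L where L: "?S \<longlonglongrightarrow> L"
    using subsum_one_form_convergent[OF assms] unfolding convergent_def by blast
  then have "(\<lambda>k. ?N (k + m)) \<longlonglongrightarrow> L" by (simp only: eq)
  then have N: "?N \<longlonglongrightarrow> L" by (rule LIMSEQ_offset)
  then have "edge_integral \<omega> (contr_word \<sigma> (vtx i)) (contr_word \<sigma> (vtx j)) = L"
    unfolding edge_integral_def by (rule limI)
  with N L show "?N \<longlonglongrightarrow> edge_integral \<omega> (contr_word \<sigma> (vtx i)) (contr_word \<sigma> (vtx j))"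
    "?S \<longlonglongrightarrow> edge_integral \<omega> (contr_word \<sigma> (vtx i)) (contr_word \<sigma> (vtx j))" by simp_all
qed

lemma form_integral_eq:
  assumes w: "\<omega> \<in> one_forms" and g: "set \<gamma> \<subseteq> (\<Union>m. oriented_edges m)"
  shows "form_integral \<gamma> \<omega> = (\<Sum>(x, y)\<leftarrow>\<gamma>. edge_integral \<omega> x y)"
proof -
  have "(\<lambda>n. \<Sum>e\<leftarrow>\<gamma>. \<Sum>(x, y)\<in>subedges n e. \<omega> (y, x)) \<longlonglongrightarrow> (\<Sum>(x, y)\<leftarrow>\<gamma>. edge_integral \<omega> x y)"
    using g
  proof (induction \<gamma>)
    case (Cons e \<gamma>)
    obtain x y where e: "e = (x, y)" by (cases e)
    obtain m where "(x, y) \<in> oriented_edges m" using Cons.prems e by auto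
    then obtain \<sigma> i j where s: "\<sigma> \<in> words m" "(i, j) \<in> vpairs" "x = contr_word \<sigma> (vtx i)" "y = contr_word \<sigma> (vtx j)"
      by (rule oriented_edgesE)
    have "(\<lambda>n. \<Sum>(a, b)\<in>subedges n e. \<omega> (b, a)) \<longlonglongrightarrow> edge_integral \<omega> x y"
      unfolding e s(3,4) by (rule edge_integral_tendsto(1)[OF w s(1,2)])
    moreover have "(\<lambda>n. \<Sum>e\<leftarrow>\<gamma>. \<Sum>(x, y)\<in>subedges n e. \<omega> (y, x)) \<longlonglongrightarrow> (\<Sum>(x, y)\<leftarrow>\<gamma>. edge_integral \<omega> x y)"
      using Cons by simp
    ultimately show ?case by (simp add: e tendsto_add)
  qed simp
  then show ?thesis unfolding form_integral_def by (rule limI)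
qed

lemma edge_integral_linear:
  assumes "\<omega> \<in> one_forms" "\<eta> \<in> one_forms" "(x, y) \<in> oriented_edges m"
  shows "edge_integral (\<lambda>z. a * \<omega> z + b * \<eta> z) x y = a * edge_integral \<omega> x y + b * edge_integral \<eta> x y"
proof -
  obtain \<sigma> i j where s: "\<sigma> \<in> words m" "(i, j) \<in> vpairs" "x = contr_word \<sigma> (vtx i)" "y = contr_word \<sigma> (vtx j)"
    using assms(3) by (rule oriented_edgesE)
  have "(\<lambda>n. a * (\<Sum>(u, v)\<in>subedges n (x, y). \<omega> (v, u)) + b * (\<Sum>(u, v)\<in>subedges n (x, y). \<eta> (v, u)))
    \<longlonglongrightarrow> a * edge_integral \<omega> x y + b * edge_integral \<eta> x y"
    unfolding s(3,4) by (intro tendsto_intros edge_integral_tendsto(1)[OF _ s(1,2)] assms)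
  then have "(\<lambda>n. \<Sum>(u, v)\<in>subedges n (x, y). a * \<omega> (v, u) + b * \<eta> (v, u))
    \<longlonglongrightarrow> a * edge_integral \<omega> x y + b * edge_integral \<eta> x y"
    by (simp add: sum.distrib sum_distrib_left case_prod_unfold)
  then show ?thesis
    unfolding edge_integral_def[of "\<lambda>z. a * \<omega> z + b * \<eta> z"] by (rule limI)
qed

text \<open>Adding the defects of all later subdivisions gives the factor 5/2 = 1/(1 - 3/5). The
  estimate is proved after K subdivisions and survives the limit in K, because level m has only
  finitely many edges.\<close>

lemma edge_integral_error:
  assumes w: "\<omega> \<in> one_forms"
  shows "\<exists>C. \<forall>m. osum m (\<lambda>x y. \<bar>edge_integral \<omega> x y - \<omega> (y, x)\<bar>) \<le> C * (3/5) ^ m"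
proof -
  obtain C where C: "\<And>m. osum m (\<lambda>x y. \<bar>refine_defect \<omega> x y\<bar>) \<le> C * (3/5) ^ m"
    using refine_defect_sum_le[OF w] by blast
  have "0 \<le> osum 0 (\<lambda>x y. \<bar>refine_defect \<omega> x y\<bar>)" by (rule osum_nonneg) simp
  with C[of 0] have C0: "0 \<le> C" by simp
  have "osum m (\<lambda>x y. \<bar>edge_integral \<omega> x y - \<omega> (y, x)\<bar>) \<le> C * (3/5) ^ m * (5/2)" for m
  proof -
    let ?S = "\<lambda>k \<sigma> p. subsum k (fst p) (snd p) (\<lambda>x y. \<omega> (contr_word \<sigma> y, contr_word \<sigma> x))"
    let ?D = "\<lambda>k \<sigma> p. subsum k (fst p) (snd p) (\<lambda>x y. \<bar>refine_defect \<omega> (contr_word \<sigma> x) (contr_word \<sigma> y)\<bar>)"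
    let ?I = "\<lambda>\<sigma> p. edge_integral \<omega> (contr_word \<sigma> (vtx (fst p))) (contr_word \<sigma> (vtx (snd p)))"
    have "(\<Sum>\<sigma>\<in>words m. \<Sum>p\<in>vpairs. \<bar>?S K \<sigma> p - ?S 0 \<sigma> p\<bar>) \<le> C * (3/5) ^ m * (5/2)" for K
    proof -
      have "\<bar>?S K \<sigma> p - ?S 0 \<sigma> p\<bar> \<le> (\<Sum>k<K. ?D k \<sigma> p)" for \<sigma> p
      proof -
        have "?S K \<sigma> p - ?S 0 \<sigma> p = (\<Sum>k<K. ?S (Suc k) \<sigma> p - ?S k \<sigma> p)"
          by (rule sum_lessThan_telescope[symmetric])
        also have "\<bar>\<dots>\<bar> \<le> (\<Sum>k<K. ?D k \<sigma> p)"
          unfolding subsum_one_form_step by (rule order_trans[OF sum_abs sum_mono[OF subsum_abs_le]])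
        finally show ?thesis .
      qed
      then have "(\<Sum>\<sigma>\<in>words m. \<Sum>p\<in>vpairs. \<bar>?S K \<sigma> p - ?S 0 \<sigma> p\<bar>) \<le> (\<Sum>\<sigma>\<in>words m. \<Sum>p\<in>vpairs. \<Sum>k<K. ?D k \<sigma> p)"
        by (intro sum_mono)
      also have "\<dots> = (\<Sum>k<K. \<Sum>\<sigma>\<in>words m. \<Sum>p\<in>vpairs. ?D k \<sigma> p)"
        by (simp only: sum.swap[of _ _ "{..<K}"])
      also have "\<dots> \<le> (\<Sum>k<K. C * (3/5) ^ m * (3/5) ^ k)"
      proof (rule sum_mono)
        fix k
        have "(\<Sum>\<sigma>\<in>words m. \<Sum>p\<in>vpairs. ?D k \<sigma> p) \<le> osum (m + k) (\<lambda>x y. \<bar>refine_defect \<omega> x y\<bar>)"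
          using sum_subsum_words_le[of "\<lambda>x y. \<bar>refine_defect \<omega> x y\<bar>" k m] by (simp add: case_prod_unfold)
        also have "\<dots> \<le> C * (3/5) ^ (m + k)" by (rule C)
        finally show "(\<Sum>\<sigma>\<in>words m. \<Sum>p\<in>vpairs. ?D k \<sigma> p) \<le> C * (3/5) ^ m * (3/5) ^ k"
          by (simp add: power_add mult.assoc)
      qed
      also have "\<dots> = C * (3/5) ^ m * (\<Sum>k<K. (3/5) ^ k)" by (simp add: sum_distrib_left)
      also have "\<dots> \<le> C * (3/5) ^ m * (5/2)"
      proof (rule mult_left_mono)
        have "(\<Sum>k<K. (3/5::real) ^ k) = (1 - (3/5) ^ K) * (5/2)"
          by (subst sum_gp_strict) simp
        then show "(\<Sum>k<K. (3/5::real) ^ k) \<le> 5/2" by simp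
      qed (use C0 in simp)
      finally show ?thesis .
    qed
    moreover have "(\<lambda>K. \<Sum>\<sigma>\<in>words m. \<Sum>p\<in>vpairs. \<bar>?S K \<sigma> p - ?S 0 \<sigma> p\<bar>)
        \<longlonglongrightarrow> (\<Sum>\<sigma>\<in>words m. \<Sum>p\<in>vpairs. \<bar>?I \<sigma> p - ?S 0 \<sigma> p\<bar>)"
      by (intro tendsto_intros edge_integral_tendsto(2)[OF w]) simp_all
    ultimately have "(\<Sum>\<sigma>\<in>words m. \<Sum>p\<in>vpairs. \<bar>?I \<sigma> p - ?S 0 \<sigma> p\<bar>) \<le> C * (3/5) ^ m * (5/2)"
      by (intro LIMSEQ_le_const2) auto
    then show ?thesis by (simp add: osum_def case_prod_unfold)
  qed
  then have "\<forall>m. osum m (\<lambda>x y. \<bar>edge_integral \<omega> x y - \<omega> (y, x)\<bar>) \<le> (C * (5/2)) * (3/5) ^ m"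
    by (simp only: mult_ac) simp
  then show ?thesis by blast
qed

text \<open>Two nested inductions reduce the claim to f dg against h dk, where it is
  \<open>energy_measure_integral_tendsto\<close> with integrand f h.\<close>

lemma inner_tendsto_one_forms:
  assumes c: "form_completion \<iota>" and w: "\<omega> \<in> one_forms" and e: "\<eta> \<in> one_forms"
  shows "(\<lambda>m. (5/3) ^ m / 2 * osum m (\<lambda>x y. \<omega> (y, x) * \<eta> (y, x))) \<longlonglongrightarrow> inner (\<iota> \<omega>) (\<iota> \<eta>)"
proof -
  have add: "\<iota> (\<lambda>z. \<omega> z + \<eta> z) = \<iota> \<omega> + \<iota> \<eta>" if "\<omega> \<in> one_forms" "\<eta> \<in> one_forms" for \<omega> \<eta>
    using c[unfolded form_completion_def, THEN conjunct1, rule_format, OF that, of 1 1] by simp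
  have 1: "(\<lambda>m. (5/3) ^ m / 2 * osum m (\<lambda>x y. fdg f g (y, x) * \<eta> (y, x))) \<longlonglongrightarrow> inner (\<iota> (fdg f g)) (\<iota> \<eta>)"
    if fg: "f \<in> finite_energy_fns" "g \<in> finite_energy_fns" for f g
    using e
  proof (induction rule: one_forms_induct)
    case (gen h k)
    have "inner (\<iota> (fdg f g)) (\<iota> (fdg h k)) = energy_measure_integral g k (\<lambda>x. f x * h x)"
      using c fg gen unfolding form_completion_def by blast
    moreover have "(\<lambda>x y. fdg f g (y, x) * fdg h k (y, x)) = (\<lambda>x y. f y * h y * (g y - g x) * (k y - k x))"
      by (intro ext) (simp add: fdg_def)
    ultimately show ?case
      using energy_measure_integral_tendsto[OF fg(2) gen(2) finite_energy_mult[OF fg(1) gen(1)]] by simp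
  next
    case (add \<omega> \<eta>)
    have "(\<lambda>m. (5/3) ^ m / 2 * osum m (\<lambda>x y. fdg f g (y, x) * \<omega> (y, x)) + (5/3) ^ m / 2 * osum m (\<lambda>x y. fdg f g (y, x) * \<eta> (y, x)))
      \<longlonglongrightarrow> inner (\<iota> (fdg f g)) (\<iota> \<omega>) + inner (\<iota> (fdg f g)) (\<iota> \<eta>)"
      by (intro tendsto_add add.IH)
    then show ?case
      unfolding \<open>\<And>\<eta> \<omega>. \<lbrakk>\<omega> \<in> one_forms; \<eta> \<in> one_forms\<rbrakk> \<Longrightarrow> \<iota> (\<lambda>z. \<omega> z + \<eta> z) = \<iota> \<omega> + \<iota> \<eta>\<close>[OF add.hyps]
      by (simp only: inner_add_right distrib_left osum_add)
  qed
  show ?thesis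
    using w
  proof (induction rule: one_forms_induct)
    case (gen f g)
    then show ?case by (rule 1)
  next
    case (add \<omega> \<theta>)
    have "(\<lambda>m. (5/3) ^ m / 2 * osum m (\<lambda>x y. \<omega> (y, x) * \<eta> (y, x)) + (5/3) ^ m / 2 * osum m (\<lambda>x y. \<theta> (y, x) * \<eta> (y, x)))
      \<longlonglongrightarrow> inner (\<iota> \<omega>) (\<iota> \<eta>) + inner (\<iota> \<theta>) (\<iota> \<eta>)"
      by (intro tendsto_add add.IH)
    then show ?case
      unfolding \<open>\<And>\<eta> \<omega>. \<lbrakk>\<omega> \<in> one_forms; \<eta> \<in> one_forms\<rbrakk> \<Longrightarrow> \<iota> (\<lambda>z. \<omega> z + \<eta> z) = \<iota> \<omega> + \<iota> \<eta>\<close>[OF add.hyps]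
      by (simp only: inner_add_left distrib_right distrib_left osum_add)
  qed
qed

text \<open>Each term of the difference contains one error factor, summable over edges to
  O((3/5)^m), and another factor that is uniformly small. The first absorbs the weight (5/3)^m, the
  second makes the difference vanish.\<close>

lemma inner_tendsto_edge_integrals:
  assumes c: "form_completion \<iota>" and w: "\<omega> \<in> one_forms" and e: "\<eta> \<in> one_forms"
  shows "(\<lambda>m. (5/3) ^ m / 2 * osum m (\<lambda>x y. edge_integral \<omega> x y * edge_integral \<eta> x y)) \<longlonglongrightarrow> inner (\<iota> \<omega>) (\<iota> \<eta>)"
proof -
  obtain C where C: "\<And>m. osum m (\<lambda>x y. \<bar>edge_integral \<omega> x y - \<omega> (y, x)\<bar>) \<le> C * (3/5) ^ m"
    using edge_integral_error[OF w] by blast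
  obtain D where D: "\<And>m. osum m (\<lambda>x y. \<bar>edge_integral \<eta> x y - \<eta> (y, x)\<bar>) \<le> D * (3/5) ^ m"
    using edge_integral_error[OF e] by blast
  obtain M where M: "\<And>m \<sigma> i j. \<sigma> \<in> words m \<Longrightarrow> i < 3 \<Longrightarrow> j < 3 \<Longrightarrow>
    \<bar>\<omega> (contr_word \<sigma> (vtx j), contr_word \<sigma> (vtx i))\<bar> \<le> M * sqrt (3/5) ^ m"
    using one_form_edge_bound[OF w] by blast
  obtain N where N: "\<And>m \<sigma> i j. \<sigma> \<in> words m \<Longrightarrow> i < 3 \<Longrightarrow> j < 3 \<Longrightarrow>
    \<bar>\<eta> (contr_word \<sigma> (vtx j), contr_word \<sigma> (vtx i))\<bar> \<le> N * sqrt (3/5) ^ m"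
    using one_form_edge_bound[OF e] by blast
  let ?p = "\<lambda>x y. edge_integral \<omega> x y - \<omega> (y, x)" and ?q = "\<lambda>x y. edge_integral \<eta> x y - \<eta> (y, x)"
  let ?A = "\<lambda>m. (5/3::real) ^ m / 2 * osum m (\<lambda>x y. edge_integral \<omega> x y * edge_integral \<eta> x y)"
  let ?B = "\<lambda>m. (5/3::real) ^ m / 2 * osum m (\<lambda>x y. \<omega> (y, x) * \<eta> (y, x))"
  have M0: "0 \<le> M * sqrt (3/5) ^ m" and N0: "0 \<le> N * sqrt (3/5) ^ m" for m
    using order_trans[OF abs_ge_zero M[of "replicate m 0" m 0 0]]
      order_trans[OF abs_ge_zero N[of "replicate m 0" m 0 0]] by simp_all
  have D0: "0 \<le> D * (3/5) ^ m" for m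
    using D[of m] osum_nonneg[of "\<lambda>x y. \<bar>?q x y\<bar>" m] by simp
  have bound: "\<bar>?A m - ?B m\<bar> \<le> (C * D * (3/5) ^ m + (C * N + D * M) * sqrt (3/5) ^ m) / 2" for m
  proof -
    let ?a = "osum m (\<lambda>x y. \<bar>?p x y\<bar>)" and ?b = "osum m (\<lambda>x y. \<bar>?q x y\<bar>)"
    \<comment> \<open>A single error is at most the sum of all errors; this gives the uniform
      smallness required for the product of two errors.\<close>
    have q: "\<bar>?q (contr_word \<sigma> (vtx i)) (contr_word \<sigma> (vtx j))\<bar> \<le> D * (3/5) ^ m"
      if "\<sigma> \<in> words m" "i < 3" "j < 3" "i \<noteq> j" for \<sigma> i j
    proof -
      have "\<bar>?q (contr_word \<sigma> (vtx i)) (contr_word \<sigma> (vtx j))\<bar> \<le> ?b"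
        by (rule osum_ge_term[of "\<lambda>x y. \<bar>?q x y\<bar>"]) (use that in simp_all)
      also have "\<dots> \<le> D * (3/5) ^ m" by (rule D)
      finally show ?thesis .
    qed
    have "\<bar>osum m (\<lambda>x y. edge_integral \<omega> x y * edge_integral \<eta> x y) - osum m (\<lambda>x y. \<omega> (y, x) * \<eta> (y, x))\<bar>
      = \<bar>osum m (\<lambda>x y. edge_integral \<omega> x y * edge_integral \<eta> x y - \<omega> (y, x) * \<eta> (y, x))\<bar>"
      by (simp only: osum_diff)
    also have "\<dots> \<le> osum m (\<lambda>x y. \<bar>edge_integral \<omega> x y * edge_integral \<eta> x y - \<omega> (y, x) * \<eta> (y, x)\<bar>)"
      unfolding osum_def case_prod_unfold by (intro order_trans[OF sum_abs] sum_mono sum_abs)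
    also have "\<dots> \<le> osum m (\<lambda>x y. D * (3/5) ^ m * \<bar>?p x y\<bar> + (N * sqrt (3/5) ^ m * \<bar>?p x y\<bar> + M * sqrt (3/5) ^ m * \<bar>?q x y\<bar>))"
    proof (rule osum_mono)
      fix \<sigma> i j assume s: "\<sigma> \<in> words m" "(i, j) \<in> vpairs"
      then have ij: "i < 3" "j < 3" "i \<noteq> j" by (auto simp: vpairs_iff)
      let ?x = "contr_word \<sigma> (vtx i)" and ?y = "contr_word \<sigma> (vtx j)"
      have split: "edge_integral \<omega> ?x ?y * edge_integral \<eta> ?x ?y - \<omega> (?y, ?x) * \<eta> (?y, ?x)
        = ?p ?x ?y * ?q ?x ?y + (?p ?x ?y * \<eta> (?y, ?x) + \<omega> (?y, ?x) * ?q ?x ?y)"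
        by (simp add: algebra_simps)
      have "\<bar>a * b + (a * c + d * b)\<bar> \<le> \<bar>b\<bar> * \<bar>a\<bar> + (\<bar>c\<bar> * \<bar>a\<bar> + \<bar>d\<bar> * \<bar>b\<bar>)" for a b c d :: real
        using abs_triangle_ineq[of "a * b" "a * c + d * b"] abs_triangle_ineq[of "a * c" "d * b"]
        by (simp add: abs_mult mult.commute)
      then have "\<bar>edge_integral \<omega> ?x ?y * edge_integral \<eta> ?x ?y - \<omega> (?y, ?x) * \<eta> (?y, ?x)\<bar> \<le>
          \<bar>?q ?x ?y\<bar> * \<bar>?p ?x ?y\<bar> + (\<bar>\<eta> (?y, ?x)\<bar> * \<bar>?p ?x ?y\<bar> + \<bar>\<omega> (?y, ?x)\<bar> * \<bar>?q ?x ?y\<bar>)"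
        unfolding split .
      also have "\<dots> \<le> D * (3/5) ^ m * \<bar>?p ?x ?y\<bar> + (N * sqrt (3/5) ^ m * \<bar>?p ?x ?y\<bar> + M * sqrt (3/5) ^ m * \<bar>?q ?x ?y\<bar>)"
        using q[OF s(1) ij] M[OF s(1) ij(1,2)] N[OF s(1) ij(1,2)] by (intro add_mono mult_right_mono) auto
      finally show "\<bar>edge_integral \<omega> ?x ?y * edge_integral \<eta> ?x ?y - \<omega> (?y, ?x) * \<eta> (?y, ?x)\<bar> \<le>
        D * (3/5) ^ m * \<bar>?p ?x ?y\<bar> + (N * sqrt (3/5) ^ m * \<bar>?p ?x ?y\<bar> + M * sqrt (3/5) ^ m * \<bar>?q ?x ?y\<bar>)" .
    qed
    also have "\<dots> = D * (3/5) ^ m * ?a + (N * sqrt (3/5) ^ m * ?a + M * sqrt (3/5) ^ m * ?b)"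
      by (simp only: osum_add osum_cmult)
    also have "\<dots> \<le> D * (3/5) ^ m * (C * (3/5) ^ m) + (N * sqrt (3/5) ^ m * (C * (3/5) ^ m) + M * sqrt (3/5) ^ m * (D * (3/5) ^ m))"
      by (intro add_mono mult_left_mono C D M0 N0 D0)
    finally have le: "\<bar>osum m (\<lambda>x y. edge_integral \<omega> x y * edge_integral \<eta> x y) - osum m (\<lambda>x y. \<omega> (y, x) * \<eta> (y, x))\<bar>
      \<le> D * (3/5) ^ m * (C * (3/5) ^ m) + (N * sqrt (3/5) ^ m * (C * (3/5) ^ m) + M * sqrt (3/5) ^ m * (D * (3/5) ^ m))"
      (is "\<bar>?u - ?v\<bar> \<le> ?R") .
    have R: "?R = (3/5) ^ m * (C * D * (3/5) ^ m + (C * N + D * M) * sqrt (3/5) ^ m)"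
      by (simp only: distrib_left distrib_right mult_ac)
    have "\<bar>?A m - ?B m\<bar> = (5/3) ^ m / 2 * \<bar>?u - ?v\<bar>"
      by (simp only: right_diff_distrib[symmetric] abs_mult) simp
    also have "\<dots> \<le> (5/3) ^ m / 2 * ?R" by (rule mult_left_mono[OF le]) simp
    also have "\<dots> = ((5/3) ^ m * (3/5) ^ m) * ((C * D * (3/5) ^ m + (C * N + D * M) * sqrt (3/5) ^ m) / 2)"
      unfolding R by (simp only: mult_ac times_divide_eq_right times_divide_eq_left)
    also have "\<dots> = (C * D * (3/5) ^ m + (C * N + D * M) * sqrt (3/5) ^ m) / 2"
      by (subst power_mult_distrib[symmetric]) simp
    finally show ?thesis .
  qed
  have "(\<lambda>m. (C * D * (3/5) ^ m + (C * N + D * M) * sqrt (3/5) ^ m) / 2) \<longlonglongrightarrow> (C * D * 0 + (C * N + D * M) * 0) / 2"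
  proof -
    have "(\<lambda>m. (3/5::real) ^ m) \<longlonglongrightarrow> 0" "(\<lambda>m. sqrt (3/5) ^ m) \<longlonglongrightarrow> 0"
      by (simp_all add: LIMSEQ_realpow_zero)
    then show ?thesis by (intro tendsto_divide tendsto_add tendsto_mult tendsto_const) simp_all
  qed
  then have lim0: "(\<lambda>m. (C * D * (3/5) ^ m + (C * N + D * M) * sqrt (3/5) ^ m) / 2) \<longlonglongrightarrow> 0" by simp
  have "(\<lambda>m. ?A m - ?B m) \<longlonglongrightarrow> 0"
    by (rule Lim_null_comparison[OF _ lim0], rule always_eventually) (simp only: real_norm_def bound simp_thms)
  from tendsto_add[OF this inner_tendsto_one_forms[OF c w e]] show ?thesis by simp
qed

section \<open>Forms with local potentials\<close>

lemma sum_of_bool_vtx: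
  assumes "k < 3" "contr_word \<sigma> (vtx k) = v"
  shows "(\<Sum>l<3. of_bool (contr_word \<sigma> (vtx l) = v) * a l) = (a k :: real)"
proof -
  have "(\<Sum>l<3. of_bool (contr_word \<sigma> (vtx l) = v) * a l) = (\<Sum>l<3. if l = k then a l else 0)"
    using assms by (intro sum.cong) auto
  also have "\<dots> = a k" using assms(1) by simp
  finally show ?thesis .
qed

text \<open>The form \<open>\<chi> dg\<close>, where near the vertex \<open>v\<close> the function \<open>\<chi>\<close> is \<open>1\<close> on the support of \<open>dg\<close> in
  \<open>C\<^sub>\<tau>\<close>, and \<open>g\<close> is constant on the support of \<open>\<chi>\<close> in the other cell at \<open>v\<close>.\<close>

lemma corner_form_exists:
  assumes t: "\<tau> \<in> words n" "j < 3"
    and bumps: "\<And>k. k < 3 \<Longrightarrow> corner_bumps k (\<phi> k) (\<psi> k)"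
  shows "\<exists>\<beta>\<in>one_forms. \<forall>\<sigma>\<in>words n. \<forall>\<rho>\<in>words 2. \<forall>x\<in>gasket. \<forall>y\<in>gasket.
    \<beta> (contr_word \<sigma> (contr_word \<rho> x), contr_word \<sigma> (contr_word \<rho> y)) =
      (if \<sigma> = \<tau> then \<psi> j (contr_word \<rho> x) - \<psi> j (contr_word \<rho> y) else 0)"
proof -
  have F: "\<phi> k \<in> finite_energy_fns" "\<psi> k \<in> finite_energy_fns" if "k < 3" for k
    using bumps[OF that] by (auto simp: corner_bumps_def)
  have v: "\<phi> k (vtx i) = of_bool (i = k)" "\<psi> k (vtx i) = of_bool (i = k)" if "k < 3" "i < 3" for k i
    using bumps[OF that(1)] that(2) by (auto simp: corner_bumps_def)
  have p12: "\<phi> k (contr_word \<rho> x) * (\<psi> k (contr_word \<rho> x) - \<psi> k (contr_word \<rho> y)) = \<psi> k (contr_word \<rho> x) - \<psi> k (contr_word \<rho> y)"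
    "\<psi> k (contr_word \<rho> x) * (\<phi> k (contr_word \<rho> x) - \<phi> k (contr_word \<rho> y)) = 0"
    if "k < 3" "\<rho> \<in> words 2" "x \<in> gasket" "y \<in> gasket" for k \<rho> x y
  proof -
    from bumps[OF that(1)] that(2)
    have "(\<forall>x\<in>gasket. \<phi> k (contr_word \<rho> x) = 1) \<or> (\<forall>x\<in>gasket. \<psi> k (contr_word \<rho> x) = 0)"
      unfolding corner_bumps_def by blast
    then show "\<phi> k (contr_word \<rho> x) * (\<psi> k (contr_word \<rho> x) - \<psi> k (contr_word \<rho> y)) = \<psi> k (contr_word \<rho> x) - \<psi> k (contr_word \<rho> y)"
      "\<psi> k (contr_word \<rho> x) * (\<phi> k (contr_word \<rho> x) - \<phi> k (contr_word \<rho> y)) = 0"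
      using that(3,4) by auto
  qed
  define p where "p = contr_word \<tau> (vtx j)"
  \<comment> \<open>Whichever cell it is read in, such a family takes at each level-n vertex the
    indicator of p, so it glues. A cell has p as at most one of its vertices, so outside \<tau> at
    most one summand is nonzero.\<close>
  define ext where "ext a b \<sigma> = (if \<sigma> = \<tau> then a j else (\<lambda>x. \<Sum>k<3. of_bool (contr_word \<sigma> (vtx k) = p) * b k x))"
    for a b :: "nat \<Rightarrow> pt \<Rightarrow> real" and \<sigma>
  have glueable: "\<exists>g\<in>finite_energy_fns. \<forall>\<sigma>\<in>words n. \<forall>x\<in>gasket. g (contr_word \<sigma> x) = ext a b \<sigma> x"
    if ab: "\<And>k. k < 3 \<Longrightarrow> a k \<in> finite_energy_fns" "\<And>k. k < 3 \<Longrightarrow> b k \<in> finite_energy_fns"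
      "\<And>k i. k < 3 \<Longrightarrow> i < 3 \<Longrightarrow> a k (vtx i) = of_bool (i = k)"
      "\<And>k i. k < 3 \<Longrightarrow> i < 3 \<Longrightarrow> b k (vtx i) = of_bool (i = k)" for a b
  proof -
    have val: "ext a b \<sigma> (vtx i) = of_bool (contr_word \<sigma> (vtx i) = p)" if i: "i < 3" for \<sigma> i
    proof (cases "\<sigma> = \<tau>")
      case True
      then show ?thesis using t(2) i ab(3) by (simp add: ext_def p_def)
    next
      case False
      have "(\<Sum>k<3. of_bool (contr_word \<sigma> (vtx k) = p) * b k (vtx i)) = (\<Sum>k<3. if k = i then of_bool (contr_word \<sigma> (vtx i) = p) else 0)"
        using i ab(4) by (intro sum.cong) auto
      then show ?thesis using False i by (simp add: ext_def)
    qed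
    show ?thesis
    proof (rule glue_family)
      show "ext a b \<sigma> \<in> finite_energy_fns" for \<sigma>
        unfolding ext_def using ab(1)[OF t(2)] ab(2) by (auto intro!: finite_energy_sum finite_energy_cmult)
      show "ext a b \<sigma> (vtx i) = ext a b \<sigma>' (vtx k)"
        if "i < 3" "k < 3" "contr_word \<sigma> (vtx i) = contr_word \<sigma>' (vtx k)" for \<sigma> \<sigma>' i k
        using that by (simp add: val)
    qed
  qed
  \<comment> \<open>X and G carry the two bumps in opposite roles: \<phi> d\<psi> in C_\<tau>, and
    \<psi> d\<phi> in the other cells at p.\<close>
  obtain X where X: "X \<in> finite_energy_fns" "\<And>\<sigma> x. \<sigma> \<in> words n \<Longrightarrow> x \<in> gasket \<Longrightarrow> X (contr_word \<sigma> x) = ext \<phi> \<psi> \<sigma> x"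
    using glueable[of \<phi> \<psi>] F v by blast
  obtain G where G: "G \<in> finite_energy_fns" "\<And>\<sigma> x. \<sigma> \<in> words n \<Longrightarrow> x \<in> gasket \<Longrightarrow> G (contr_word \<sigma> x) = ext \<psi> \<phi> \<sigma> x"
    using glueable[of \<psi> \<phi>] F v by blast
  show ?thesis
  proof (intro bexI[of _ "fdg X G"] ballI)
    show "fdg X G \<in> one_forms" using X G by (intro one_forms.gen)
    fix \<sigma> \<rho> x y assume *: "\<sigma> \<in> words n" "\<rho> \<in> words 2" "x \<in> gasket" "y \<in> gasket"
    let ?x = "contr_word \<rho> x" and ?y = "contr_word \<rho> y"
    have "fdg X G (contr_word \<sigma> ?x, contr_word \<sigma> ?y) = ext \<phi> \<psi> \<sigma> ?x * (ext \<psi> \<phi> \<sigma> ?x - ext \<psi> \<phi> \<sigma> ?y)"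
      using * X(2)[of \<sigma> ?x] G(2)[of \<sigma> ?x] G(2)[of \<sigma> ?y] by (simp add: fdg_def)
    also have "\<dots> = (if \<sigma> = \<tau> then \<psi> j ?x - \<psi> j ?y else 0)"
    proof (cases "\<sigma> = \<tau>")
      case True
      then show ?thesis using p12(1)[OF t(2) *(2-4)] by (simp add: ext_def)
    next
      case False
      show ?thesis
      proof (cases "\<exists>k<3. contr_word \<sigma> (vtx k) = p")
        case True
        then obtain k where k: "k < 3" "contr_word \<sigma> (vtx k) = p" by blast
        show ?thesis
          using False p12(2)[OF k(1) *(2-4)] by (simp add: ext_def sum_of_bool_vtx[OF k])
      next
        case none: False
        then have "ext \<phi> \<psi> \<sigma> ?x = 0" using False by (auto simp: ext_def)
        then show ?thesis using False by simp
      qed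
    qed
    finally show "fdg X G (contr_word \<sigma> ?x, contr_word \<sigma> ?y) = (if \<sigma> = \<tau> then \<psi> j ?x - \<psi> j ?y else 0)" .
  qed
qed

text \<open>The u_\<sigma> need not agree at common vertices. After subtraction of the bumps
  u_\<sigma>(p_j) \<psi>_j they vanish at all vertices and glue to a global function U; the
  subtracted parts are restored by corner forms, which live on one cell each.\<close>

lemma one_form_of_cell_functions:
  assumes u: "\<And>\<sigma>. \<sigma> \<in> words n \<Longrightarrow> u \<sigma> \<in> finite_energy_fns"
  shows "\<exists>\<omega>\<in>one_forms. \<forall>\<sigma>\<in>words n. \<forall>\<rho>\<in>words 2. \<forall>x\<in>gasket. \<forall>y\<in>gasket.
    \<omega> (contr_word \<sigma> (contr_word \<rho> x), contr_word \<sigma> (contr_word \<rho> y)) = u \<sigma> (contr_word \<rho> x) - u \<sigma> (contr_word \<rho> y)"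
proof -
  have "\<forall>j. \<exists>\<phi> \<psi>. j < 3 \<longrightarrow> corner_bumps j \<phi> \<psi>" using corner_bumps_exist by blast
  then obtain \<phi> \<psi> where bumps: "\<And>j. j < 3 \<Longrightarrow> corner_bumps j (\<phi> j) (\<psi> j)" by metis
  have \<psi>: "\<psi> j \<in> finite_energy_fns" "\<And>k. k < 3 \<Longrightarrow> \<psi> j (vtx k) = of_bool (k = j)" if "j < 3" for j
    using bumps[OF that] by (auto simp: corner_bumps_def)
  define Q where "Q \<tau> j \<beta> \<longleftrightarrow> \<beta> \<in> one_forms \<and> (\<forall>\<sigma>\<in>words n. \<forall>\<rho>\<in>words 2. \<forall>x\<in>gasket. \<forall>y\<in>gasket.
    \<beta> (contr_word \<sigma> (contr_word \<rho> x), contr_word \<sigma> (contr_word \<rho> y)) =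
      (if \<sigma> = \<tau> then \<psi> j (contr_word \<rho> x) - \<psi> j (contr_word \<rho> y) else 0))" for \<tau> j \<beta>
  have "\<exists>\<beta>. Q \<tau> j \<beta>" if "\<tau> \<in> words n" "j < 3" for \<tau> j
    using corner_form_exists[OF that, of \<phi> \<psi>] bumps unfolding Q_def by blast
  then obtain \<beta> where "\<And>\<tau> j. \<tau> \<in> words n \<Longrightarrow> j < 3 \<Longrightarrow> Q \<tau> j (\<beta> \<tau> j)" by metis
  note \<beta> = this[unfolded Q_def]
  define w where "w \<sigma> x = u \<sigma> x - (\<Sum>j<3. u \<sigma> (vtx j) * \<psi> j x)" for \<sigma> x
  have w_vtx: "w \<sigma> (vtx i) = 0" if "i < 3" for \<sigma> i
  proof -
    have "(\<Sum>j<3. u \<sigma> (vtx j) * \<psi> j (vtx i)) = (\<Sum>j<3. if j = i then u \<sigma> (vtx i) else 0)"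
      using that \<psi>(2) by (intro sum.cong) auto
    then show ?thesis using that by (simp add: w_def)
  qed
  have "\<exists>g\<in>finite_energy_fns. \<forall>\<sigma>\<in>words n. \<forall>x\<in>gasket. g (contr_word \<sigma> x) = w \<sigma> x"
  proof (rule glue_family)
    show "w \<sigma> \<in> finite_energy_fns" if "\<sigma> \<in> words n" for \<sigma>
      unfolding w_def[abs_def] using u[OF that] \<psi>(1)
      by (intro finite_energy_diff finite_energy_sum finite_energy_cmult) auto
  qed (simp add: w_vtx)
  then obtain U where U: "U \<in> finite_energy_fns" "\<And>\<sigma> x. \<sigma> \<in> words n \<Longrightarrow> x \<in> gasket \<Longrightarrow> U (contr_word \<sigma> x) = w \<sigma> x"
    by blast
  define \<omega> where "\<omega> = (\<lambda>z. fdg (\<lambda>_. 1) U z + (\<Sum>\<tau>\<in>words n. \<Sum>j<3. u \<tau> (vtx j) * \<beta> \<tau> j z))"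
  have "\<omega> \<in> one_forms"
    unfolding \<omega>_def using \<beta> U(1)
    by (intro one_forms.add one_forms.gen one_forms_sum one_forms_cmult) auto
  moreover have "\<omega> (contr_word \<sigma> (contr_word \<rho> x), contr_word \<sigma> (contr_word \<rho> y)) = u \<sigma> (contr_word \<rho> x) - u \<sigma> (contr_word \<rho> y)"
    if s: "\<sigma> \<in> words n" "\<rho> \<in> words 2" "x \<in> gasket" "y \<in> gasket" for \<sigma> \<rho> x y
  proof -
    let ?x = "contr_word \<rho> x" and ?y = "contr_word \<rho> y"
    have "(\<Sum>\<tau>\<in>words n. \<Sum>j<3. u \<tau> (vtx j) * \<beta> \<tau> j (contr_word \<sigma> ?x, contr_word \<sigma> ?y))
      = (\<Sum>\<tau>\<in>words n. if \<tau> = \<sigma> then \<Sum>j<3. u \<sigma> (vtx j) * (\<psi> j ?x - \<psi> j ?y) else 0)"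
      using \<beta> s by (intro sum.cong refl) auto
    also have "\<dots> = (\<Sum>j<3. u \<sigma> (vtx j) * (\<psi> j ?x - \<psi> j ?y))" using s(1) by simp
    also have "\<dots> = (\<Sum>j<3. u \<sigma> (vtx j) * \<psi> j ?x) - (\<Sum>j<3. u \<sigma> (vtx j) * \<psi> j ?y)"
      by (simp add: right_diff_distrib sum_subtractf)
    finally show ?thesis
      using U(2)[OF s(1), of ?x] U(2)[OF s(1), of ?y] s by (simp add: \<omega>_def fdg_def w_def)
  qed
  ultimately show ?thesis by blast
qed

text \<open>The potentials are pulled back by w_\<sigma> to the whole gasket, so the results on
  global functions apply to them, and they are tested on single edges instead of paths. Equivalence
  with \<open>locally_exact\<close> is proved below in both directions.\<close>

definition has_potentials :: "nat \<Rightarrow> (nat list \<Rightarrow> pt \<Rightarrow> real) \<Rightarrow> form \<Rightarrow> bool" where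
  "has_potentials n u \<omega> \<longleftrightarrow> \<omega> \<in> one_forms \<and> (\<forall>\<sigma>\<in>words n. u \<sigma> \<in> finite_energy_fns \<and>
     (\<forall>m x y. (x, y) \<in> oriented_edges m \<longrightarrow>
        edge_integral \<omega> (contr_word \<sigma> x) (contr_word \<sigma> y) = u \<sigma> y - u \<sigma> x))"

lemma has_potentialsD:
  assumes "has_potentials n u \<omega>"
  shows "\<omega> \<in> one_forms" "\<sigma> \<in> words n \<Longrightarrow> u \<sigma> \<in> finite_energy_fns"
    "\<sigma> \<in> words n \<Longrightarrow> (x, y) \<in> oriented_edges m \<Longrightarrow>
       edge_integral \<omega> (contr_word \<sigma> x) (contr_word \<sigma> y) = u \<sigma> y - u \<sigma> x"
  using assms unfolding has_potentials_def by blast+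

text \<open>The pointwise formula is kept beside the potentials because the approximation of f dg
  compares values on edges, not integrals.\<close>

lemma has_potentials_exists:
  assumes u: "\<And>\<sigma>. \<sigma> \<in> words n \<Longrightarrow> u \<sigma> \<in> finite_energy_fns"
  shows "\<exists>\<omega>. has_potentials n u \<omega> \<and> (\<forall>\<sigma>\<in>words n. \<forall>\<rho>\<in>words 2. \<forall>x\<in>gasket. \<forall>y\<in>gasket.
    \<omega> (contr_word \<sigma> (contr_word \<rho> x), contr_word \<sigma> (contr_word \<rho> y)) = u \<sigma> (contr_word \<rho> x) - u \<sigma> (contr_word \<rho> y))"
proof -
  obtain \<omega> where w: "\<omega> \<in> one_forms" "\<And>\<sigma> \<rho> x y. \<sigma> \<in> words n \<Longrightarrow> \<rho> \<in> words 2 \<Longrightarrow> x \<in> gasket \<Longrightarrow> y \<in> gasket \<Longrightarrow>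
    \<omega> (contr_word \<sigma> (contr_word \<rho> x), contr_word \<sigma> (contr_word \<rho> y)) = u \<sigma> (contr_word \<rho> x) - u \<sigma> (contr_word \<rho> y)"
    using one_form_of_cell_functions[of n u] u by blast
  have "edge_integral \<omega> (contr_word \<sigma> x) (contr_word \<sigma> y) = u \<sigma> y - u \<sigma> x"
    if s: "\<sigma> \<in> words n" and xy: "(x, y) \<in> oriented_edges m" for \<sigma> m x y
  proof -
    obtain \<tau> i j where t: "\<tau> \<in> words m" "(i, j) \<in> vpairs" "x = contr_word \<tau> (vtx i)" "y = contr_word \<tau> (vtx j)"
      using xy by (rule oriented_edgesE)
    let ?W = "contr_word (\<sigma> @ \<tau>)"
    \<comment> \<open>The pointwise formula covers the edges at least two levels below \<sigma>, so
      from k = 2 on the Riemann sums telescope exactly.\<close>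
    have const: "subsum k i j (\<lambda>a b. \<omega> (?W b, ?W a)) = u \<sigma> y - u \<sigma> x" if k: "k \<ge> 2" for k
    proof -
      have "subsum k i j (\<lambda>a b. \<omega> (?W b, ?W a)) = (\<Sum>(a, b)\<in>subedges k (vtx i, vtx j). \<omega> (?W b, ?W a))"
        by (rule sum_subedges_vtx[OF t(2), symmetric])
      also have "\<dots> = (\<Sum>(a, b)\<in>subedges k (vtx i, vtx j). u \<sigma> (contr_word \<tau> b) - u \<sigma> (contr_word \<tau> a))"
      proof (rule sum.cong[OF refl], clarify)
        fix a1 a2 b1 b2 assume ab: "((a1, a2), (b1, b2)) \<in> subedges k (vtx i, vtx j)"
        define a b where "a = (a1, a2)" and "b = (b1, b2)"
        have "(a, b) \<in> oriented_edges k" using ab by (simp add: subedges_iff a_def b_def)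
        then have "(contr_word \<tau> a, contr_word \<tau> b) \<in> oriented_edges (m + k)" by (rule oriented_edges_addI[OF t(1)])
        moreover have "m + k = 2 + (m + k - 2)" using k by simp
        ultimately obtain \<rho> a' b' where r: "\<rho> \<in> words 2" "(a', b') \<in> oriented_edges (m + k - 2)"
          "contr_word \<tau> a = contr_word \<rho> a'" "contr_word \<tau> b = contr_word \<rho> b'"
          by (metis oriented_edges_addE)
        then have "\<omega> (?W b, ?W a) = u \<sigma> (contr_word \<tau> b) - u \<sigma> (contr_word \<tau> a)"
          using w(2)[OF s r(1)] oriented_edges_gasket[OF r(2)] by (simp add: contr_word_append)
        then show "\<omega> (?W (b1, b2), ?W (a1, a2)) = u \<sigma> (contr_word \<tau> (b1, b2)) - u \<sigma> (contr_word \<tau> (a1, a2))"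
          by (simp add: a_def b_def)
      qed
      also have "\<dots> = subsum k i j (\<lambda>a b. u \<sigma> (contr_word \<tau> b) - u \<sigma> (contr_word \<tau> a))"
        by (rule sum_subedges_vtx[OF t(2)])
      also have "\<dots> = u \<sigma> y - u \<sigma> x" by (simp add: subsum_telescope t)
      finally show ?thesis .
    qed
    have "(\<lambda>k. subsum k i j (\<lambda>a b. \<omega> (?W b, ?W a))) \<longlonglongrightarrow> u \<sigma> y - u \<sigma> x"
      by (rule tendsto_eventually) (use const in \<open>auto simp: eventually_sequentially\<close>)
    moreover have "(\<lambda>k. subsum k i j (\<lambda>a b. \<omega> (?W b, ?W a))) \<longlonglongrightarrow> edge_integral \<omega> (contr_word \<sigma> x) (contr_word \<sigma> y)"
      using edge_integral_tendsto(2)[OF w(1) words_append[OF s t(1)] t(2)] by (simp add: t contr_word_append)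
    ultimately show ?thesis by (rule LIMSEQ_unique[rotated])
  qed
  then have "has_potentials n u \<omega>" using u w(1) by (simp add: has_potentials_def)
  then show ?thesis using w(2) by blast
qed

lemma has_potentials_refine:
  assumes "has_potentials n u \<omega>"
  shows "has_potentials (n + k) (\<lambda>\<rho> x. u (take n \<rho>) (contr_word (drop n \<rho>) x)) \<omega>"
  unfolding has_potentials_def
proof (intro conjI ballI allI impI)
  show "\<omega> \<in> one_forms" using assms by (simp add: has_potentials_def)
  fix \<rho> assume "\<rho> \<in> words (n + k)"
  then obtain \<sigma> \<tau> where st: "\<rho> = \<sigma> @ \<tau>" "\<sigma> \<in> words n" "\<tau> \<in> words k" by (rule words_addE)
  then have l: "take n \<rho> = \<sigma>" "drop n \<rho> = \<tau>" using length_words by auto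
  show "(\<lambda>x. u (take n \<rho>) (contr_word (drop n \<rho>) x)) \<in> finite_energy_fns"
    unfolding l using assms st by (intro finite_energy_contr_word) (auto simp: has_potentials_def)
  fix m x y assume "(x, y) \<in> oriented_edges m"
  then have "(contr_word \<tau> x, contr_word \<tau> y) \<in> oriented_edges (k + m)" by (rule oriented_edges_addI[OF st(3)])
  then show "edge_integral \<omega> (contr_word \<rho> x) (contr_word \<rho> y) =
      u (take n \<rho>) (contr_word (drop n \<rho>) y) - u (take n \<rho>) (contr_word (drop n \<rho>) x)"
    unfolding l unfolding st(1) contr_word_append by (rule has_potentialsD(3)[OF assms st(2)])
qed

lemma has_potentials_inner_tendsto:
  assumes c: "form_completion \<iota>" and u: "has_potentials n u \<omega>" and v: "has_potentials n v \<eta>"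
  shows "(\<lambda>k. (5/3) ^ n * (\<Sum>\<sigma>\<in>words n. energy_at k (u \<sigma>) (v \<sigma>))) \<longlonglongrightarrow> inner (\<iota> \<omega>) (\<iota> \<eta>)"
proof -
  let ?A = "\<lambda>m. (5/3) ^ m / 2 * osum m (\<lambda>x y. edge_integral \<omega> x y * edge_integral \<eta> x y)"
  have "?A (n + k) = (5/3) ^ n * (\<Sum>\<sigma>\<in>words n. energy_at k (u \<sigma>) (v \<sigma>))" for k
  proof -
    have "osum k (\<lambda>x y. edge_integral \<omega> (contr_word \<sigma> x) (contr_word \<sigma> y) * edge_integral \<eta> (contr_word \<sigma> x) (contr_word \<sigma> y))
      = osum k (\<lambda>x y. (u \<sigma> y - u \<sigma> x) * (v \<sigma> y - v \<sigma> x))" if s: "\<sigma> \<in> words n" for \<sigma>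
    proof (rule osum_cong)
      fix \<tau> i j assume "\<tau> \<in> words k" "(i, j) \<in> vpairs"
      then have e: "(contr_word \<tau> (vtx i), contr_word \<tau> (vtx j)) \<in> oriented_edges k" by (rule oriented_edgesI)
      show "edge_integral \<omega> (contr_word \<sigma> (contr_word \<tau> (vtx i))) (contr_word \<sigma> (contr_word \<tau> (vtx j))) *
          edge_integral \<eta> (contr_word \<sigma> (contr_word \<tau> (vtx i))) (contr_word \<sigma> (contr_word \<tau> (vtx j))) =
        (u \<sigma> (contr_word \<tau> (vtx j)) - u \<sigma> (contr_word \<tau> (vtx i))) * (v \<sigma> (contr_word \<tau> (vtx j)) - v \<sigma> (contr_word \<tau> (vtx i)))"
        by (simp add: has_potentialsD(3)[OF u s e] has_potentialsD(3)[OF v s e])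
    qed
    then show ?thesis
      by (simp add: osum_add_level energy_at_def power_add sum_distrib_left mult.assoc)
  qed
  moreover have "(\<lambda>k. ?A (n + k)) \<longlonglongrightarrow> inner (\<iota> \<omega>) (\<iota> \<eta>)"
    using LIMSEQ_ignore_initial_segment[OF inner_tendsto_edge_integrals[OF c], of \<omega> \<eta> n] u v
    by (simp add: has_potentials_def add.commute)
  ultimately show ?thesis by simp
qed

section \<open>Local exactness and edgewise potentials are equivalent\<close>

lemma oriented_edge_segment: 
  assumes "(x, y) \<in> oriented_edges m" shows "closed_segment x y \<subseteq> gasket"
proof -
  obtain \<sigma> i j where s: "\<sigma> \<in> words m" "(i, j) \<in> vpairs" "x = contr_word \<sigma> (vtx i)" "y = contr_word \<sigma> (vtx j)"
    using assms by (rule oriented_edgesE)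
  have "closed_segment (vtx i) (vtx j) \<subseteq> gasket"
    using s(2) by (intro segment_subset_gasket) (auto simp: vpairs_iff)
  then show ?thesis unfolding s(3,4) contr_word_segment using s(1) by auto
qed

text \<open>An edge of a level coarser than the cell cannot have both ends in it: the cell lies in
  one subcell of the coarse cell, and an original vertex p_i belongs only to the subcell with letter
  i. So no path inside a cell uses edges that are too long.\<close>

lemma oriented_edge_in_cell:
  assumes s: "\<sigma> \<in> words n" and e: "(a, b) \<in> oriented_edges m" and ab: "a \<in> cell \<sigma>" "b \<in> cell \<sigma>"
  obtains k x y where "(x, y) \<in> oriented_edges k" "a = contr_word \<sigma> x" "b = contr_word \<sigma> y"
proof (cases "n \<le> m")
  case True
  obtain p q where pq: "p \<in> gasket" "q \<in> gasket" "a = contr_word \<sigma> p" "b = contr_word \<sigma> q"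
    using ab by (auto simp: cell_def)
  have "(a, b) \<in> oriented_edges (n + (m - n))" using e True by simp
  then obtain \<tau> x y where t: "\<tau> \<in> words n" "(x, y) \<in> oriented_edges (m - n)" "a = contr_word \<tau> x" "b = contr_word \<tau> y"
    by (rule oriented_edges_addE)
  have "\<tau> = \<sigma>"
    using edge_determines_word(1)[OF t(1) s, of x y p q] oriented_edges_gasket[OF t(2)] oriented_edges_neq[OF t(2)] pq t(3,4)
    by simp
  then show thesis using that t by blast
next
  case False
  obtain p q where pq: "p \<in> gasket" "q \<in> gasket" "a = contr_word \<sigma> p" "b = contr_word \<sigma> q"
    using ab by (auto simp: cell_def)
  obtain \<tau> i j where t: "\<tau> \<in> words m" "(i, j) \<in> vpairs" "a = contr_word \<tau> (vtx i)" "b = contr_word \<tau> (vtx j)"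
    using e by (rule oriented_edgesE)
  then have ij: "i < 3" "j < 3" "i \<noteq> j" by (auto simp: vpairs_iff)
  have "\<sigma> \<in> words (m + Suc (n - m - 1))" using s False by simp
  then obtain \<sigma>1 \<sigma>2 where s12: "\<sigma> = \<sigma>1 @ \<sigma>2" "\<sigma>1 \<in> words m" "\<sigma>2 \<in> words (Suc (n - m - 1))" by (rule words_addE)
  obtain l \<sigma>3 where s3: "\<sigma>2 = l # \<sigma>3" "l < 3" "\<sigma>3 \<in> words (n - m - 1)" using s12(3) by (rule words_SucE)
  have g: "contr_word \<sigma>2 p \<in> gasket" "contr_word \<sigma>2 q \<in> gasket" using s12(3) pq by auto
  have "vtx i = contr_word \<sigma>2 p" "vtx j = contr_word \<sigma>2 q"
    using edge_determines_word(2,3)[OF t(1) s12(2), of "vtx i" "vtx j" "contr_word \<sigma>2 p" "contr_word \<sigma>2 q"] g ij pq t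
    by (simp_all add: s12(1) contr_word_append)
  then have eq: "contr i (vtx i) = contr l (contr_word \<sigma>3 p)" "contr j (vtx j) = contr l (contr_word \<sigma>3 q)"
    unfolding contr_vtx_self s3(1) contr_word_Cons by blast+
  have "i = l" using contr_eq_contr(1)[OF ij(1) s3(2) _ _ _ eq(1)] ij(1) s3 pq by force
  moreover have "j = l" using contr_eq_contr(1)[OF ij(2) s3(2) _ _ _ eq(2)] ij(2) s3 pq by force
  ultimately show thesis using ij(3) by simp
qed

lemma cell_edges:
  assumes s: "\<sigma> \<in> words n"
  shows "{(a, b) \<in> edges (n + k). closed_segment a b \<subseteq> cell \<sigma>} = map_prod (contr_word \<sigma>) (contr_word \<sigma>) ` edges k"
proof (rule subset_antisym; (rule image_subsetI | rule subsetI))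
  fix p assume "p \<in> {(a, b) \<in> edges (n + k). closed_segment a b \<subseteq> cell \<sigma>}"
  then obtain a b where ab: "p = (a, b)" "(a, b) \<in> edges (n + k)" "closed_segment a b \<subseteq> cell \<sigma>"
    by blast
  then have ab': "a \<in> cell \<sigma>" "b \<in> cell \<sigma>" by (meson ends_in_segment subsetD)+
  obtain \<rho> i j where r: "\<rho> \<in> words (n + k)" "(i, j) \<in> {(0,1), (1,2), (2,0)}" "a = contr_word \<rho> (vtx i)" "b = contr_word \<rho> (vtx j)"
    using ab(2) unfolding edges_eq by auto
  obtain \<tau> \<tau>' where t: "\<rho> = \<tau> @ \<tau>'" "\<tau> \<in> words n" "\<tau>' \<in> words k" using r(1) by (rule words_addE)
  have ij: "i < 3" "j < 3" "i \<noteq> j" using r(2) by auto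
  obtain p' q' where pq: "p' \<in> gasket" "q' \<in> gasket" "a = contr_word \<sigma> p'" "b = contr_word \<sigma> q'"
    using ab' by (auto simp: cell_def)
  have "\<tau> = \<sigma>"
    using edge_determines_word(1)[OF t(2) s, of "contr_word \<tau>' (vtx i)" "contr_word \<tau>' (vtx j)" p' q'] t ij pq r(3,4)
    by (simp add: contr_word_append)
  then have "p = map_prod (contr_word \<sigma>) (contr_word \<sigma>) (contr_word \<tau>' (vtx i), contr_word \<tau>' (vtx j))"
    by (simp add: ab r t contr_word_append)
  then show "p \<in> map_prod (contr_word \<sigma>) (contr_word \<sigma>) ` edges k"
    using edges_memI[OF t(3) r(2)] by (rule image_eqI)
next
  fix p assume p: "p \<in> edges k"
  obtain a b where ab: "p = (a, b)" by (cases p)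
  obtain \<tau> i j where t: "\<tau> \<in> words k" "(i, j) \<in> {(0,1), (1,2), (2,0)}" "a = contr_word \<tau> (vtx i)" "b = contr_word \<tau> (vtx j)"
    using p unfolding ab edges_eq by auto
  have "(contr_word \<sigma> a, contr_word \<sigma> b) \<in> edges (n + k)"
    using edges_memI[OF words_append[OF s t(1)] t(2)] by (simp add: t(3,4) contr_word_append)
  moreover have "closed_segment a b \<subseteq> gasket"
    using p oriented_edge_segment[of a b k] by (simp add: oriented_edges_def ab)
  ultimately show "map_prod (contr_word \<sigma>) (contr_word \<sigma>) p \<in> {(a, b) \<in> edges (n + k). closed_segment a b \<subseteq> cell \<sigma>}"
    by (simp add: ab contr_word_segment cell_def image_mono)
qed

text \<open>Edges of level n+k in C_\<sigma> are exactly the images of edges of level k, so pulling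
  back costs only the constant (5/3)^n. The levels below n are removed by shifting the
  sequence.\<close>

lemma cell_energy_finite_iff:
  assumes s: "\<sigma> \<in> words n"
  shows "cell_energy (cell \<sigma>) f < \<infinity> \<longleftrightarrow> (\<exists>B. \<forall>m. energy_at m (\<lambda>x. f (contr_word \<sigma> x)) (\<lambda>x. f (contr_word \<sigma> x)) \<le> B)"
proof -
  let ?u = "\<lambda>x. f (contr_word \<sigma> x)"
  let ?a = "\<lambda>m. ennreal ((5/3)^m * (\<Sum>(a, b)\<in>{(a, b) \<in> edges m. closed_segment a b \<subseteq> cell \<sigma>}. \<bar>f b - f a\<bar>\<^sup>2))"
  let ?L = "SUP k. ennreal ((5/3)^n * energy_at k ?u ?u)"
  have a: "?a (k + n) = ennreal ((5/3)^n * energy_at k ?u ?u)" for k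
  proof -
    have inj: "inj_on (map_prod (contr_word \<sigma>) (contr_word \<sigma>)) S" for S
      by (rule inj_onI) (auto simp: map_prod_def split: prod.splits)
    have "(\<Sum>(a, b)\<in>{(a, b) \<in> edges (n + k). closed_segment a b \<subseteq> cell \<sigma>}. \<bar>f b - f a\<bar>\<^sup>2) =
      (\<Sum>(a, b)\<in>edges k. \<bar>?u b - ?u a\<bar>\<^sup>2)"
      unfolding cell_edges[OF s] sum.reindex[OF inj] by (simp add: o_def case_prod_unfold)
    also have "\<dots> = osum k (\<lambda>a b. \<bar>?u b - ?u a\<bar>\<^sup>2) / 2"
      by (rule sum_edges_sym) (simp add: power2_commute)
    finally have "(5/3) ^ (n + k) * (\<Sum>(a, b)\<in>{(a, b) \<in> edges (n + k). closed_segment a b \<subseteq> cell \<sigma>}. \<bar>f b - f a\<bar>\<^sup>2)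
        = (5/3)^n * energy_at k ?u ?u"
      by (simp add: energy_at_def power_add power2_eq_square mult.assoc)
    then show ?thesis by (simp only: add.commute[of k n])
  qed
  have inc: "incseq (\<lambda>k. ennreal ((5/3)^n * energy_at k ?u ?u))"
    by (intro incseq_SucI ennreal_leI mult_left_mono energy_at_Suc_le) simp
  have "(\<lambda>k. ?a (k + n)) \<longlonglongrightarrow> ?L" unfolding a by (rule LIMSEQ_SUP[OF inc])
  then have "?a \<longlonglongrightarrow> ?L" by (rule LIMSEQ_offset)
  then have L: "cell_energy (cell \<sigma>) f = ?L" unfolding cell_energy_def by (rule limI)
  show ?thesis
  proof
    assume fin: "cell_energy (cell \<sigma>) f < \<infinity>"
    have "energy_at k ?u ?u \<le> enn2real ?L" for k
    proof -
      have "ennreal ((5/3)^n * energy_at k ?u ?u) \<le> ?L" by (rule SUP_upper) simp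
      then have "(5/3)^n * energy_at k ?u ?u \<le> enn2real ?L"
        using fin L by (cases ?L) (auto simp: ennreal_le_iff)
      moreover have "energy_at k ?u ?u \<le> (5/3)^n * energy_at k ?u ?u"
        using mult_right_mono[OF one_le_power[of "5/3::real" n] energy_at_nonneg[of k ?u]] by simp
      ultimately show ?thesis by linarith
    qed
    then show "\<exists>B. \<forall>m. energy_at m ?u ?u \<le> B" by blast
  next
    assume "\<exists>B. \<forall>m. energy_at m ?u ?u \<le> B"
    then obtain B where "\<And>m. energy_at m ?u ?u \<le> B" by blast
    then have "?L \<le> ennreal ((5/3)^n * B)" by (intro SUP_least ennreal_leI mult_left_mono) auto
    then show "cell_energy (cell \<sigma>) f < \<infinity>" unfolding L by (rule le_less_trans) simp
  qed
qed

lemma locally_exact_imp_potentials: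
  assumes "locally_exact n \<omega>"
  obtains u where "has_potentials n u \<omega>"
proof -
  have w: "\<omega> \<in> one_forms" using assms by (simp add: locally_exact_def)
  have "\<exists>f. continuous_on (cell \<sigma>) f \<and> cell_energy (cell \<sigma>) f < \<infinity> \<and>
    (\<forall>\<gamma>. elementary_path \<gamma> \<and> path_support \<gamma> \<subseteq> cell \<sigma> \<longrightarrow> form_integral \<gamma> \<omega> = f (path_end \<gamma>) - f (path_start \<gamma>))"
    if "\<sigma> \<in> words n" for \<sigma>
    using assms that by (simp add: locally_exact_def words_def)
  then obtain f where f: "\<And>\<sigma>. \<sigma> \<in> words n \<Longrightarrow> continuous_on (cell \<sigma>) (f \<sigma>)"
    "\<And>\<sigma>. \<sigma> \<in> words n \<Longrightarrow> cell_energy (cell \<sigma>) (f \<sigma>) < \<infinity>"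
    "\<And>\<sigma> \<gamma>. \<sigma> \<in> words n \<Longrightarrow> elementary_path \<gamma> \<Longrightarrow> path_support \<gamma> \<subseteq> cell \<sigma> \<Longrightarrow>
      form_integral \<gamma> \<omega> = f \<sigma> (path_end \<gamma>) - f \<sigma> (path_start \<gamma>)"
    by metis
  have "has_potentials n (\<lambda>\<sigma> x. f \<sigma> (contr_word \<sigma> x)) \<omega>"
    unfolding has_potentials_def
  proof (intro conjI ballI allI impI w)
    fix \<sigma> assume s: "\<sigma> \<in> words n"
    have "continuous_on gasket (\<lambda>x. f \<sigma> (contr_word \<sigma> x))"
      by (rule continuous_on_compose2[OF f(1)[OF s] continuous_on_contr_word]) (auto simp: cell_def)
    then show "(\<lambda>x. f \<sigma> (contr_word \<sigma> x)) \<in> finite_energy_fns"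
      using f(2)[OF s] unfolding finite_energy_iff cell_energy_finite_iff[OF s] by blast
    fix m x y assume e: "(x, y) \<in> oriented_edges m"
    let ?\<gamma> = "[(contr_word \<sigma> x, contr_word \<sigma> y)]"
    have o: "(contr_word \<sigma> x, contr_word \<sigma> y) \<in> oriented_edges (n + m)" by (rule oriented_edges_addI[OF s e])
    then have "elementary_path ?\<gamma>" by (auto simp: elementary_path_def)
    moreover have "path_support ?\<gamma> \<subseteq> cell \<sigma>"
      using oriented_edge_segment[OF e] by (auto simp: path_support_def cell_def contr_word_segment)
    ultimately have "form_integral ?\<gamma> \<omega> = f \<sigma> (contr_word \<sigma> y) - f \<sigma> (contr_word \<sigma> x)"
      using f(3)[OF s] by (simp add: path_end_def path_start_def)
    moreover have "form_integral ?\<gamma> \<omega> = edge_integral \<omega> (contr_word \<sigma> x) (contr_word \<sigma> y)"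
      using form_integral_eq[OF w, of ?\<gamma>] o by auto
    ultimately show "edge_integral \<omega> (contr_word \<sigma> x) (contr_word \<sigma> y) = f \<sigma> (contr_word \<sigma> y) - f \<sigma> (contr_word \<sigma> x)" by simp
  qed
  then show thesis by (rule that)
qed

lemma contr_word_left_inverse: "(2 ^ length \<sigma>) *\<^sub>R (contr_word \<sigma> x - contr_word \<sigma> 0) = x"
  by (simp add: contr_word_diff flip: power_mult_distrib)

lemma potentials_imp_locally_exact:
  assumes u: "has_potentials n u \<omega>"
  shows "locally_exact n \<omega>"
  unfolding locally_exact_def
proof (intro conjI ballI impI)
  show w: "\<omega> \<in> one_forms" using u by (simp add: has_potentials_def)
  fix \<sigma> assume "\<sigma> \<in> gwords" "length \<sigma> = n"
  then have s: "\<sigma> \<in> words n" by (simp add: words_def)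
  have us: "u \<sigma> \<in> finite_energy_fns" using u s by (simp add: has_potentials_def)
  \<comment> \<open>The potential is transported to the cell by the inverse homothety.\<close>
  define f where "f x = u \<sigma> ((2 ^ length \<sigma>) *\<^sub>R (x - contr_word \<sigma> 0))" for x
  have f: "f (contr_word \<sigma> x) = u \<sigma> x" for x by (simp only: f_def contr_word_left_inverse)
  have "continuous_on (cell \<sigma>) f"
    unfolding f_def
    by (rule continuous_on_compose2[of gasket "u \<sigma>"])
       (use us in \<open>auto simp: finite_energy_iff cell_def contr_word_left_inverse intro!: continuous_intros\<close>)
  moreover have "cell_energy (cell \<sigma>) f < \<infinity>"
    using us unfolding cell_energy_finite_iff[OF s] finite_energy_iff f by blast
  moreover have "form_integral \<gamma> \<omega> = f (path_end \<gamma>) - f (path_start \<gamma>)"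
    if g: "elementary_path \<gamma>" "path_support \<gamma> \<subseteq> cell \<sigma>" for \<gamma>
  proof -
    have sub: "set \<gamma> \<subseteq> (\<Union>m. oriented_edges m)" using g(1) by (simp add: elementary_path_def)
    have step: "edge_integral \<omega> a b = f b - f a" if ab: "(a, b) \<in> set \<gamma>" for a b
    proof -
      obtain m where m: "(a, b) \<in> oriented_edges m" using sub ab by auto
      have "closed_segment a b \<subseteq> cell \<sigma>" using g(2) ab by (auto simp: path_support_def)
      then have "a \<in> cell \<sigma>" "b \<in> cell \<sigma>" by auto
      from oriented_edge_in_cell[OF s m this] obtain k x y
        where xy: "(x, y) \<in> oriented_edges k" "a = contr_word \<sigma> x" "b = contr_word \<sigma> y" by metis
      show ?thesis unfolding xy(2,3) f by (rule has_potentialsD(3)[OF u s xy(1)])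
    qed
    have "(\<Sum>(x, y)\<leftarrow>\<gamma>. edge_integral \<omega> x y) = f (snd (last \<gamma>)) - f (fst (hd \<gamma>))"
      if "\<gamma> \<noteq> []" "successively (\<lambda>e e'. snd e = fst e') \<gamma>" "\<And>a b. (a, b) \<in> set \<gamma> \<Longrightarrow> edge_integral \<omega> a b = f b - f a" for \<gamma>
      using that
    proof (induction \<gamma>)
      case (Cons e \<gamma>)
      show ?case
      proof (cases "\<gamma> = []")
        case True
        then show ?thesis using Cons.prems(3)[of "fst e" "snd e"] by (simp add: case_prod_unfold)
      next
        case False
        then have "snd e = fst (hd \<gamma>)" "successively (\<lambda>e e'. snd e = fst e') \<gamma>"
          using Cons.prems(2) by (auto simp: successively_Cons)
        moreover have "edge_integral \<omega> (fst e) (snd e) = f (snd e) - f (fst e)" using Cons.prems(3) by simp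
        ultimately show ?thesis using Cons False by (simp add: case_prod_unfold)
      qed
    qed simp
    then show ?thesis
      using g(1) step by (simp add: form_integral_eq[OF w sub] elementary_path_def path_end_def path_start_def)
  qed
  ultimately show "\<exists>f. continuous_on (cell \<sigma>) f \<and> cell_energy (cell \<sigma>) f < \<infinity> \<and>
    (\<forall>\<gamma>. elementary_path \<gamma> \<and> path_support \<gamma> \<subseteq> cell \<sigma> \<longrightarrow> form_integral \<gamma> \<omega> = f (path_end \<gamma>) - f (path_start \<gamma>))"
    by blast
qed

text \<open>The integral around the lacuna in terms of potentials: its clockwise sides lie in the
  cells with last letters 1, 2, 0, in this order.\<close>

definition period :: "(nat list \<Rightarrow> pt \<Rightarrow> real) \<Rightarrow> nat list \<Rightarrow> real" where
  "period u \<sigma> = (u (\<sigma> @ [1]) (vtx 2) - u (\<sigma> @ [1]) (vtx 0)) + (u (\<sigma> @ [2]) (vtx 0) - u (\<sigma> @ [2]) (vtx 1))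
     + (u (\<sigma> @ [0]) (vtx 1) - u (\<sigma> @ [0]) (vtx 2))"

lemma form_integral_lacuna:
  assumes u: "has_potentials (Suc n) u \<omega>" and s: "\<sigma> \<in> words n"
  shows "form_integral (lacuna \<sigma>) \<omega> = period u \<sigma>"
proof -
  have w: "\<omega> \<in> one_forms" using u by (simp add: has_potentials_def)
  have si: "\<sigma> @ [i] \<in> words (Suc n)" if "i < 3" for i
    using words_append[OF s, of "[i]" 1] that words_1 by (auto simp: less3)
  have oe: "(vtx i, vtx j) \<in> oriented_edges 0" if "(i, j) \<in> vpairs" for i j
    using oriented_edgesI[of "[]" 0, OF _ that] by simp
  have ei: "edge_integral \<omega> (contr_word \<sigma> (contr k (vtx i))) (contr_word \<sigma> (contr k (vtx j))) =
      u (\<sigma> @ [k]) (vtx j) - u (\<sigma> @ [k]) (vtx i)" if "(i, j) \<in> vpairs" "k < 3" for i j k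
  proof -
    have "edge_integral \<omega> (contr_word (\<sigma> @ [k]) (vtx i)) (contr_word (\<sigma> @ [k]) (vtx j)) =
      u (\<sigma> @ [k]) (vtx j) - u (\<sigma> @ [k]) (vtx i)"
      using u si[OF that(2)] oe[OF that(1)] unfolding has_potentials_def by blast
    then show ?thesis by (simp add: contr_word_append contr_word_single)
  qed
  have o: "(contr_word \<sigma> (contr k (vtx i)), contr_word \<sigma> (contr k (vtx j))) \<in> oriented_edges (Suc n)"
    if "(i, j) \<in> vpairs" "k < 3" for i j k
    using oriented_edgesI[OF si[OF that(2)] that(1)] by (simp add: contr_word_append contr_word_single)
  have p: "(0, 2) \<in> vpairs" "(1, 0) \<in> vpairs" "(2, 1) \<in> vpairs" by (simp_all add: vpairs_iff)
  have mids: "midpoint (vtx 0) (vtx 1) = contr 1 (vtx 0)" "midpoint (vtx 1) (vtx 2) = contr 1 (vtx 2)"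
    "midpoint (vtx 0) (vtx 2) = contr 2 (vtx 0)"
    "contr 2 (vtx 1) = contr 1 (vtx 2)" "contr 0 (vtx 1) = contr 1 (vtx 0)" "contr 0 (vtx 2) = contr 2 (vtx 0)"
    using contr_vtx_commute[of 1 0] contr_vtx_commute[of 2 0] contr_vtx_commute[of 2 1]
    by (simp_all add: contr_vtx_midpoint[symmetric])
  have "set (lacuna \<sigma>) \<subseteq> (\<Union>m. oriented_edges m)"
  proof -
    have "set (lacuna \<sigma>) \<subseteq> oriented_edges (Suc n)"
      using o[OF p(1), of 1] o[OF p(2), of 2] o[OF p(3), of 0] unfolding lacuna_def mids by (simp add: mids(4-6)[unfolded One_nat_def])
    then show ?thesis by blast
  qed
  then have "form_integral (lacuna \<sigma>) \<omega> = (\<Sum>(x, y)\<leftarrow>lacuna \<sigma>. edge_integral \<omega> x y)"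
    by (rule form_integral_eq[OF w])
  also have "\<dots> = period u \<sigma>"
    using ei[OF p(1), of 1] ei[OF p(2), of 2] ei[OF p(3), of 0]
    unfolding lacuna_def mids period_def by simp
  finally show ?thesis .
qed

section \<open>Orthogonality in Hilbert space\<close>

lemma subspace_closure_inner:
  fixes S :: "'h::real_inner set"
  assumes "subspace S" shows "subspace (closure S)"
proof (rule subspaceI)
  show "0 \<in> closure S" using subspace_0[OF assms] closure_subset by blast
  fix x y assume "x \<in> closure S" "y \<in> closure S"
  then obtain a b where "\<And>n. a n \<in> S" "a \<longlonglongrightarrow> x" "\<And>n. b n \<in> S" "b \<longlonglongrightarrow> y"
    unfolding closure_sequential by blast
  then show "x + y \<in> closure S"
    unfolding closure_sequential
    by (intro exI[of _ "\<lambda>n. a n + b n"]) (auto intro: tendsto_add subspace_add[OF assms])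
next
  fix c :: real and x assume "x \<in> closure S"
  then obtain a where "\<And>n. a n \<in> S" "a \<longlonglongrightarrow> x" unfolding closure_sequential by blast
  then show "c *\<^sub>R x \<in> closure S"
    unfolding closure_sequential
    by (intro exI[of _ "\<lambda>n. c *\<^sub>R a n"]) (auto intro: tendsto_scaleR subspace_scale[OF assms])
qed

lemma norm_le_norm_add_orthogonal:
  fixes a b :: "'h::real_inner"
  assumes "inner a b = 0" shows "norm a \<le> norm (a + b)" "norm b \<le> norm (a + b)"
proof -
  have "(norm (a + b))\<^sup>2 = (norm a)\<^sup>2 + (norm b)\<^sup>2"
    using assms by (simp add: power2_norm_eq_inner inner_add_left inner_add_right inner_commute)
  then show "norm a \<le> norm (a + b)" "norm b \<le> norm (a + b)"
    by (auto intro!: power2_le_imp_le[OF _ norm_ge_zero])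
qed

lemma orthogonal_span:
  fixes x :: "'h::real_inner"
  assumes "\<And>b. b \<in> B \<Longrightarrow> inner x b = 0" "y \<in> span B"
  shows "inner x y = 0"
  using assms(2) by (induction rule: span_induct_alt) (auto simp: inner_add_right assms(1))

text \<open>Among the finite linear combinations, the partial sums are the best approximations.\<close>

lemma orthogonal_expansion:
  fixes e :: "'i \<Rightarrow> 'h::real_inner"
  assumes orth: "\<And>i j. i \<in> I \<Longrightarrow> j \<in> I \<Longrightarrow> i \<noteq> j \<Longrightarrow> inner (e i) (e j) = 0"
    and x: "x \<in> closure (span (e ` I))"
  shows "((\<lambda>i. (inner x (e i) / inner (e i) (e i)) *\<^sub>R e i) has_sum x) I"
  unfolding has_sum_def tendsto_iff eventually_finite_subsets_at_top
proof (intro allI impI)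
  fix r :: real assume "r > 0"
  then obtain s where s: "s \<in> span (e ` I)" "dist s x < r"
    using x unfolding closure_approachable by blast
  then obtain T where T: "finite T" "T \<subseteq> e ` I" "s \<in> span T"
    unfolding span_explicit by (auto intro: span_sum span_scale span_base)
  from finite_subset_image[OF T(1,2)] obtain X where X: "X \<subseteq> I" "finite X" "T = e ` X" by blast
  let ?f = "\<lambda>i. (inner x (e i) / inner (e i) (e i)) *\<^sub>R e i"
  have "dist (sum ?f Y) x < r" if Y: "finite Y" "X \<subseteq> Y" "Y \<subseteq> I" for Y
  proof -
    have perp: "inner (x - sum ?f Y) (e i) = 0" if i: "i \<in> Y" for i
    proof -
      have "inner (sum ?f Y) (e i) = (\<Sum>j\<in>Y. if j = i then inner x (e i) else 0)"
        unfolding inner_sum_left using i Y orth by (intro sum.cong) (auto simp: subset_iff)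
      also have "\<dots> = inner x (e i)" using i Y(1) by simp
      finally show ?thesis by (simp add: inner_diff_left)
    qed
    have "s \<in> span (e ` Y)" using T(3) span_mono[of "e ` X" "e ` Y"] X(3) Y(2) by blast
    then have d: "sum ?f Y - s \<in> span (e ` Y)"
      by (intro span_diff[OF span_sum]) (auto intro: span_scale span_base)
    have "inner (x - sum ?f Y) (sum ?f Y - s) = 0"
      by (rule orthogonal_span[OF _ d]) (elim imageE, simp only: perp)
    from norm_le_norm_add_orthogonal(1)[OF this] have "norm (x - sum ?f Y) \<le> norm (x - s)" by simp
    then show ?thesis using s(2) by (simp add: dist_norm norm_minus_commute)
  qed
  then show "\<exists>X. finite X \<and> X \<subseteq> I \<and> (\<forall>Y. finite Y \<and> X \<subseteq> Y \<and> Y \<subseteq> I \<longrightarrow> dist (sum ?f Y) x < r)"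
    using X by blast
qed

text \<open>Only \<open>E\<close> needs to be closed: by orthogonality, the two components of a convergent sequence in
  \<open>E + B\<close> are Cauchy sequences.\<close>

lemma closure_orthogonal_sum:
  fixes E B :: "'h::{real_inner, complete_space} set"
  assumes E: "subspace E" "closed E" and B: "subspace B"
    and orth: "\<And>x y. x \<in> E \<Longrightarrow> y \<in> B \<Longrightarrow> inner x y = 0"
    and w: "w \<in> closure {x + y | x y. x \<in> E \<and> y \<in> B}"
  obtains x y where "x \<in> E" "y \<in> closure B" "w = x + y"
proof -
  obtain a where a: "\<And>n. a n \<in> {x + y | x y. x \<in> E \<and> y \<in> B}" "a \<longlonglongrightarrow> w"
    using w unfolding closure_sequential by blast
  have "\<forall>n. \<exists>x y. x \<in> E \<and> y \<in> B \<and> a n = x + y" using a(1) by blast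
  then obtain f g where fg: "\<And>n. f n \<in> E" "\<And>n. g n \<in> B" "\<And>n. a n = f n + g n" by metis
  have le: "norm (f m - f n) \<le> norm (a m - a n)" "norm (g m - g n) \<le> norm (a m - a n)" for m n
  proof -
    have "inner (f m - f n) (g m - g n) = 0"
      by (intro orth subspace_diff E B fg)
    moreover have "a m - a n = (f m - f n) + (g m - g n)" by (simp add: fg)
    ultimately show "norm (f m - f n) \<le> norm (a m - a n)" "norm (g m - g n) \<le> norm (a m - a n)"
      using norm_le_norm_add_orthogonal[of "f m - f n" "g m - g n"] by simp_all
  qed
  have "Cauchy a" using a(2) by (rule LIMSEQ_imp_Cauchy)
  then have "Cauchy f" "Cauchy g"
    unfolding Cauchy_def dist_norm using le by (meson le_less_trans)+
  then obtain x y where xy: "f \<longlonglongrightarrow> x" "g \<longlonglongrightarrow> y"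
    using Cauchy_convergent_iff[of f] Cauchy_convergent_iff[of g] by (auto simp: convergent_def)
  have "x \<in> E" using closed_sequentially[OF E(2) fg(1) xy(1)] .
  moreover have "y \<in> closure B" using xy(2) fg(2) unfolding closure_sequential by blast
  moreover have "w = x + y"
    using LIMSEQ_unique[OF a(2)] tendsto_add[OF xy] by (simp add: fg(3)[abs_def])
  ultimately show thesis by (rule that)
qed

section \<open>The forms \<open>dz\<^sub>\<sigma>\<close> and the decomposition\<close>

lemma has_potentials_lincomb:
  assumes u: "has_potentials n u \<omega>" and v: "has_potentials n v \<eta>"
  shows "has_potentials n (\<lambda>\<sigma> x. a * u \<sigma> x + b * v \<sigma> x) (\<lambda>z. a * \<omega> z + b * \<eta> z)"
  unfolding has_potentials_def
proof (intro conjI ballI allI impI)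
  show "(\<lambda>z. a * \<omega> z + b * \<eta> z) \<in> one_forms"
    by (intro one_forms.add one_forms_cmult has_potentialsD(1)[OF u] has_potentialsD(1)[OF v])
  fix \<sigma> assume s: "\<sigma> \<in> words n"
  show "(\<lambda>x. a * u \<sigma> x + b * v \<sigma> x) \<in> finite_energy_fns"
    by (intro finite_energy_add finite_energy_cmult has_potentialsD(2)[OF u s] has_potentialsD(2)[OF v s])
  fix m x y assume e: "(x, y) \<in> oriented_edges m"
  show "edge_integral (\<lambda>z. a * \<omega> z + b * \<eta> z) (contr_word \<sigma> x) (contr_word \<sigma> y) =
      a * u \<sigma> y + b * v \<sigma> y - (a * u \<sigma> x + b * v \<sigma> x)"
    unfolding edge_integral_linear[OF has_potentialsD(1)[OF u] has_potentialsD(1)[OF v] oriented_edges_addI[OF s e]]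
      has_potentialsD(3)[OF u s e] has_potentialsD(3)[OF v s e]
    by (simp add: algebra_simps)
qed

lemma has_potentials_exact:
  assumes U: "U \<in> finite_energy_fns"
  shows "has_potentials 0 (\<lambda>_. U) (fdg (\<lambda>_. 1) U)"
  unfolding has_potentials_def
proof (intro conjI ballI allI impI U)
  show w: "fdg (\<lambda>_. 1) U \<in> one_forms" using U by (intro one_forms.gen) auto
  fix \<sigma> m x y assume s: "\<sigma> \<in> words 0" and "(x, y) \<in> oriented_edges m"
  then obtain \<tau> i j where t: "\<tau> \<in> words m" "(i, j) \<in> vpairs" "x = contr_word \<tau> (vtx i)" "y = contr_word \<tau> (vtx j)"
    by (auto elim: oriented_edgesE)
  have "(\<lambda>k. subsum k i j (\<lambda>a b. fdg (\<lambda>_. 1) U (contr_word \<tau> b, contr_word \<tau> a))) \<longlonglongrightarrow> edge_integral (fdg (\<lambda>_. 1) U) x y"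
    unfolding t(3,4) by (rule edge_integral_tendsto(2)[OF w t(1,2)])
  moreover have "subsum k i j (\<lambda>a b. fdg (\<lambda>_. 1) U (contr_word \<tau> b, contr_word \<tau> a)) = U y - U x" for k
    using subsum_telescope[of k i j "\<lambda>z. U (contr_word \<tau> z)"] by (simp add: fdg_def t)
  ultimately show "edge_integral (fdg (\<lambda>_. 1) U) (contr_word \<sigma> x) (contr_word \<sigma> y) = U y - U x"
    using s by (simp add: LIMSEQ_const_iff)
qed

lemma has_potentials_zero: "has_potentials n (\<lambda>_ _. 0) (\<lambda>_. 0)"
proof -
  have "has_potentials 0 (\<lambda>_ _. 0) (fdg (\<lambda>_. 1) (\<lambda>_. 0))" by (rule has_potentials_exact) simp
  from has_potentials_refine[OF this, of n] show ?thesis by (simp add: fdg_def case_prod_unfold)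
qed

lemma has_potentials_sum:
  assumes "finite I" "\<And>i. i \<in> I \<Longrightarrow> has_potentials n (u i) (\<omega> i)"
  shows "has_potentials n (\<lambda>\<sigma> x. \<Sum>i\<in>I. a i * u i \<sigma> x) (\<lambda>z. \<Sum>i\<in>I. a i * \<omega> i z)"
  using assms
proof (induction I)
  case empty
  then show ?case by (simp add: has_potentials_zero)
next
  case (insert i I)
  then have "has_potentials n (\<lambda>\<sigma> x. a i * u i \<sigma> x + 1 * (\<Sum>i\<in>I. a i * u i \<sigma> x)) (\<lambda>z. a i * \<omega> i z + 1 * (\<Sum>i\<in>I. a i * \<omega> i z))"
    by (intro has_potentials_lincomb) auto
  then show ?case using insert.hyps by simp
qed

text \<open>In subcell i the clockwise side of the lacuna ends at the vertex with index i+1 modulo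
  3. Placing +1/6 there and -1/6 at the other end gives the increment 1/3.\<close>

definition corner_vals :: "nat \<Rightarrow> nat \<Rightarrow> real" where
  "corner_vals i j = (if j = i then 0 else if j = (i + 1) mod 3 then 1/6 else -1/6)"

definition dz_corner :: "nat \<Rightarrow> pt \<Rightarrow> real" where
  "dz_corner i = (SOME h. h \<in> finite_energy_fns \<and> (\<forall>j<3. h (vtx j) = corner_vals i j) \<and>
     (\<forall>m u. energy_at m h u = energy_at 0 h u))"

lemma dz_corner:
  "dz_corner i \<in> finite_energy_fns" "j < 3 \<Longrightarrow> dz_corner i (vtx j) = corner_vals i j"
  "energy_at m (dz_corner i) u = energy_at 0 (dz_corner i) u"
proof -
  from harmonic_extension_exists[of "corner_vals i"]
  have "\<exists>h. h \<in> finite_energy_fns \<and> (\<forall>j<3. h (vtx j) = corner_vals i j) \<and>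
     (\<forall>m u. energy_at m h u = energy_at 0 h u)" by blast
  from someI_ex[OF this, folded dz_corner_def]
  show "dz_corner i \<in> finite_energy_fns" "j < 3 \<Longrightarrow> dz_corner i (vtx j) = corner_vals i j"
    "energy_at m (dz_corner i) u = energy_at 0 (dz_corner i) u" by blast+
qed

text \<open>The normal derivative vanishes at p_i, where the neighbours have values 1/6 and -1/6,
  and equals 1/6 + 1/3 = 1/2 up to sign at the other two vertices. Only the increment of u along the
  lacuna side remains.\<close>

lemma dz_corner_energy:
  "energy_at m (dz_corner 0) u = (u (vtx 1) - u (vtx 2)) / 2"
  "energy_at m (dz_corner 1) u = (u (vtx 2) - u (vtx 0)) / 2"
  "energy_at m (dz_corner 2) u = (u (vtx 0) - u (vtx 1)) / 2"
  by (simp_all add: dz_corner(3)[of m] energy_at_0 dz_corner(2) corner_vals_def field_simps)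

definition dz_potential :: "nat list \<Rightarrow> nat list \<Rightarrow> pt \<Rightarrow> real" where
  "dz_potential \<sigma> \<rho> = (if \<rho> \<noteq> [] \<and> butlast \<rho> = \<sigma> then dz_corner (last \<rho>) else (\<lambda>_. 0))"

text \<open>An arbitrary representative: by \<open>potentials_determine_class\<close> its class
  depends only on the potentials.\<close>

definition dz_form :: "nat list \<Rightarrow> form" where
  "dz_form \<sigma> = (SOME \<omega>. has_potentials (Suc (length \<sigma>)) (dz_potential \<sigma>) \<omega>)"

lemma has_potentials_dz_form: "has_potentials (Suc (length \<sigma>)) (dz_potential \<sigma>) (dz_form \<sigma>)"
proof -
  have "dz_potential \<sigma> \<rho> \<in> finite_energy_fns" for \<rho> by (simp add: dz_potential_def dz_corner(1))
  then have "\<exists>\<omega>. has_potentials (Suc (length \<sigma>)) (dz_potential \<sigma>) \<omega>" using has_potentials_exists by blast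
  then show ?thesis unfolding dz_form_def by (rule someI_ex)
qed

lemma period_dz_potential: "period (dz_potential \<sigma>) \<tau> = of_bool (\<sigma> = \<tau>)"
  by (simp add: period_def dz_potential_def dz_corner(2) corner_vals_def)

lemma period_closed:
  assumes "\<And>i. u (\<sigma> @ [i]) = (\<lambda>x. g (contr i x))"
  shows "period u \<sigma> = 0"
  using contr_vtx_commute[of 1 0] contr_vtx_commute[of 2 0] contr_vtx_commute[of 2 1]
  by (simp add: period_def assms)

section \<open>Inner products with the forms dz in a fixed completion\<close>

context
  fixes \<iota> :: "form \<Rightarrow> 'h::{real_inner, complete_space}"
  assumes completion: "form_completion \<iota>"
begin

lemma completion_lincomb:
  "\<omega> \<in> one_forms \<Longrightarrow> \<eta> \<in> one_forms \<Longrightarrow> \<iota> (\<lambda>z. a * \<omega> z + b * \<eta> z) = a *\<^sub>R \<iota> \<omega> + b *\<^sub>R \<iota> \<eta>"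
  using completion unfolding form_completion_def by blast

lemma completion_sum:
  assumes "finite I" "\<And>i. i \<in> I \<Longrightarrow> \<omega> i \<in> one_forms"
  shows "\<iota> (\<lambda>z. \<Sum>i\<in>I. a i * \<omega> i z) = (\<Sum>i\<in>I. a i *\<^sub>R \<iota> (\<omega> i))"
  using assms
proof (induction I)
  case empty
  have "\<iota> (\<lambda>z. 0 * fdg (\<lambda>_. 0) (\<lambda>_. 0) z + 0 * fdg (\<lambda>_. 0) (\<lambda>_. 0) z) = 0"
    by (subst completion_lincomb) (auto intro: one_forms.gen)
  then show ?case by simp
next
  case (insert i I)
  have "\<iota> (\<lambda>z. a i * \<omega> i z + 1 * (\<Sum>i\<in>I. a i * \<omega> i z)) = a i *\<^sub>R \<iota> (\<omega> i) + 1 *\<^sub>R \<iota> (\<lambda>z. \<Sum>i\<in>I. a i * \<omega> i z)"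
    using insert.prems by (intro completion_lincomb one_forms_sum one_forms_cmult) auto
  then show ?case using insert by simp
qed

lemma potentials_determine_class:
  assumes u: "has_potentials n u \<omega>" and v: "has_potentials n v \<eta>"
    and eq: "\<And>\<sigma>. \<sigma> \<in> words n \<Longrightarrow> \<exists>c. \<forall>x\<in>gasket. u \<sigma> x = v \<sigma> x + c"
  shows "\<iota> \<omega> = \<iota> \<eta>"
proof -
  let ?w = "\<lambda>\<sigma> x. 1 * u \<sigma> x + (-1) * v \<sigma> x" and ?d = "\<lambda>z. 1 * \<omega> z + (-1) * \<eta> z"
  have "energy_at k (?w \<sigma>) (?w \<sigma>) = 0" if s: "\<sigma> \<in> words n" for k \<sigma>
  proof -
    obtain c where "\<forall>x\<in>gasket. u \<sigma> x = v \<sigma> x + c" using eq[OF s] by blast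
    then have "energy_at k (?w \<sigma>) (?w \<sigma>) = energy_at k (\<lambda>_. c) (\<lambda>_. c)" by (intro energy_at_cong) auto
    then show ?thesis by simp
  qed
  then have "(\<Sum>\<sigma>\<in>words n. energy_at k (?w \<sigma>) (?w \<sigma>)) = 0" for k by (intro sum.neutral) blast
  moreover have "(\<lambda>k. (5/3) ^ n * (\<Sum>\<sigma>\<in>words n. energy_at k (?w \<sigma>) (?w \<sigma>))) \<longlonglongrightarrow> inner (\<iota> ?d) (\<iota> ?d)"
    using has_potentials_inner_tendsto[OF completion has_potentials_lincomb[OF u v] has_potentials_lincomb[OF u v]] .
  ultimately have "inner (\<iota> ?d) (\<iota> ?d) = 0" by (simp only: mult_zero_right LIMSEQ_const_iff)
  then show ?thesis
    using completion_lincomb[OF has_potentialsD(1)[OF u] has_potentialsD(1)[OF v], of 1 "-1"] by simp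
qed

text \<open>The three corner energies add up to half the period at every level k, so the sequence
  whose limit is the inner product is constant.\<close>

lemma inner_dz_form:
  assumes s: "\<sigma> \<in> words n" and v: "has_potentials (Suc n) v \<eta>"
  shows "inner (\<iota> (dz_form \<sigma>)) (\<iota> \<eta>) = (5/3) ^ Suc n / 2 * period v \<sigma>"
proof -
  have d: "has_potentials (Suc n) (dz_potential \<sigma>) (dz_form \<sigma>)"
    using has_potentials_dz_form[of \<sigma>] s by (simp add: length_words)
  have "(\<Sum>\<rho>\<in>words (Suc n). energy_at k (dz_potential \<sigma> \<rho>) (v \<rho>)) = period v \<sigma> / 2" for k
  proof -
    have "(\<Sum>\<rho>\<in>words (n + 1). energy_at k (dz_potential \<sigma> \<rho>) (v \<rho>)) =
      (\<Sum>\<tau>\<in>words n. if \<tau> = \<sigma> then period v \<sigma> / 2 else 0)"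
      unfolding sum_words_add sum_words_1
      by (intro sum.cong refl) (auto simp: dz_potential_def dz_corner_energy[unfolded One_nat_def] period_def field_simps)
    then show ?thesis using s by simp
  qed
  with has_potentials_inner_tendsto[OF completion d v]
  have "(\<lambda>k. (5/3) ^ Suc n * (period v \<sigma> / 2)) \<longlonglongrightarrow> inner (\<iota> (dz_form \<sigma>)) (\<iota> \<eta>)" by (simp only:)
  then show ?thesis by (simp add: LIMSEQ_const_iff)
qed

text \<open>If m \<le> n, the cell C_\<sigma> lies in a cell that carries a single potential, so the
  loop around the lacuna closes and the period is zero. The case m = 0 treats exact forms, and m =
  |\<tau>| + 1 treats \<open>dz\<close> of a shorter word \<tau>.\<close>

lemma inner_dz_form_coarse:
  assumes s: "\<sigma> \<in> words n" and m: "m \<le> n" and v: "has_potentials m v \<eta>"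
  shows "inner (\<iota> (dz_form \<sigma>)) (\<iota> \<eta>) = 0"
proof -
  let ?v = "\<lambda>\<rho> x. v (take m \<rho>) (contr_word (drop m \<rho>) x)"
  have "has_potentials (Suc n) ?v \<eta>" using has_potentials_refine[OF v, of "Suc n - m"] m by simp
  moreover have "period ?v \<sigma> = 0"
    by (rule period_closed[of _ _ "\<lambda>x. v (take m \<sigma>) (contr_word (drop m \<sigma>) x)"])
       (use s m in \<open>simp add: length_words contr_word_append contr_word_single\<close>)
  ultimately show ?thesis using inner_dz_form[OF s, of ?v \<eta>] by (simp only: mult_zero_right)
qed

lemma dz_eq:
  assumes s: "\<sigma> \<in> gwords"
  shows "dz \<iota> \<sigma> = \<iota> (dz_form \<sigma>)"
proof -
  let ?n = "length \<sigma>" and ?D = "\<iota> (dz_form \<sigma>)"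
  define c :: real where "c = (5/3) ^ Suc ?n / 2"
  have c: "c > 0" by (simp add: c_def)
  have w: "\<sigma> \<in> words ?n" using s by (rule gwords_in_words)
  \<comment> \<open>All competitors have the same product c with ?D, and ?D is one of them; hence
    \<eta> - ?D is orthogonal to ?D, and Pythagoras gives the minimum and its uniqueness.\<close>
  have comp: "inner ?D (\<iota> \<eta>) = c" if "\<eta> \<in> dz_competitors \<sigma>" for \<eta>
  proof -
    have "locally_exact (Suc ?n) \<eta>" using that by (simp add: dz_competitors_def)
    then obtain v where v: "has_potentials (Suc ?n) v \<eta>" by (rule locally_exact_imp_potentials)
    have "period v \<sigma> = 1" using that form_integral_lacuna[OF v w] by (simp add: dz_competitors_def)
    then show ?thesis using inner_dz_form[OF w v] by (simp add: c_def)
  qed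
  have D: "dz_form \<sigma> \<in> dz_competitors \<sigma>"
    using potentials_imp_locally_exact[OF has_potentials_dz_form[of \<sigma>]] form_integral_lacuna[OF has_potentials_dz_form w]
    by (simp add: dz_competitors_def period_dz_potential)
  have norm: "(norm (\<iota> \<eta>))\<^sup>2 = (norm ?D)\<^sup>2 + (norm (\<iota> \<eta> - ?D))\<^sup>2" if "\<eta> \<in> dz_competitors \<sigma>" for \<eta>
    using comp[OF that] comp[OF D]
    by (simp add: power2_norm_eq_inner inner_diff_left inner_diff_right inner_commute)
  have min: "norm ?D \<le> norm (\<iota> \<eta>)" if "\<eta> \<in> dz_competitors \<sigma>" for \<eta>
    using norm[OF that] by (intro power2_le_imp_le[OF _ norm_ge_zero]) simp
  show ?thesis
    unfolding dz_def
  proof (rule the_equality)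
    show "\<exists>\<omega>\<in>dz_competitors \<sigma>. ?D = \<iota> \<omega> \<and> (\<forall>\<eta>\<in>dz_competitors \<sigma>. norm (\<iota> \<omega>) \<le> norm (\<iota> \<eta>))"
      using D min by blast
    fix \<theta> assume "\<exists>\<omega>\<in>dz_competitors \<sigma>. \<theta> = \<iota> \<omega> \<and> (\<forall>\<eta>\<in>dz_competitors \<sigma>. norm (\<iota> \<omega>) \<le> norm (\<iota> \<eta>))"
    then obtain \<omega> where o: "\<omega> \<in> dz_competitors \<sigma>" "\<theta> = \<iota> \<omega>" "norm (\<iota> \<omega>) \<le> norm ?D" using D by blast
    then have "(norm (\<iota> \<omega>))\<^sup>2 \<le> (norm ?D)\<^sup>2" by (intro power_mono) auto
    then show "\<theta> = ?D" using norm[OF o(1)] o(2) by simp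
  qed
qed

lemma inner_dz_self: "\<sigma> \<in> gwords \<Longrightarrow> inner (dz \<iota> \<sigma>) (dz \<iota> \<sigma>) = (5/3) ^ Suc (length \<sigma>) / 2"
  unfolding dz_eq by (subst inner_dz_form[OF gwords_in_words has_potentials_dz_form]) (simp_all add: period_dz_potential)

lemma inner_dz_dz:
  assumes "\<sigma> \<in> gwords" "\<tau> \<in> gwords" "\<sigma> \<noteq> \<tau>"
  shows "inner (dz \<iota> \<sigma>) (dz \<iota> \<tau>) = 0"
proof -
  have *: "inner (dz \<iota> \<sigma>) (dz \<iota> \<tau>) = 0" if "\<sigma> \<in> gwords" "\<tau> \<in> gwords" "\<sigma> \<noteq> \<tau>" "length \<tau> \<le> length \<sigma>" for \<sigma> \<tau>
  proof (cases "length \<tau> = length \<sigma>")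
    case True
    have "has_potentials (Suc (length \<sigma>)) (dz_potential \<tau>) (dz_form \<tau>)"
      using has_potentials_dz_form[of \<tau>] True by simp
    from inner_dz_form[OF gwords_in_words[OF that(1)] this] show ?thesis
      using that by (simp add: dz_eq period_dz_potential)
  next
    case False
    then show ?thesis
      using inner_dz_form_coarse[OF gwords_in_words[OF that(1)] _ has_potentials_dz_form[of \<tau>]] that
      by (simp add: dz_eq)
  qed
  show ?thesis
    using *[of \<sigma> \<tau>] *[of \<tau> \<sigma>] assms by (cases "length \<tau> \<le> length \<sigma>") (auto simp: inner_commute)
qed

lemma inner_dz_exact:
  assumes "\<sigma> \<in> gwords" "U \<in> finite_energy_fns"
  shows "inner (dz \<iota> \<sigma>) (exact_form \<iota> U) = 0"
  using inner_dz_form_coarse[OF gwords_in_words[OF assms(1)] _ has_potentials_exact[OF assms(2)]] assms(1)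
  by (simp add: dz_eq exact_form_def)

section \<open>The exact forms are a closed subspace\<close>

lemma exact_form_lincomb:
  assumes "U \<in> finite_energy_fns" "V \<in> finite_energy_fns"
  shows "exact_form \<iota> (\<lambda>x. a * U x + b * V x) = a *\<^sub>R exact_form \<iota> U + b *\<^sub>R exact_form \<iota> V"
proof -
  have "fdg (\<lambda>_. 1) (\<lambda>x. a * U x + b * V x) = (\<lambda>z. a * fdg (\<lambda>_. 1) U z + b * fdg (\<lambda>_. 1) V z)"
    by (rule ext) (simp add: fdg_def case_prod_unfold algebra_simps)
  then show ?thesis
    unfolding exact_form_def using assms by (simp add: completion_lincomb one_forms.gen)
qed

lemma exact_form_diff:
  assumes "U \<in> finite_energy_fns" "V \<in> finite_energy_fns"
  shows "exact_form \<iota> (\<lambda>x. U x - V x) = exact_form \<iota> U - exact_form \<iota> V"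
  using exact_form_lincomb[OF assms, of 1 "-1"] by simp

lemma exact_form_const: "exact_form \<iota> (\<lambda>_. c) = 0"
  using exact_form_lincomb[of "\<lambda>_. c" "\<lambda>_. c" 1 "-1"] exact_form_lincomb[of "\<lambda>_. 0" "\<lambda>_. 0" 0 0]
    potentials_determine_class[OF has_potentials_exact has_potentials_exact, of "\<lambda>_. c" "\<lambda>_. 0"]
  by (simp add: exact_form_def)

lemma subspace_exact_forms: "subspace (exact_forms \<iota>)"
proof (rule subspaceI)
  show "0 \<in> exact_forms \<iota>"
    unfolding exact_forms_def using exact_form_const[of 0] by (metis image_eqI finite_energy_const)
  fix x y assume "x \<in> exact_forms \<iota>" "y \<in> exact_forms \<iota>"
  then obtain U V where UV: "U \<in> finite_energy_fns" "V \<in> finite_energy_fns" "x = exact_form \<iota> U" "y = exact_form \<iota> V"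
    by (auto simp: exact_forms_def)
  have eq: "x + y = exact_form \<iota> (\<lambda>x. 1 * U x + 1 * V x)"
    unfolding UV(3,4) exact_form_lincomb[OF UV(1,2)] by simp
  have "(\<lambda>x. 1 * U x + 1 * V x) \<in> finite_energy_fns" by (intro finite_energy_add finite_energy_cmult UV)
  then show "x + y \<in> exact_forms \<iota>"
    unfolding exact_forms_def eq by (rule imageI)
next
  fix c :: real and x assume "x \<in> exact_forms \<iota>"
  then obtain U where U: "U \<in> finite_energy_fns" "x = exact_form \<iota> U" by (auto simp: exact_forms_def)
  have eq: "c *\<^sub>R x = exact_form \<iota> (\<lambda>x. c * U x + 0 * U x)"
    unfolding U(2) exact_form_lincomb[OF U(1,1)] by simp
  have "(\<lambda>x. c * U x + 0 * U x) \<in> finite_energy_fns" by (intro finite_energy_add finite_energy_cmult U)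
  then show "c *\<^sub>R x \<in> exact_forms \<iota>"
    unfolding exact_forms_def eq by (rule imageI)
qed

lemma energy_at_tendsto_norm:
  assumes "U \<in> finite_energy_fns"
  shows "(\<lambda>m. energy_at m U U) \<longlonglongrightarrow> (norm (exact_form \<iota> U))\<^sup>2"
  using has_potentials_inner_tendsto[OF completion has_potentials_exact[OF assms] has_potentials_exact[OF assms]]
  by (simp add: exact_form_def power2_norm_eq_inner)

lemma energy_at_le_norm:
  assumes "U \<in> finite_energy_fns"
  shows "energy_at m U U \<le> (norm (exact_form \<iota> U))\<^sup>2"
  by (rule incseq_le[OF incseq_SucI energy_at_tendsto_norm[OF assms]]) (rule energy_at_Suc_le)

lemma closed_exact_forms: "closed (exact_forms \<iota>)"
  unfolding closed_sequential_limits
proof (intro allI impI, elim conjE)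
  fix a \<theta> assume a: "\<forall>n. a n \<in> exact_forms \<iota>" "a \<longlonglongrightarrow> \<theta>"
  have "\<forall>n. \<exists>U. U \<in> finite_energy_fns \<and> a n = exact_form \<iota> U" using a(1) by (auto simp: exact_forms_def)
  then obtain U where U: "\<And>n. U n \<in> finite_energy_fns" "\<And>n. a n = exact_form \<iota> (U n)" by metis
  \<comment> \<open>Constants do not change the exact form. After normalisation at p_0,
    \<open>oscillation_le\<close> turns a Cauchy sequence in norm into a uniformly Cauchy sequence
    of functions.\<close>
  define V where "V n x = U n x - U n (vtx 0)" for n x
  have V: "V n \<in> finite_energy_fns" for n
    unfolding V_def[abs_def] by (intro finite_energy_diff U) simp
  have aV: "a n = exact_form \<iota> (V n)" for n
    unfolding V_def[abs_def] U(2) by (subst exact_form_diff) (simp_all add: U exact_form_const)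
  have VV: "(\<lambda>x. V m x - V n x) \<in> finite_energy_fns" for m n by (intro finite_energy_diff V)
  have e: "energy_at k (\<lambda>x. V m x - V n x) (\<lambda>x. V m x - V n x) \<le> (norm (a m - a n))\<^sup>2" for k m n
    using energy_at_le_norm[OF VV[of m n], of k] by (simp add: exact_form_diff[OF V V] aV)
  have osc: "\<bar>V m x - V n x\<bar> \<le> 5 * sqrt 2 * norm (a m - a n)" if "x \<in> gasket" for m n x
  proof -
    have "continuous_on gasket (\<lambda>x. V m x - V n x)" using VV by (simp add: finite_energy_iff)
    from oscillation_le[OF this e that] show ?thesis by (simp add: V_def real_sqrt_mult)
  qed
  have cauchy: "Cauchy a" using a(2) by (rule LIMSEQ_imp_Cauchy)
  have "uniformly_Cauchy_on gasket V"
  proof (rule uniformly_Cauchy_onI)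
    fix r :: real assume "r > 0"
    then obtain M where M: "\<And>m n. m \<ge> M \<Longrightarrow> n \<ge> M \<Longrightarrow> norm (a m - a n) < r / (5 * sqrt 2)"
      using CauchyD[OF cauchy, of "r / (5 * sqrt 2)"] by auto
    have "dist (V m x) (V n x) < r" if "x \<in> gasket" "m \<ge> M" "n \<ge> M" for x m n
      using osc[OF that(1), of m n] M[OF that(2,3)] by (simp add: dist_real_def field_simps)
    then show "\<exists>M. \<forall>x\<in>gasket. \<forall>m\<ge>M. \<forall>n\<ge>M. dist (V m x) (V n x) < r" by blast
  qed
  then obtain W where W: "uniform_limit gasket V W sequentially"
    using Cauchy_uniformly_convergent unfolding uniformly_convergent_on_def by blast
  have contW: "continuous_on gasket W"
    by (rule uniform_limit_theorem[OF _ W]) (use V in \<open>simp_all add: finite_energy_iff\<close>)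
  have lim: "(\<lambda>n. V n x) \<longlonglongrightarrow> W x" if "x \<in> gasket" for x by (rule tendsto_uniform_limitI[OF W that])
  \<comment> \<open>At a fixed level k the energy is a finite sum, so pointwise convergence in m
    suffices. The level tends to infinity only afterwards, which avoids exchanging the two
    limits.\<close>
  have limE: "(\<lambda>m. energy_at k (\<lambda>x. V m x - V n x) (\<lambda>x. V m x - V n x))
      \<longlonglongrightarrow> energy_at k (\<lambda>x. W x - V n x) (\<lambda>x. W x - V n x)" for k n
    unfolding energy_at_def osum_def case_prod_unfold
    by (intro tendsto_mult tendsto_const tendsto_sum tendsto_diff lim) (auto simp: vpairs_def)
  have bound: "energy_at k (\<lambda>x. W x - V n x) (\<lambda>x. W x - V n x) \<le> r\<^sup>2"
    if n: "\<And>m. m \<ge> n \<Longrightarrow> norm (a m - a n) \<le> r" for k n r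
  proof (rule LIMSEQ_le_const2[OF limE])
    show "\<exists>N. \<forall>m\<ge>N. energy_at k (\<lambda>x. V m x - V n x) (\<lambda>x. V m x - V n x) \<le> r\<^sup>2"
    proof (intro exI[of _ n] allI impI)
      fix m assume "n \<le> m"
      then have "(norm (a m - a n))\<^sup>2 \<le> r\<^sup>2" using n by (intro power_mono) auto
      then show "energy_at k (\<lambda>x. V m x - V n x) (\<lambda>x. V m x - V n x) \<le> r\<^sup>2" using e[of k m n] by linarith
    qed
  qed
  have tail: "\<exists>N. \<forall>n\<ge>N. \<forall>m\<ge>n. norm (a m - a n) \<le> r" if r: "r > 0" for r
  proof -
    obtain M where "\<forall>m\<ge>M. \<forall>n\<ge>M. norm (a m - a n) < r" using CauchyD[OF cauchy r] by blast
    then show ?thesis by (intro exI[of _ M]) (auto intro: less_imp_le)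
  qed
  have WF: "W \<in> finite_energy_fns"
  proof -
    obtain N where "\<forall>n\<ge>N. \<forall>m\<ge>n. norm (a m - a n) \<le> 1" using tail[of 1] by auto
    then have "energy_at k (\<lambda>x. W x - V N x) (\<lambda>x. W x - V N x) \<le> 1\<^sup>2" for k by (intro bound) auto
    moreover have "continuous_on gasket (\<lambda>x. W x - V N x)"
      using V by (intro continuous_on_diff contW) (simp add: finite_energy_iff)
    ultimately have "(\<lambda>x. W x - V N x) \<in> finite_energy_fns" unfolding finite_energy_iff by blast
    from finite_energy_add[OF this V[of N]] show ?thesis by simp
  qed
  have "a \<longlonglongrightarrow> exact_form \<iota> W"
    unfolding LIMSEQ_iff
  proof (intro allI impI)
    fix r :: real assume "r > 0"
    then obtain N where N: "\<forall>n\<ge>N. \<forall>m\<ge>n. norm (a m - a n) \<le> r / 2" using tail[of "r / 2"] by auto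
    have "norm (a n - exact_form \<iota> W) < r" if "n \<ge> N" for n
    proof -
      have "(norm (exact_form \<iota> (\<lambda>x. W x - V n x)))\<^sup>2 \<le> (r / 2)\<^sup>2"
        by (rule LIMSEQ_le_const2[OF energy_at_tendsto_norm[OF finite_energy_diff[OF WF V]]])
           (use N that in \<open>auto intro!: bound\<close>)
      then have "norm (exact_form \<iota> (\<lambda>x. W x - V n x)) \<le> r / 2"
        by (rule power2_le_imp_le) (use \<open>r > 0\<close> in simp)
      then show ?thesis using \<open>r > 0\<close> by (simp add: exact_form_diff[OF WF V] aV norm_minus_commute)
    qed
    then show "\<exists>N. \<forall>n\<ge>N. norm (a n - exact_form \<iota> W) < r" by blast
  qed
  then have "\<theta> = exact_form \<iota> W" using a(2) LIMSEQ_unique by blast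
  then show "\<theta> \<in> exact_forms \<iota>" using WF by (simp add: exact_forms_def)
qed

section \<open>Density of the sum of the exact forms and the span of the dz\<close>

lemma exact_orthogonal_span_dz:
  assumes "x \<in> exact_forms \<iota>" "y \<in> span (dz \<iota> ` gwords)"
  shows "inner x y = 0"
proof (rule orthogonal_span[OF _ assms(2)])
  fix b assume "b \<in> dz \<iota> ` gwords"
  then show "inner x b = 0"
    using assms(1) inner_dz_exact by (auto simp: exact_forms_def inner_commute)
qed

abbreviation exact_dz_sum :: "'h set" where
  "exact_dz_sum \<equiv> {x + y | x y. x \<in> exact_forms \<iota> \<and> y \<in> span (dz \<iota> ` gwords)}"

lemma subspace_exact_dz_sum: "subspace exact_dz_sum"
  by (intro subspace_sums subspace_exact_forms subspace_span)

lemma exact_in_sum: "x \<in> exact_forms \<iota> \<Longrightarrow> x \<in> exact_dz_sum"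
  by (intro CollectI exI[of _ x] exI[of _ 0]) (simp add: span_zero)

lemma dz_in_sum: "\<sigma> \<in> gwords \<Longrightarrow> dz \<iota> \<sigma> \<in> exact_dz_sum"
  using subspace_0[OF subspace_exact_forms]
  by (intro CollectI exI[of _ 0] exI[of _ "dz \<iota> \<sigma>"]) (simp add: span_base)

text \<open>Subtracting the periods around the lacunas of the last level from an \<open>(n+1)\<close>-exact form,
  by means of the \<open>dz\<^sub>\<sigma>\<close>, leaves an \<open>n\<close>-exact form.\<close>

lemma potentials_in_sum: "has_potentials n u \<omega> \<Longrightarrow> \<iota> \<omega> \<in> exact_dz_sum"
proof (induction n arbitrary: u \<omega>)
  case 0
  have U: "u [] \<in> finite_energy_fns" using has_potentialsD(2)[OF 0] by simp
  have "\<iota> \<omega> = \<iota> (fdg (\<lambda>_. 1) (u []))"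
    by (rule potentials_determine_class[OF 0 has_potentials_exact[OF U]]) (auto intro!: exI[of _ 0])
  then show ?case
    using U by (intro exact_in_sum) (auto simp: exact_forms_def exact_form_def)
next
  case (Suc n)
  define P where "P = period u"
  have "\<forall>\<sigma>. \<exists>g c. \<sigma> \<in> words n \<longrightarrow> g \<in> finite_energy_fns \<and>
    (\<forall>i<3. \<forall>x\<in>gasket. g (contr i x) = u (\<sigma> @ [i]) x - P \<sigma> * dz_corner i x + c i)"
  proof
    fix \<sigma>
    show "\<exists>g c. \<sigma> \<in> words n \<longrightarrow> g \<in> finite_energy_fns \<and>
      (\<forall>i<3. \<forall>x\<in>gasket. g (contr i x) = u (\<sigma> @ [i]) x - P \<sigma> * dz_corner i x + c i)"
    proof (cases "\<sigma> \<in> words n")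
      case True
      define a where "a i x = u (\<sigma> @ [i]) x - P \<sigma> * dz_corner i x" for i x
      \<comment> \<open>Integration constants relative to subcell 0: they match the potentials at
        its junctions with subcells 1 and 2.\<close>
      define c where "c i = (if i = 0 then 0 else a 0 (vtx i) - a i (vtx 0))" for i :: nat
      have w: "\<sigma> @ [i] \<in> words (Suc n)" if "i < 3" for i
        using True that unfolding words_def gwords_def set012 by auto
      have aF: "a i \<in> finite_energy_fns" if "i < 3" for i
        unfolding a_def[abs_def]
        by (intro finite_energy_diff finite_energy_cmult dz_corner(1) has_potentialsD(2)[OF Suc.prems w[OF that]])
      \<comment> \<open>With the period removed, the remaining junction, between subcells 1 and 2,
        matches automatically.\<close>
      have loop: "a 1 (vtx 2) - a 1 (vtx 0) + (a 2 (vtx 0) - a 2 (vtx 1)) + (a 0 (vtx 1) - a 0 (vtx 2)) = 0"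
        by (simp add: a_def P_def period_def dz_corner(2) corner_vals_def algebra_simps)
      have comp: "a i (vtx j) + c i = a j (vtx i) + c j" if "i < 3" "j < 3" for i j
        using that loop unfolding less3 by (elim disjE) (simp_all add: c_def)
      let ?g = "glue (\<lambda>i x. a i x + c i)"
      have "?g \<in> finite_energy_fns"
        by (rule glue_finite_energy) (use comp aF in \<open>auto intro: finite_energy_add\<close>)
      moreover have "?g (contr i x) = a i x + c i" if "i < 3" "x \<in> gasket" for i x
        by (rule glue_contr) (use comp that in auto)
      ultimately show ?thesis by (intro exI[of _ ?g] exI[of _ c]) (auto simp: a_def)
    qed simp
  qed
  then obtain g c where g: "\<And>\<sigma>. \<sigma> \<in> words n \<Longrightarrow> g \<sigma> \<in> finite_energy_fns"
    "\<And>\<sigma> i x. \<sigma> \<in> words n \<Longrightarrow> i < 3 \<Longrightarrow> x \<in> gasket \<Longrightarrow>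
       g \<sigma> (contr i x) = u (\<sigma> @ [i]) x - P \<sigma> * dz_corner i x + c \<sigma> i" by metis
  obtain \<eta> where h: "has_potentials n g \<eta>" using has_potentials_exists[of n g] g(1) by blast
  let ?v = "\<lambda>\<rho> x. g (take n \<rho>) (contr_word (drop n \<rho>) x)"
  have hr: "has_potentials (Suc n) ?v \<eta>" using has_potentials_refine[OF h, of 1] by simp
  have dzp: "has_potentials (Suc n) (dz_potential \<sigma>) (dz_form \<sigma>)" if "\<sigma> \<in> words n" for \<sigma>
    using has_potentials_dz_form[of \<sigma>] that by (simp add: length_words)
  have dzs: "has_potentials (Suc n) (\<lambda>\<rho> x. \<Sum>\<sigma>\<in>words n. P \<sigma> * dz_potential \<sigma> \<rho> x) (\<lambda>z. \<Sum>\<sigma>\<in>words n. P \<sigma> * dz_form \<sigma> z)"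
    by (rule has_potentials_sum[OF finite_words dzp])
  have "\<iota> \<omega> = \<iota> (\<lambda>z. 1 * \<eta> z + 1 * (\<Sum>\<sigma>\<in>words n. P \<sigma> * dz_form \<sigma> z))"
  proof (rule potentials_determine_class[OF Suc.prems has_potentials_lincomb[OF hr dzs]])
    fix \<rho> assume "\<rho> \<in> words (Suc n)"
    then have "\<rho> \<in> words (n + 1)" by simp
    then obtain \<tau> \<pi> where "\<rho> = \<tau> @ \<pi>" "\<tau> \<in> words n" "\<pi> \<in> words 1" by (rule words_addE)
    then obtain i where r: "\<rho> = \<tau> @ [i]" "\<tau> \<in> words n" "i < 3" by (auto simp: words_1[unfolded One_nat_def])
    have s: "(\<Sum>\<sigma>\<in>words n. P \<sigma> * dz_potential \<sigma> \<rho> x) = P \<tau> * dz_corner i x" for x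
    proof -
      have "(\<Sum>\<sigma>\<in>words n. P \<sigma> * dz_potential \<sigma> \<rho> x) = (\<Sum>\<sigma>\<in>words n. if \<sigma> = \<tau> then P \<tau> * dz_corner i x else 0)"
        by (intro sum.cong) (auto simp: dz_potential_def r(1))
      then show ?thesis using r(2) by simp
    qed
    have "u \<rho> x = 1 * ?v \<rho> x + 1 * (\<Sum>\<sigma>\<in>words n. P \<sigma> * dz_potential \<sigma> \<rho> x) + - c \<tau> i" if "x \<in> gasket" for x
      unfolding s using g(2)[OF r(2,3) that] r by (simp add: length_words contr_word_single)
    then show "\<exists>c. \<forall>x\<in>gasket. u \<rho> x = 1 * ?v \<rho> x + 1 * (\<Sum>\<sigma>\<in>words n. P \<sigma> * dz_potential \<sigma> \<rho> x) + c" by blast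
  qed
  also have "\<dots> = \<iota> \<eta> + (\<Sum>\<sigma>\<in>words n. P \<sigma> *\<^sub>R \<iota> (dz_form \<sigma>))"
  proof -
    have "\<iota> (\<lambda>z. \<Sum>\<sigma>\<in>words n. P \<sigma> * dz_form \<sigma> z) = (\<Sum>\<sigma>\<in>words n. P \<sigma> *\<^sub>R \<iota> (dz_form \<sigma>))"
      by (rule completion_sum[OF finite_words]) (rule has_potentialsD(1)[OF dzp])
    then show ?thesis
      using completion_lincomb[OF has_potentialsD(1)[OF h] has_potentialsD(1)[OF dzs], of 1 1] by simp
  qed
  also have "\<dots> \<in> exact_dz_sum"
  proof (intro subspace_add[OF subspace_exact_dz_sum] subspace_sum[OF subspace_exact_dz_sum]
      subspace_scale[OF subspace_exact_dz_sum])
    show "\<iota> \<eta> \<in> exact_dz_sum" by (rule Suc.IH[OF h])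
    fix \<sigma> assume "\<sigma> \<in> words n"
    then have "\<sigma> \<in> gwords" by (rule words_imp_gwords)
    from dz_in_sum[OF this] show "\<iota> (dz_form \<sigma>) \<in> exact_dz_sum"
      unfolding dz_eq[OF \<open>\<sigma> \<in> gwords\<close>] .
  qed
  finally show ?case .
qed

text \<open>A form \<open>f dg\<close> is approximated by replacing \<open>f\<close> with a constant on every cell of level \<open>n\<close>.\<close>

lemma fdg_approximable:
  assumes f: "f \<in> finite_energy_fns" and g: "g \<in> finite_energy_fns" and e: "e > 0"
  shows "\<exists>n u \<omega>. has_potentials n u \<omega> \<and> dist (\<iota> \<omega>) (\<iota> (fdg f g)) < e"
proof -
  obtain B where B: "\<And>m. energy_at m g g \<le> B" using g by (auto simp: finite_energy_iff)
  have B0: "0 \<le> B" using B[of 0] energy_at_nonneg[of 0 g] by linarith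
  \<comment> \<open>The summand 1 makes d well defined and d * sqrt B strictly less than e even for
    B = 0.\<close>
  define d where "d = e / (1 + sqrt B)"
  have d: "d > 0" using e B0 by (simp add: d_def add_pos_nonneg)
  have "uniformly_continuous_on gasket f"
    using f by (intro compact_uniformly_continuous) (auto simp: finite_energy_iff)
  then obtain r where r: "r > 0" "\<And>x y. x \<in> gasket \<Longrightarrow> y \<in> gasket \<Longrightarrow> dist y x < r \<Longrightarrow> dist (f y) (f x) < d"
    using d unfolding uniformly_continuous_on_def by metis
  obtain D where D: "\<And>x. x \<in> gasket \<Longrightarrow> norm x \<le> D" and "D > 0"
    using compact_imp_bounded[OF compact_gasket] unfolding bounded_pos by blast
  obtain n where n: "(1/2) ^ n < r / (2 * D)"
    using real_arch_pow_inv[of "r / (2 * D)" "1/2"] r(1) \<open>D > 0\<close> by auto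
  have close: "\<bar>f (contr_word \<tau> x) - f (contr_word \<tau> y)\<bar> \<le> d"
    if t: "\<tau> \<in> words n" and xy: "x \<in> gasket" "y \<in> gasket" for \<tau> x y
  proof -
    have "dist (contr_word \<tau> x) (contr_word \<tau> y) = (1/2) ^ n * norm (x - y)"
      using t by (simp add: dist_norm contr_word_diff length_words)
    also have "\<dots> \<le> (1/2) ^ n * (2 * D)"
      using norm_triangle_ineq4[of x y] D[OF xy(1)] D[OF xy(2)] by (intro mult_left_mono) auto
    also have "\<dots> < r" using n \<open>D > 0\<close> by (simp add: field_simps)
    finally have "dist (f (contr_word \<tau> x)) (f (contr_word \<tau> y)) < d" using t xy by (intro r(2)) auto
    then show ?thesis by (simp add: dist_real_def)
  qed
  define u where "u \<tau> x = f (contr_word \<tau> (vtx 0)) * g (contr_word \<tau> x)" for \<tau> x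
  have "u \<tau> \<in> finite_energy_fns" if "\<tau> \<in> words n" for \<tau>
    unfolding u_def[abs_def] by (intro finite_energy_cmult finite_energy_contr_word[OF g that])
  then obtain \<omega> where w: "has_potentials n u \<omega>"
    "\<And>\<tau> \<rho> x y. \<tau> \<in> words n \<Longrightarrow> \<rho> \<in> words 2 \<Longrightarrow> x \<in> gasket \<Longrightarrow> y \<in> gasket \<Longrightarrow>
      \<omega> (contr_word \<tau> (contr_word \<rho> x), contr_word \<tau> (contr_word \<rho> y)) = u \<tau> (contr_word \<rho> x) - u \<tau> (contr_word \<rho> y)"
    using has_potentials_exists[of n u] by blast
  have forms: "\<omega> \<in> one_forms" "fdg f g \<in> one_forms"
    using has_potentialsD(1)[OF w(1)] one_forms.gen[OF f g] .
  let ?D = "\<lambda>z. 1 * \<omega> z + (-1) * fdg f g z"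
  have iD: "\<iota> ?D = \<iota> \<omega> - \<iota> (fdg f g)"
    using completion_lincomb[OF forms, of 1 "-1"] by simp
  have "?D \<in> one_forms" by (intro one_forms.add one_forms_cmult forms)
  from inner_tendsto_one_forms[OF completion this this]
  have lim: "(\<lambda>m. (5/3) ^ m / 2 * osum m (\<lambda>x y. ?D (y, x) * ?D (y, x))) \<longlonglongrightarrow> (norm (\<iota> ?D))\<^sup>2"
    by (simp only: power2_norm_eq_inner)
  have "(norm (\<iota> ?D))\<^sup>2 \<le> d\<^sup>2 * B"
  proof (rule LIMSEQ_le_const2[OF lim], intro exI[of _ "n + 2"] allI impI)
    \<comment> \<open>The explicit values of \<omega> are known only two levels below the cells of
      level n; smaller m do not affect the limit.\<close>
    fix m assume "n + 2 \<le> m"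
    then obtain k where k: "m = n + (2 + k)" by (metis add.assoc le_Suc_ex)
    have "osum m (\<lambda>x y. ?D (y, x) * ?D (y, x)) \<le> osum m (\<lambda>x y. d\<^sup>2 * ((g y - g x) * (g y - g x)))"
    proof (rule osum_mono)
      fix \<sigma> i j assume s: "\<sigma> \<in> words m" "(i, j) \<in> vpairs"
      obtain \<tau> \<sigma>' where t: "\<sigma> = \<tau> @ \<sigma>'" "\<tau> \<in> words n" "\<sigma>' \<in> words (2 + k)"
        using s(1) unfolding k by (rule words_addE)
      obtain \<rho> \<pi> where p: "\<sigma>' = \<rho> @ \<pi>" "\<rho> \<in> words 2" "\<pi> \<in> words k" using t(3) by (rule words_addE)
      have ij: "i < 3" "j < 3" using s(2) by (auto simp: vpairs_iff)
      let ?a = "contr_word \<pi> (vtx i)" and ?b = "contr_word \<pi> (vtx j)"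
      define x where "x = contr_word \<sigma> (vtx i)"
      define y where "y = contr_word \<sigma> (vtx j)"
      have xy: "x = contr_word \<tau> (contr_word \<rho> ?a)" "y = contr_word \<tau> (contr_word \<rho> ?b)"
        by (simp_all add: x_def y_def t(1) p(1) contr_word_append)
      have ab: "?a \<in> gasket" "?b \<in> gasket" using p(3) ij by auto
      have "\<omega> (y, x) = f (contr_word \<tau> (vtx 0)) * (g y - g x)"
        unfolding xy using w(2)[OF t(2) p(2) ab(2,1)] by (simp add: u_def right_diff_distrib)
      then have D: "?D (y, x) = (f (contr_word \<tau> (vtx 0)) - f y) * (g y - g x)"
        by (simp add: fdg_def algebra_simps)
      have "\<bar>f (contr_word \<tau> (vtx 0)) - f y\<bar> \<le> d"
        unfolding xy using close[OF t(2), of "vtx 0" "contr_word \<rho> ?b"] p(2) ab by simp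
      then have "(f (contr_word \<tau> (vtx 0)) - f y)\<^sup>2 \<le> d\<^sup>2" using d by (simp add: abs_le_square_iff[symmetric])
      then have "(f (contr_word \<tau> (vtx 0)) - f y)\<^sup>2 * ((g y - g x) * (g y - g x)) \<le> d\<^sup>2 * ((g y - g x) * (g y - g x))"
        by (rule mult_right_mono) simp
      then show "?D (contr_word \<sigma> (vtx j), contr_word \<sigma> (vtx i)) * ?D (contr_word \<sigma> (vtx j), contr_word \<sigma> (vtx i))
        \<le> d\<^sup>2 * ((g (contr_word \<sigma> (vtx j)) - g (contr_word \<sigma> (vtx i))) * (g (contr_word \<sigma> (vtx j)) - g (contr_word \<sigma> (vtx i))))"
        unfolding x_def[symmetric] y_def[symmetric] D by (simp add: power2_eq_square mult_ac)
    qed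
    then have "(5/3) ^ m / 2 * osum m (\<lambda>x y. ?D (y, x) * ?D (y, x)) \<le> (5/3) ^ m / 2 * osum m (\<lambda>x y. d\<^sup>2 * ((g y - g x) * (g y - g x)))"
      by (rule mult_left_mono) simp
    also have "\<dots> = d\<^sup>2 * energy_at m g g" by (simp add: energy_at_def osum_cmult)
    also have "\<dots> \<le> d\<^sup>2 * B" by (intro mult_left_mono B) simp
    finally show "(5/3) ^ m / 2 * osum m (\<lambda>x y. ?D (y, x) * ?D (y, x)) \<le> d\<^sup>2 * B" .
  qed
  also have "\<dots> = (d * sqrt B)\<^sup>2" using B0 by (simp add: power_mult_distrib)
  finally have "norm (\<iota> ?D) \<le> d * sqrt B" by (rule power2_le_imp_le) (use d B0 in simp)
  also have "\<dots> < d * (1 + sqrt B)" using d by simp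
  also have "\<dots> = e" using B0 by (simp add: d_def add_nonneg_eq_0_iff)
  finally show ?thesis using w(1) iD by (auto simp: dist_norm)
qed

lemma closure_exact_dz_sum: "closure exact_dz_sum = UNIV"
proof -
  note sub = subspace_closure_inner[OF subspace_exact_dz_sum]
  have "\<iota> \<omega> \<in> closure exact_dz_sum" if "\<omega> \<in> one_forms" for \<omega>
    using that
  proof (induction rule: one_forms_induct)
    case (gen f g)
    show ?case
      unfolding closure_approachable
    proof (intro allI impI)
      fix e :: real assume "e > 0"
      from fdg_approximable[OF gen this] show "\<exists>y\<in>exact_dz_sum. dist y (\<iota> (fdg f g)) < e"
        using potentials_in_sum by blast
    qed
  next
    case (add \<omega> \<eta>)
    then show ?case
      using completion_lincomb[OF add.hyps, of 1 1] subspace_add[OF sub] by simp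
  qed
  then have "closure (\<iota> ` one_forms) \<subseteq> closure exact_dz_sum" by (intro closure_minimal) auto
  moreover have "closure (\<iota> ` one_forms) = UNIV" using completion by (simp add: form_completion_def)
  ultimately show ?thesis by blast
qed

lemma hodge_decomposition:
  obtains x y where "x \<in> exact_forms \<iota>" "y \<in> closure (span (dz \<iota> ` gwords))" "w = x + y"
proof (rule closure_orthogonal_sum[OF subspace_exact_forms closed_exact_forms subspace_span])
  show "w \<in> closure exact_dz_sum" by (simp only: closure_exact_dz_sum UNIV_I)
qed (use exact_orthogonal_span_dz that in auto)

text \<open>Orthogonality to exact forms survives limits. Conversely, decompose a harmonic \<theta>
  as x + y with x exact: both \<theta> and y are orthogonal to x, so x is orthogonal to itself and
  vanishes.\<close>

lemma closure_span_dz: "closure (span (dz \<iota> ` gwords)) = harmonic_forms \<iota>"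
proof (intro subset_antisym subsetI)
  fix y assume "y \<in> closure (span (dz \<iota> ` gwords))"
  then obtain b where b: "\<And>n. b n \<in> span (dz \<iota> ` gwords)" "b \<longlonglongrightarrow> y" unfolding closure_sequential by blast
  have "inner y \<eta> = 0" if e: "\<eta> \<in> exact_forms \<iota>" for \<eta>
  proof -
    have "(\<lambda>n. inner (b n) \<eta>) \<longlonglongrightarrow> inner y \<eta>" by (intro tendsto_intros b)
    moreover have "inner (b n) \<eta> = 0" for n using exact_orthogonal_span_dz[OF e b(1)] by (simp add: inner_commute)
    ultimately show ?thesis by (simp add: LIMSEQ_const_iff)
  qed
  then show "y \<in> harmonic_forms \<iota>" by (simp add: harmonic_forms_def co_closed_def)
next
  fix \<theta> assume h: "\<theta> \<in> harmonic_forms \<iota>"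
  obtain x y where xy: "x \<in> exact_forms \<iota>" "y \<in> closure (span (dz \<iota> ` gwords))" "\<theta> = x + y"
    by (rule hodge_decomposition)
  obtain b where b: "\<And>n. b n \<in> span (dz \<iota> ` gwords)" "b \<longlonglongrightarrow> y" using xy(2) unfolding closure_sequential by blast
  have "(\<lambda>n. inner x (b n)) \<longlonglongrightarrow> inner x y" by (intro tendsto_intros b)
  then have "inner x y = 0" using exact_orthogonal_span_dz[OF xy(1) b(1)] by (simp add: LIMSEQ_const_iff)
  moreover have "inner \<theta> x = 0" using h xy(1) by (simp add: harmonic_forms_def co_closed_def)
  ultimately have "inner x x = 0" by (simp add: xy(3) inner_add_left inner_commute[of y x])
  then show "\<theta> \<in> closure (span (dz \<iota> ` gwords))" using xy by simp
qed

end

theorem theorem2p27: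
  fixes \<iota> :: "form \<Rightarrow> 'h::{real_inner, complete_space}"
  assumes "form_completion \<iota>"
  shows
    "(\<forall>\<omega>. \<exists>!p. p \<in> exact_forms \<iota> \<times> harmonic_forms \<iota> \<and> \<omega> = fst p + snd p) \<and>
     (\<forall>\<eta>\<in>exact_forms \<iota>. \<forall>\<theta>\<in>harmonic_forms \<iota>. inner \<eta> \<theta> = 0) \<and>
     (\<forall>\<sigma>\<in>gwords. dz \<iota> \<sigma> \<in> harmonic_forms \<iota> \<and> dz \<iota> \<sigma> \<noteq> 0) \<and>
     (\<forall>\<sigma>\<in>gwords. \<forall>\<tau>\<in>gwords. \<sigma> \<noteq> \<tau> \<longrightarrow> inner (dz \<iota> \<sigma>) (dz \<iota> \<tau>) = 0) \<and>
     closure (span (dz \<iota> ` gwords)) = harmonic_forms \<iota> \<and>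
     (\<forall>\<omega>. \<exists>U\<in>finite_energy_fns. \<exists>\<theta>\<in>harmonic_forms \<iota>. \<exists>k :: nat list \<Rightarrow> real.
        \<omega> = exact_form \<iota> U + \<theta> \<and> ((\<lambda>\<sigma>. k \<sigma> *\<^sub>R dz \<iota> \<sigma>) has_sum \<theta>) gwords)"
proof -
  note closure = closure_span_dz[OF assms]
  have dec: "\<exists>x\<in>exact_forms \<iota>. \<exists>y\<in>harmonic_forms \<iota>. w = x + y" for w
    using hodge_decomposition[OF assms, of w] unfolding closure by blast
  have orth: "inner \<eta> \<theta> = 0" if "\<eta> \<in> exact_forms \<iota>" "\<theta> \<in> harmonic_forms \<iota>" for \<eta> \<theta>
    using that by (simp add: harmonic_forms_def co_closed_def inner_commute)
  have uniq: "x = x' \<and> y = y'"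
    if "x \<in> exact_forms \<iota>" "x' \<in> exact_forms \<iota>" "y \<in> harmonic_forms \<iota>" "y' \<in> harmonic_forms \<iota>" "x + y = x' + y'"
    for x x' y y'
  proof -
    have "x - x' \<in> exact_forms \<iota>" by (rule subspace_diff[OF subspace_exact_forms[OF assms] that(1,2)])
    then have "inner (x - x') (y' - y) = 0" using orth that(3,4) by (simp add: inner_diff_right)
    moreover have "y' - y = x - x'" using that(5) by (simp add: algebra_simps)
    ultimately have "x = x'" by simp
    then show ?thesis using that(5) by simp
  qed
  have "\<exists>!p. p \<in> exact_forms \<iota> \<times> harmonic_forms \<iota> \<and> w = fst p + snd p" for w
  proof -
    obtain x y where xy: "x \<in> exact_forms \<iota>" "y \<in> harmonic_forms \<iota>" "w = x + y" using dec by blast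
    show ?thesis
    proof (rule ex1I[of _ "(x, y)"])
      fix p assume *: "p \<in> exact_forms \<iota> \<times> harmonic_forms \<iota> \<and> w = fst p + snd p"
      then have "fst p + snd p = x + y" using xy(3) by metis
      then have "fst p = x \<and> snd p = y" using * xy(1,2) by (intro uniq) (simp_all add: mem_Times_iff)
      then show "p = (x, y)" by (cases p) simp
    qed (use xy in simp)
  qed
  moreover have "dz \<iota> \<sigma> \<in> harmonic_forms \<iota> \<and> dz \<iota> \<sigma> \<noteq> 0" if "\<sigma> \<in> gwords" for \<sigma>
    using inner_dz_exact[OF assms that] inner_dz_self[OF assms that]
    by (auto simp: harmonic_forms_def co_closed_def exact_forms_def)
  moreover have "\<exists>U\<in>finite_energy_fns. \<exists>\<theta>\<in>harmonic_forms \<iota>. \<exists>k :: nat list \<Rightarrow> real.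
        w = exact_form \<iota> U + \<theta> \<and> ((\<lambda>\<sigma>. k \<sigma> *\<^sub>R dz \<iota> \<sigma>) has_sum \<theta>) gwords" for w
  proof -
    obtain x y where xy: "x \<in> exact_forms \<iota>" "y \<in> harmonic_forms \<iota>" "w = x + y" using dec by blast
    then obtain U where U: "U \<in> finite_energy_fns" "x = exact_form \<iota> U" by (auto simp: exact_forms_def)
    have "((\<lambda>\<sigma>. (inner y (dz \<iota> \<sigma>) / inner (dz \<iota> \<sigma>) (dz \<iota> \<sigma>)) *\<^sub>R dz \<iota> \<sigma>) has_sum y) gwords"
    proof (rule orthogonal_expansion)
      show "inner (dz \<iota> \<sigma>) (dz \<iota> \<tau>) = 0" if "\<sigma> \<in> gwords" "\<tau> \<in> gwords" "\<sigma> \<noteq> \<tau>" for \<sigma> \<tau>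
        by (rule inner_dz_dz[OF assms that])
      show "y \<in> closure (span (dz \<iota> ` gwords))" unfolding closure by (rule xy(2))
    qed
    with U xy show ?thesis
      by (intro bexI[of _ U] bexI[of _ y] exI[of _ "\<lambda>\<sigma>. inner y (dz \<iota> \<sigma>) / inner (dz \<iota> \<sigma>) (dz \<iota> \<sigma>)"]) auto
  qed
  ultimately show ?thesis using orth inner_dz_dz[OF assms] closure by blast
qed

end
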